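(* Let $\mathbf F$ be an $\mathscr H$-valued random function, let $X_0$ be a $(0,\infty)$-valued random variable, and let $(X_n)_{n\in\mathbb N}$ be $(0,\infty)$-valued random variables whose laws are determined recursively by: for all $n\in\mathbb N$, $$X_{n+1}\ \overset{\mathrm{law}}{=}\ \mathbf F(X_n,X_n'),$$ where $X_n'$ is an independent copy of $X_n$ and $\mathbf F$ is independent of $(X_n,X'_n)$ (the law of $\mathbf F$ being the same for all $n$). Let $\eta\in(0,1)$. Assume that $$\mathbb P\big(\mathbf F\notin\{\varphi_+,\varphi_-\}\big)>0,\qquad \mathbb E\big[M^{(\eta)}_{\mathbf F}\big]<\infty\qquad\text{and}\qquad \mathbb E[\varepsilon(\mathbf F)]=\mathbb E\big[\Gamma^{0,1}_{\mathbf F}\,\varepsilon(\mathbf F)\big]=0 .$$ Set $c_*:=\tfrac92\,\mathbb E[\mathtt c(\mathbf F)]$. Then $c_*\in(0,\infty)$ and for all $y\in\mathbb R$, $$\lim_{n\to\infty}\mathbb P\Big(\frac{\log X_n}{(c_*n)^{1/3}}\le y\Big)=\int_{-\infty}^y\tfrac34(1-x^2)\,\mathbf 1_{\{|x|<1\}}\,dx .$$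
   Context: $\mathbb N=\{0,1,2,\dots\}$, $\mathbb R_+=[0,\infty)$, $\mathbb R_+^*=(0,\infty)$. The class $\mathscr H$ is the set of continuous functions $F:(\mathbb R_+^* )^2\to\mathbb R_+^*$ such that: (a) $F$ is nondecreasing in each coordinate and $1$-homogeneous, i.e. $F(zx,zy)=zF(x,y)$ for all $x,y,z>0$; (b) either $F(x,y)\ge\max(x,y)$ for all $x,y>0$, in which case we set $\varepsilon(F)=1$, or $F(x,y)\le\min(x,y)$ for all $x,y>0$, in which case we set $\varepsilon(F)=-1$; (c) for all $x>0$: if $\varepsilon(F)=1$, $\lim_{y\to0}F(x,y)=\lim_{y\to0}F(y,x)=x$, and if $\varepsilon(F)=-1$, $\lim_{y\to\infty}F(x,y)=\lim_{y\to\infty}F(y,x)=x$. Each $F\in\mathscr H$ extends continuously to $\mathbb R_+^2$ by $F(0,0)=0$ and $F(x,0)=F(0,x)=x\mathbf 1_{\{\varepsilon(F)=1\}}$ for $x>0$. An $\mathscr H$-valued random function is a random variable $\mathbf F$ with values in $C^0(\mathbb R_+^2,\mathbb R)$ (Borel measurable for the topology of uniform convergence on compact subsets) such that $\mathbb P(\mathbf F\in\mathscr H)=1$. $\varphi_+(x,y)=\max(x,y)$ and $\varphi_-(x,y)=\min(x,y)$. For $F\in\mathscr H$, set $F^*=F$ if $\varepsilon(F)=1$, and $F^*(x,y)=1/F(\frac1x,\frac1y)$ if $\varepsilon(F)=-1$. For $x>0$ set $T_F(x)=\inf\{y\in\mathbb R:F^*(e^{-x},e^{-y})<1\}\in[0,\infty)$.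 For $a\ge0$, $b>0$, $\eta\in(0,1)$ define (possibly infinite) $$\Gamma_F^{a,b}=\int_0^\infty x^a\,(T_F(x))^b\,dx,\qquad \mathtt c(F)=\Gamma_F^{1,1}+\tfrac12\Gamma_F^{0,2},\qquad M_F^{(\eta)}=\Gamma_F^{1+\eta,1}+\Gamma_F^{0,2+\eta}.$$ *)

theory Defs
  imports "HOL-Probability.Probability"
begin

definition quadrant :: "(real \<times> real) set" where
  "quadrant = {0..} \<times> {0..}"

text \<open>
  Continuous functions on the closed quadrant are represented extensionally: their value outside
  the quadrant is \<^const>\<open>undefined\<close>, so that equality of functions is equality on the quadrant.
\<close>

definition C0 :: "(real \<times> real \<Rightarrow> real) set" where
  "C0 = {f \<in> extensional quadrant. continuous_on quadrant f}"

text \<open>Uniform convergence on compact subsets.\<close>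

definition C0_topology :: "(real \<times> real \<Rightarrow> real) topology" where
  "C0_topology = topology_generated_by
     {{g \<in> C0. \<forall>p\<in>K. \<bar>g p - f p\<bar> < e} | f K e. f \<in> C0 \<and> compact K \<and> K \<subseteq> quadrant \<and> 0 < e}"

definition C0_borel :: "(real \<times> real \<Rightarrow> real) measure" where
  "C0_borel = sigma C0 {U. openin C0_topology U}"

definition above_max :: "(real \<times> real \<Rightarrow> real) \<Rightarrow> bool" where
  "above_max F \<longleftrightarrow> (\<forall>x>0. \<forall>y>0. F (x, y) \<ge> max x y)"

definition below_min :: "(real \<times> real \<Rightarrow> real) \<Rightarrow> bool" where
  "below_min F \<longleftrightarrow> (\<forall>x>0. \<forall>y>0. F (x, y) \<le> min x y)"

text \<open>
  \<^const>\<open>above_max\<close> and \<^const>\<open>below_min\<close> exclude each other, so on the class below \<open>eps F = -1\<close>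
  is equivalent to \<^term>\<open>below_min F\<close>.
\<close>

definition eps :: "(real \<times> real \<Rightarrow> real) \<Rightarrow> real" where
  "eps F = (if above_max F then 1 else -1)"

text \<open>
  The class \<open>class_H\<close> only constrains the values on the open quadrant. For an element of \<^const>\<open>C0\<close>,
  membership means that its restriction to the open quadrant is in the class; by continuity it is
  then the extension \<open>F(0,0) = 0\<close>, \<open>F(x,0) = F(0,x) = x\<close> resp. \<open>0\<close> of that restriction.
\<close>

definition class_H :: "(real \<times> real \<Rightarrow> real) set" where
  "class_H = {F.
     continuous_on ({0<..} \<times> {0<..}) F \<and>
     (\<forall>x>0. \<forall>y>0. F (x, y) > 0) \<and>
     (\<forall>x>0. \<forall>x'>0. \<forall>y>0. x \<le> x' \<longrightarrow> F (x, y) \<le> F (x', y)) \<and>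
     (\<forall>x>0. \<forall>y>0. \<forall>y'>0. y \<le> y' \<longrightarrow> F (x, y) \<le> F (x, y')) \<and>
     (\<forall>x>0. \<forall>y>0. \<forall>z>0. F (z * x, z * y) = z * F (x, y)) \<and>
     (above_max F \<or> below_min F) \<and>
     (eps F = 1 \<longrightarrow> (\<forall>x>0. ((\<lambda>y. F (x, y)) \<longlongrightarrow> x) (at_right 0) \<and>
                            ((\<lambda>y. F (y, x)) \<longlongrightarrow> x) (at_right 0))) \<and>
     (eps F = -1 \<longrightarrow> (\<forall>x>0. ((\<lambda>y. F (x, y)) \<longlongrightarrow> x) at_top \<and>
                             ((\<lambda>y. F (y, x)) \<longlongrightarrow> x) at_top))}"

definition phi_plus :: "real \<times> real \<Rightarrow> real" where
  "phi_plus = (\<lambda>(x, y)\<in>quadrant. max x y)"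

definition phi_minus :: "real \<times> real \<Rightarrow> real" where
  "phi_minus = (\<lambda>(x, y)\<in>quadrant. min x y)"

definition H_random_function :: "'a measure \<Rightarrow> ('a \<Rightarrow> real \<times> real \<Rightarrow> real) \<Rightarrow> bool" where
  "H_random_function M F \<longleftrightarrow> F \<in> measurable M C0_borel \<and> (AE \<omega> in M. F \<omega> \<in> class_H)"

text \<open>
  Independence of two random variables with values in measurable spaces over possibly different
  types (the library's \<open>indep_var\<close> requires a common value type).
\<close>

definition indep_rv ::
    "'a measure \<Rightarrow> 'b measure \<Rightarrow> ('a \<Rightarrow> 'b) \<Rightarrow> 'c measure \<Rightarrow> ('a \<Rightarrow> 'c) \<Rightarrow> bool" where
  "indep_rv M S A T B \<longleftrightarrow> A \<in> measurable M S \<and> B \<in> measurable M T \<and>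
     prob_space.indep_set M (sets (vimage_algebra (space M) A S))
                            (sets (vimage_algebra (space M) B T))"

definition star :: "(real \<times> real \<Rightarrow> real) \<Rightarrow> real \<times> real \<Rightarrow> real" where
  "star F = (if eps F = 1 then F else (\<lambda>(x, y). 1 / F (1 / x, 1 / y)))"

definition T_fun :: "(real \<times> real \<Rightarrow> real) \<Rightarrow> real \<Rightarrow> real" where
  "T_fun F x = Inf {y. star F (exp (- x), exp (- y)) < 1}"

definition Gamma_fun :: "real \<Rightarrow> real \<Rightarrow> (real \<times> real \<Rightarrow> real) \<Rightarrow> ennreal" where
  "Gamma_fun a b F = (\<integral>\<^sup>+x\<in>{0<..}. ennreal (x powr a * T_fun F x powr b) \<partial>lborel)"

definition c_fun :: "(real \<times> real \<Rightarrow> real) \<Rightarrow> ennreal" where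
  "c_fun F = Gamma_fun 1 1 F + ennreal (1 / 2) * Gamma_fun 0 2 F"

definition M_fun :: "real \<Rightarrow> (real \<times> real \<Rightarrow> real) \<Rightarrow> ennreal" where
  "M_fun \<eta> F = Gamma_fun (1 + \<eta>) 1 F + Gamma_fun 0 (2 + \<eta>) F"

definition c_star :: "'a measure \<Rightarrow> ('a \<Rightarrow> real \<times> real \<Rightarrow> real) \<Rightarrow> ennreal" where
  "c_star M F = ennreal (9 / 2) * (\<integral>\<^sup>+\<omega>. c_fun (F \<omega>) \<partial>M)"

end

theory Submission
  imports Defs
begin

text \<open>
  Let \<open>H\<^sub>n\<close> be the distribution function of \<open>ln X\<^sub>n\<close>. The recursion is \<open>H\<^sub>n\<^sub>+\<^sub>1 = \<Phi> H\<^sub>n\<close>, where \<open>\<Phi>\<close> averages the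
  effect of one step over the law of \<open>F\<close>. Two facts suffice. First, because the sign \<^const>\<open>eps\<close> is fair,
  \<open>\<Phi>\<close> is nonexpansive for the one-sided uniform distance: \<open>H \<le> K + a\<close> implies \<open>\<Phi> H \<le> \<Phi> K + a\<close>.
  Second, if \<open>K\<close> has a density \<open>h\<close> of Barenblatt shape at scale \<open>s\<close>, then expanding the double integral of
  \<open>h(u - x) h(u - y)\<close> over \<open>0 < y \<le> T\<^sub>F(x)\<close> gives \<open>\<Phi> K = K + E[c(F)] h h' + O(s\<^sup>-\<^sup>(\<^sup>3\<^sup>+\<^sup>\<eta>\<^sup>))\<close>, the first-order terms
  vanishing on average; this is one time step of the porous medium equation, solved up to \<open>O(n\<^sup>-\<^sup>2)\<close> by
  the profile at scale \<open>s = (c\<^sub>* n)\<^sup>1\<^sup>/\<^sup>3\<close>. The one-step errors \<open>O(n\<^sup>-\<^sup>1\<^sup>-\<^sup>\<eta>\<^sup>/\<^sup>3)\<close> are summable, so, starting from a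
  profile of large scale translated far to the left (or right) which dominates (or is dominated by)
  \<open>H\<^sub>0\<close> up to a small constant, the comparison persists for all times.
\<close>

section \<open>Measurability on the space of continuous functions\<close>

text \<open>Nothing is known about the regularity of the laws of \<open>ln (X n)\<close>, so only
  the explicit profile is ever expanded and these laws are reached by uniform comparison alone. In
  the expansion the region between the axes and the graph of \<open>T_fun\<close> carries a factor
  \<sigma> = \<open>eps f\<close>, and the linear Taylor term carries a second one from the
  reflection. Hence the terms with \<open>K - K^2\<close> and with \<open>Gamma_fun 0 1\<close>
  average to zero, while the flux term survives; its coefficient is the integral of
  \<open>x + y\<close> over the region, which is \<open>c_fun\<close>. The constant 9/2 is forced:
  for \<open>H = B((u - m) / s)\<close> with density profile \<open>b\<close>, the equation
  \<open>dH/dt = c h h'\<close> with \<open>h h' = -(3/2) v b(v) / s^3\<close> becomes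
  \<open>s^2 ds/dt = (3/2) c\<close>, so \<open>s^3 = (9/2) c t\<close>. The obstacle is the kink of
  the density at the edges of its support, where \<open>h'\<close> jumps. In \<open>h h'\<close> the
  factor \<open>h\<close> vanishes linearly there, and this restores second-order remainders. Errors
  of order \<open>s^-3\<close> would sum like the harmonic series; the extra moment \<eta> makes the
  sum converge, and a large starting scale makes its tail small.\<close>

lemma openin_C0_topology_subset: "openin C0_topology U \<Longrightarrow> U \<subseteq> C0"
proof -
  have "topspace C0_topology \<subseteq> C0"
    unfolding C0_topology_def by (auto simp: topology_generated_by_topspace)
  then show "openin C0_topology U \<Longrightarrow> U \<subseteq> C0" using openin_subset by fastforce
qed

lemma space_C0_borel [simp]: "space C0_borel = C0"
  unfolding C0_borel_def using openin_C0_topology_subset by (subst space_measure_of) auto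

lemma openin_C0_borel: "openin C0_topology U \<Longrightarrow> U \<in> sets C0_borel"
  unfolding C0_borel_def using openin_C0_topology_subset by (subst sets_measure_of) auto

text \<open>The sets \<open>f p < r\<close> are open, being unions of basic neighbourhoods with
  \<open>K = {p}\<close> and radius \<open>r - f p\<close>. Off the quadrant, extensionality makes
  the evaluation constant.\<close>

lemma eval_measurable_point: "(\<lambda>f. f p) \<in> borel_measurable C0_borel"
proof (cases "p \<in> quadrant")
  case False
  then have eq: "f p = undefined" if "f \<in> space C0_borel" for f
  proof -
    have "f \<in> extensional quadrant" using that unfolding space_C0_borel C0_def by blast
    then show ?thesis using False by (rule extensional_arb)
  qed
  show ?thesis
    by (rule iffD2[OF measurable_cong borel_measurable_const]) (rule eq)
next
  case True
  show ?thesis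
  proof (rule borel_measurableI_less)
    fix r :: real
    let ?U = "{f \<in> C0. f p < r}"
    have eq: "?U = \<Union>{{g \<in> C0. \<forall>q\<in>{p}. \<bar>g q - f q\<bar> < r - f p} | f. f \<in> ?U}"
      (is "_ = \<Union>?W")
    proof (intro equalityI subsetI)
      fix f assume "f \<in> ?U"
      then show "f \<in> \<Union>?W"
        by (intro UnionI[of "{g \<in> C0. \<forall>q\<in>{p}. \<bar>g q - f q\<bar> < r - f p}"] CollectI exI[of _ f]) simp_all
    next
      fix g assume "g \<in> \<Union>?W"
      then obtain f where "g \<in> C0" "\<bar>g p - f p\<bar> < r - f p" by blast
      then show "g \<in> ?U" by simp
    qed
    have "openin C0_topology ?U"
      unfolding C0_topology_def openin_topology_generated_by_iff
    proof (subst eq, rule generate_topology_on.UN)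
      fix k
      assume "k \<in> {{g \<in> C0. \<forall>q\<in>{p}. \<bar>g q - f q\<bar> < r - f p} | f. f \<in> ?U}"
      then obtain f where f: "f \<in> C0" "f p < r"
        and k: "k = {g \<in> C0. \<forall>q\<in>{p}. \<bar>g q - f q\<bar> < r - f p}" by auto
      show "generate_topology_on
          {{g \<in> C0. \<forall>p\<in>K. \<bar>g p - f p\<bar> < e} | f K e. f \<in> C0 \<and> compact K \<and> K \<subseteq> quadrant \<and> 0 < e} k"
        apply (rule generate_topology_on.Basis)
        using f True unfolding k
        by (intro CollectI exI[of _ f] exI[of _ "{p}"] exI[of _ "r - f p"]) auto
    qed
    then show "{f \<in> space C0_borel. f p < r} \<in> sets C0_borel"
      using openin_C0_borel by simp
  qed
qed

text \<open>Evaluation at a moving point is the limit of evaluations on the grids \<open>(1/n)\<int>\<^sup>2\<close>.\<close>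

lemma eval_measurable:
  "(\<lambda>x. fst x (snd x)) \<in> borel_measurable (C0_borel \<Otimes>\<^sub>M (borel :: (real \<times> real) measure))"
proof -
  let ?M = "C0_borel \<Otimes>\<^sub>M (borel :: (real \<times> real) measure)"
  \<comment> \<open>Rounding down keeps points of the quadrant in the quadrant, where continuity
    applies; \<open>Suc n\<close> avoids a division by zero.\<close>
  define q where "q n p = (real_of_int \<lfloor>real (Suc n) * fst p\<rfloor> / real (Suc n),
      real_of_int \<lfloor>real (Suc n) * snd p\<rfloor> / real (Suc n))" for n and p :: "real \<times> real"
  have m: "(\<lambda>x. (fst x) (q n (snd x))) \<in> borel_measurable ?M" for n
  proof -
    have "(\<lambda>x. (\<lambda>i x. (fst x) (real_of_int (fst i) / real (Suc n), real_of_int (snd i) / real (Suc n)))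
         (\<lfloor>real (Suc n) * fst (snd x)\<rfloor>, \<lfloor>real (Suc n) * snd (snd x)\<rfloor>) x) \<in> borel_measurable ?M"
    proof (rule measurable_compose_countable[where
          f="\<lambda>i x. (fst x) (real_of_int (fst i) / real (Suc n), real_of_int (snd i) / real (Suc n))" and
          g="\<lambda>x. (\<lfloor>real (Suc n) * fst (snd x)\<rfloor>, \<lfloor>real (Suc n) * snd (snd x)\<rfloor>)"])
      fix i :: "int \<times> int"
      show "(\<lambda>x. (fst x) (real_of_int (fst i) / real (Suc n), real_of_int (snd i) / real (Suc n)))
        \<in> borel_measurable ?M"
        by (rule measurable_compose[OF measurable_fst eval_measurable_point])
    next
      show "(\<lambda>x. (\<lfloor>real (Suc n) * fst (snd x)\<rfloor>, \<lfloor>real (Suc n) * snd (snd x)\<rfloor>))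
          \<in> ?M \<rightarrow>\<^sub>M count_space UNIV"
      proof -
        have 1: "(\<lambda>x. \<lfloor>real (Suc n) * fst (snd x)\<rfloor>) \<in> ?M \<rightarrow>\<^sub>M count_space UNIV"
          and 2: "(\<lambda>x. \<lfloor>real (Suc n) * snd (snd x)\<rfloor>) \<in> ?M \<rightarrow>\<^sub>M count_space UNIV"
          by (simp_all add: borel_prod[symmetric])
        show ?thesis
          using measurable_Pair[OF 1 2] by (simp add: pair_measure_countable)
      qed
    qed
    then show ?thesis by (simp add: q_def)
  qed
  have conv: "(\<lambda>n. (fst x) (q n (snd x))) \<longlonglongrightarrow> (fst x) (snd x)"
    if x: "x \<in> space ?M" "snd x \<in> quadrant" for x
  proof -
    have f: "continuous_on quadrant (fst x)"
      using x by (auto simp: space_pair_measure C0_def)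
    have lim: "(\<lambda>n. real_of_int \<lfloor>real (Suc n) * t\<rfloor> / real (Suc n)) \<longlonglongrightarrow> t" for t
    proof (rule LIMSEQ_I)
      fix r :: real assume "r > 0"
      then obtain N where N: "inverse (real (Suc N)) < r" using reals_Archimedean by blast
      have "norm (real_of_int \<lfloor>real (Suc n) * t\<rfloor> / real (Suc n) - t) < r" if "n \<ge> N" for n
      proof -
        define k where "k = real (Suc n)"
        have k: "k > 0" "real (Suc N) \<le> k" using that by (auto simp: k_def)
        have "real_of_int \<lfloor>k * t\<rfloor> / k - t = (real_of_int \<lfloor>k * t\<rfloor> - k * t) / k"
          using k by (simp add: diff_divide_distrib)
        then have "\<bar>real_of_int \<lfloor>k * t\<rfloor> / k - t\<bar> = \<bar>real_of_int \<lfloor>k * t\<rfloor> - k * t\<bar> / k"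
          using k by simp
        also have "\<dots> \<le> 1 / k" using k by (intro divide_right_mono) linarith+
        also have "\<dots> \<le> inverse (real (Suc N))"
          unfolding inverse_eq_divide using k by (intro divide_left_mono) auto
        finally show ?thesis using N by (simp add: k_def)
      qed
      then show "\<exists>no. \<forall>n\<ge>no. norm (real_of_int \<lfloor>real (Suc n) * t\<rfloor> / real (Suc n) - t) < r"
        by blast
    qed
    have "(\<lambda>n. q n (snd x)) \<longlonglongrightarrow> snd x"
      unfolding q_def by (subst (2) prod.collapse[symmetric]) (intro tendsto_Pair lim)
    moreover have "q n (snd x) \<in> quadrant" for n
      using x by (auto simp: q_def quadrant_def mem_Times_iff)
    ultimately show ?thesis
      using x f unfolding continuous_on_sequentially by (auto simp: o_def)
  qed
  have qm: "{x \<in> space ?M. snd x \<in> quadrant} \<in> sets ?M"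
  proof -
    have "quadrant \<in> sets borel"
      unfolding quadrant_def by (intro borel_closed closed_Times closed_atLeast)
    from measurable_sets[OF measurable_snd this, of C0_borel] show ?thesis
      by (simp add: vimage_def Int_def conj_commute)
  qed
  \<comment> \<open>The grid limit is available only on the quadrant; elsewhere every element of
    \<open>C0\<close> has the same value.\<close>
  have mm: "(\<lambda>x. if snd x \<in> quadrant then fst x (snd x) else undefined) \<in> borel_measurable ?M"
  proof (rule borel_measurable_LIMSEQ_real)
    fix n
    show "(\<lambda>x. if snd x \<in> quadrant then (fst x) (q n (snd x)) else undefined) \<in> borel_measurable ?M"
      using qm m by (intro measurable_If) auto
  qed (use conv in auto)
  have eq: "(if snd x \<in> quadrant then fst x (snd x) else undefined) = fst x (snd x)"
    if "x \<in> space ?M" for x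
  proof -
    have "fst x \<in> extensional quadrant" using that by (simp add: space_pair_measure C0_def mem_Times_iff)
    from extensional_arb[OF this, of "snd x"] show ?thesis by simp
  qed
  show ?thesis
    by (rule iffD1[OF measurable_cong mm]) (rule eq)
qed

lemma measurable_eval:
  assumes "f \<in> M \<rightarrow>\<^sub>M C0_borel" "g \<in> borel_measurable M"
  shows "(\<lambda>x. f x (g x)) \<in> borel_measurable M"
  using measurable_compose[OF measurable_Pair[OF assms] eval_measurable] unfolding fst_conv snd_conv .

section \<open>Measurability of \<open>eps\<close>, of \<open>T_fun\<close> and of its
  moments\<close>

lemma eval_exp_continuous:
  assumes "f \<in> C0"
  shows "continuous_on UNIV (\<lambda>y. f (exp (a + b * y), exp (c + d * y)))"
proof -
  have "continuous_on UNIV (f \<circ> (\<lambda>y. (exp (a + b * y), exp (c + d * y))))"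
  proof (rule continuous_on_compose)
    have "range (\<lambda>y. (exp (a + b * y), exp (c + d * y))) \<subseteq> quadrant"
      by (auto simp: quadrant_def)
    then show "continuous_on (range (\<lambda>y. (exp (a + b * y), exp (c + d * y)))) f"
      using assms continuous_on_subset by (auto simp: C0_def)
  qed (intro continuous_intros)
  then show ?thesis by (simp add: o_def)
qed

text \<open>By continuity a violation of the inequality persists on an open set, which contains a
  rational point; this replaces the uncountable quantifier by a countable one.\<close>

lemma above_max_sets: "{f \<in> C0. above_max f} \<in> sets C0_borel"
proof -
  have "above_max f \<longleftrightarrow> (\<forall>x\<in>\<rat>. \<forall>y\<in>\<rat>. x > 0 \<longrightarrow> y > 0 \<longrightarrow> f (x, y) \<ge> max x y)" (is "_ \<longleftrightarrow> ?R")
    if f: "f \<in> C0" for f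
  proof
    assume R: ?R
    let ?P = "{0<..} \<times> {0<..} :: (real \<times> real) set"
    have c: "continuous_on ?P (\<lambda>p. f p - max (fst p) (snd p))"
    proof -
      have "continuous_on ?P f"
        using f by (auto simp: C0_def quadrant_def intro: continuous_on_subset)
      then show ?thesis by (intro continuous_intros)
    qed
    show "above_max f" unfolding above_max_def
    proof (intro allI impI, rule ccontr)
      fix x y :: real
      assume xy: "x > 0" "y > 0" "\<not> max x y \<le> f (x, y)"
      define V where "V = (\<lambda>p. f p - max (fst p) (snd p)) -` {..<0} \<inter> ?P"
      have "open V"
        unfolding V_def by (rule continuous_open_preimage[OF c, unfolded Int_commute[of ?P]])
          (auto intro: open_Times)
      moreover have "(x, y) \<in> V" using xy by (auto simp: V_def)
      ultimately obtain A B where AB: "open A" "open B" "x \<in> A" "y \<in> B" "A \<times> B \<subseteq> V"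
        by (auto elim!: open_prod_elim)
      have "\<exists>q\<in>\<rat>. q \<in> U" if "open U" "z \<in> U" for U and z :: real
        using open_Int_closure_eq_empty[OF that(1), of \<rat>] that Rats_closure_real by auto
      then obtain a b where "a \<in> A" "a \<in> \<rat>" "b \<in> B" "b \<in> \<rat>" using AB by metis
      moreover from this have "(a, b) \<in> V" using AB by auto
      ultimately show False using R by (force simp: V_def)
    qed
  qed (auto simp: above_max_def)
  then have "{f \<in> C0. above_max f} =
      {f \<in> space C0_borel. \<forall>x\<in>\<rat>. \<forall>y\<in>\<rat>. x > 0 \<longrightarrow> y > 0 \<longrightarrow> f (x, y) \<ge> max x y}"
    by auto
  also have "\<dots> \<in> sets C0_borel"
  proof -
    have "{f \<in> space C0_borel. x > 0 \<longrightarrow> y > 0 \<longrightarrow> f (x, y) \<ge> max x y} \<in> sets C0_borel" for x y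
      using borel_measurable_le[OF borel_measurable_const eval_measurable_point]
      by (cases "x > 0 \<and> y > 0") (auto simp del: max.bounded_iff intro: sets.top[of C0_borel, simplified])
    then show ?thesis
      by (intro sets.sets_Collect_countable_All' countable_rat)
  qed
  finally show ?thesis .
qed

lemma eps_measurable [measurable]: "eps \<in> borel_measurable C0_borel"
proof -
  have "(\<lambda>f. if above_max f then 1 else - 1 :: real) \<in> borel_measurable C0_borel"
    by (rule measurable_If) (simp_all add: above_max_sets)
  then show ?thesis by (simp add: eps_def[abs_def])
qed

text \<open>The event is a union over uncountably many \<open>y\<close>. Compactness makes it
  countable: the minimum is attained, and it is nonpositive exactly when rational parameters bring
  the function below every \<open>1 / Suc k\<close>.\<close>

lemma hit_interval_sets:
  fixes G :: "'b \<Rightarrow> real \<Rightarrow> real"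
  assumes "\<And>\<omega>. \<omega> \<in> space M \<Longrightarrow> continuous_on UNIV (G \<omega>)"
    and m [measurable]: "\<And>y. (\<lambda>\<omega>. G \<omega> y) \<in> borel_measurable M"
    and "a \<le> b"
  shows "{\<omega> \<in> space M. \<exists>y\<in>{a..b}. G \<omega> y \<le> 0} \<in> sets M"
proof -
  \<comment> \<open>Rational parameters of the unit interval have a dense image even when
    \<open>{a..b}\<close> is a single irrational point.\<close>
  let ?p = "\<lambda>q. a + (b - a) * q"
  let ?Q = "\<rat> \<inter> {0..1} :: real set"
  have iff: "(\<exists>y\<in>{a..b}. G \<omega> y \<le> 0) \<longleftrightarrow> (\<forall>k::nat. \<exists>q\<in>?Q. G \<omega> (?p q) < 1 / real (Suc k))"
    (is "?L \<longleftrightarrow> ?R") if \<omega>: "\<omega> \<in> space M" for \<omega>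
  proof -
    define g where "g q = G \<omega> (?p q)" for q
    have gc: "continuous_on UNIV g"
    proof -
      have "continuous_on UNIV (G \<omega> \<circ> ?p)"
        using assms(1)[OF \<omega>]
        by (intro continuous_on_compose continuous_on_add continuous_on_mult continuous_on_const
            continuous_on_id) (auto intro: continuous_on_subset)
      then show ?thesis by (simp add: g_def o_def)
    qed
    have im: "{a..b} = ?p ` {0..1}"
    proof (intro equalityI subsetI)
      fix y assume y: "y \<in> {a..b}"
      show "y \<in> ?p ` {0..1}"
      proof (cases "a = b")
        case True
        then show ?thesis using y by (intro image_eqI[of _ _ 0]) auto
      next
        case False
        then show ?thesis using y \<open>a \<le> b\<close>
          by (intro image_eqI[of _ _ "(y - a) / (b - a)"]) (auto simp: field_simps)
      qed
    next
      fix y assume "y \<in> ?p ` {0..1}"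
      then obtain q where q: "0 \<le> q" "q \<le> 1" "y = ?p q" by auto
      moreover have "(b - a) * q \<le> (b - a) * 1" "0 \<le> (b - a) * q"
        using q \<open>a \<le> b\<close> by (auto intro!: mult_left_mono simp del: mult_1_right mult.right_neutral)
      ultimately show "y \<in> {a..b}" by auto
    qed
    then have L: "?L \<longleftrightarrow> (\<exists>q\<in>{0..1}. g q \<le> 0)" by (auto simp: g_def)
    have "(\<exists>q\<in>{0..1}. g q \<le> 0) \<longleftrightarrow> (\<forall>k::nat. \<exists>q\<in>?Q. g q < 1 / real (Suc k))"
    proof
      assume "\<exists>q\<in>{0..1}. g q \<le> 0"
      then obtain q where q: "q \<in> {0..1}" "g q \<le> 0" by auto
      have cl: "{0..1} \<subseteq> closure ({0<..<1} \<inter> \<rat> :: real set)"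
      proof -
        have "{0<..<1} \<subseteq> closure ({0<..<1} \<inter> \<rat> :: real set)"
          using open_Int_closure_subset[of "{0<..<1::real}" "\<rat>"] Rats_closure_real by simp
        then have "closure {0<..<1} \<subseteq> closure ({0<..<1} \<inter> \<rat> :: real set)"
          by (rule closure_minimal) simp
        then show ?thesis by simp
      qed
      show "\<forall>k::nat. \<exists>q\<in>?Q. g q < 1 / real (Suc k)"
      proof
        fix k :: nat
        have "open (g -` {..<1 / real (Suc k)})"
          using gc by (simp add: open_vimage)
        moreover have "q \<in> g -` {..<1 / real (Suc k)} \<inter> closure ({0<..<1} \<inter> \<rat>)"
          using q subsetD[OF cl q(1)] by (auto intro: le_less_trans)
        ultimately have "g -` {..<1 / real (Suc k)} \<inter> ({0<..<1} \<inter> \<rat>) \<noteq> {}"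
          using open_Int_closure_eq_empty by blast
        then show "\<exists>q\<in>?Q. g q < 1 / real (Suc k)" by force
      qed
    next
      assume R: "\<forall>k::nat. \<exists>q\<in>?Q. g q < 1 / real (Suc k)"
      obtain q0 where q0: "q0 \<in> {0..1}" "\<And>q. q \<in> {0..1} \<Longrightarrow> g q0 \<le> g q"
        using continuous_attains_inf[of "{0..1::real}" g] gc continuous_on_subset by force
      have "g q0 \<le> 0"
      proof (rule ccontr)
        assume "\<not> g q0 \<le> 0"
        then obtain k where "inverse (real (Suc k)) < g q0"
          using reals_Archimedean[of "g q0"] by (auto simp del: of_nat_Suc)
        moreover obtain q where "q \<in> ?Q" "g q < 1 / real (Suc k)" using R by blast
        ultimately show False using q0(2)[of q] by (auto simp: inverse_eq_divide)
      qed
      then show "\<exists>q\<in>{0..1}. g q \<le> 0" using q0 by auto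
    qed
    with L show ?thesis by (simp add: g_def)
  qed
  have "{\<omega> \<in> space M. \<exists>y\<in>{a..b}. G \<omega> y \<le> 0}
      = {\<omega> \<in> space M. \<forall>k::nat. \<exists>q\<in>?Q. G \<omega> (?p q) < 1 / real (Suc k)}"
    using iff by auto
  also have "\<dots> \<in> sets M"
  proof (intro sets.sets_Collect_countable_All sets.sets_Collect_countable_Ex')
    show "countable ?Q" using countable_rat by (rule countable_subset[rotated]) auto
  qed measurable
  finally show ?thesis .
qed

text \<open>Both sides are defaults: \<open>Least\<close> of a constantly false predicate and
  \<open>Least\<close> of a constantly true one are both \<open>THE\<close> of an unsatisfiable
  predicate, so the two values coincide.\<close>

lemma Inf_real_not_bdd_below:
  assumes "\<And>r. \<exists>y<r. y \<in> (A :: real set)"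
  shows "Inf A = Inf {}"
proof -
  have 1: "(\<forall>y\<in>uminus ` A. y \<le> z) \<longleftrightarrow> False" for z
    using assms[of "- z"] by force
  have 2: "\<not> (\<forall>y. x \<le> y)" for x :: real
    by (metis lt_ex not_less)
  show ?thesis unfolding Inf_real_def Sup_real_def 1
    by (simp add: Least_def 2)
qed

text \<open>For a nonempty set bounded below, \<open>Inf < r\<close> means that some element is
  below \<open>r\<close>. On the measurable rest of the space \<open>Inf\<close> takes the constant
  default value \<open>Inf {}\<close>.\<close>

lemma Inf_measurable:
  fixes A :: "'b \<Rightarrow> real set"
  assumes E: "\<And>r. {\<omega> \<in> space M. \<exists>y<r. y \<in> A \<omega>} \<in> sets M"
  shows "(\<lambda>\<omega>. Inf (A \<omega>)) \<in> borel_measurable M"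
proof (rule borel_measurableI_less)
  fix r
  let ?E = "\<lambda>r \<omega>. \<exists>y<r. y \<in> A \<omega>"
  \<comment> \<open>Nonempty and bounded below, expressed by countably many of the events in the
    hypothesis.\<close>
  let ?P = "\<lambda>\<omega>. (\<exists>k::nat. ?E (real k) \<omega>) \<and> \<not> (\<forall>k::nat. ?E (- real k) \<omega>)"
  have m: "{\<omega> \<in> space M. ?P \<omega>} \<in> sets M"
    using E by (intro sets.sets_Collect_conj sets.sets_Collect_neg
        sets.sets_Collect_countable_Ex sets.sets_Collect_countable_All) auto
  have iff: "Inf (A \<omega>) < r \<longleftrightarrow> (if ?P \<omega> then ?E r \<omega> else Inf {} < r)" for \<omega>
  proof (cases "?P \<omega>")
    case True
    then obtain k y where k: "\<not> ?E (- real k) \<omega>" "y \<in> A \<omega>" by auto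
    then have "bdd_below (A \<omega>)" "A \<omega> \<noteq> {}" by (auto simp: bdd_below_def not_less intro!: exI[of _ "- real k"])
    then have "Inf (A \<omega>) < r \<longleftrightarrow> ?E r \<omega>" by (subst cInf_less_iff) auto
    then show ?thesis using True by simp
  next
    case False
    have "Inf (A \<omega>) = Inf {}"
    proof (cases "\<exists>k::nat. ?E (real k) \<omega>")
      case False
      then have "A \<omega> = {}" using reals_Archimedean2 by blast
      then show ?thesis by simp
    next
      case True
      with \<open>\<not> ?P \<omega>\<close> have k: "\<And>k::nat. ?E (- real k) \<omega>" by auto
      show ?thesis
      proof (rule Inf_real_not_bdd_below)
        fix r :: real
        obtain k :: nat where "- r < real k" using reals_Archimedean2 by blast
        then have "- real k < r" by simp
        then show "?E r \<omega>" using k[of k] by (meson less_trans)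
      qed
    qed
    then show ?thesis using False by (simp only: if_False)
  qed
  have gen: "{\<omega> \<in> space M. if P \<omega> then Q \<omega> else c} \<in> sets M"
    if "{\<omega> \<in> space M. P \<omega>} \<in> sets M" "{\<omega> \<in> space M. Q \<omega>} \<in> sets M" for P Q c
    unfolding if_bool_eq_disj using that
    by (intro sets.sets_Collect_disj sets.sets_Collect_conj sets.sets_Collect_neg
        sets.sets_Collect_const)
  have "{\<omega> \<in> space M. if ?P \<omega> then ?E r \<omega> else Inf {} < r} \<in> sets M"
    by (rule gen[OF m E])
  then show "{\<omega> \<in> space M. Inf (A \<omega>) < r} \<in> sets M"
    unfolding iff .
qed

text \<open>
  Outside \<^const>\<open>class_H\<close> the set in the definition of \<^const>\<open>T_fun\<close> need not be open in \<open>y\<close>, since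
  \<open>1 / 0 = 0 < 1\<close>; it is always a countable union of closed sets.
\<close>

lemma T_fun_measurable:
  "(\<lambda>z. T_fun (fst z) (snd z)) \<in> borel_measurable (C0_borel \<Otimes>\<^sub>M (borel :: real measure))"
  unfolding T_fun_def
proof (rule Inf_measurable)
  fix r :: real
  let ?M = "C0_borel \<Otimes>\<^sub>M (borel :: real measure)"
  \<comment> \<open>Strict inequalities become countable unions of closed conditions:
    \<open>G1 m z y \<le> 0\<close> says that the value is at most
    \<open>1 - 1 / Suc m\<close>.\<close>
  define G1 where "G1 m z y = fst z (exp (- snd z), exp (- y)) - 1 + 1 / real (Suc m)" for m y and z :: "(real \<times> real \<Rightarrow> real) \<times> real"
  \<comment> \<open>\<open>1 / t < 1\<close> holds for \<open>t > 1\<close> and for every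
    \<open>t \<le> 0\<close>. The minimum is nonpositive when \<open>t \<le> 0\<close> or
    \<open>t \<ge> 1 + 1 / Suc m\<close>, and it is continuous in \<open>y\<close>.\<close>
  define G2 where "G2 m z y = (let t = fst z (exp (snd z), exp y) in min t (1 + 1 / real (Suc m) - t))"
    for m y and z :: "(real \<times> real \<Rightarrow> real) \<times> real"
  let ?I = "\<lambda>m n G z. \<exists>y\<in>{- real n..r - 1 / real (Suc m)}. G z y \<le> 0"
  have cf: "continuous_on UNIV (\<lambda>y. fst z (exp (snd z), exp y))"
     "continuous_on UNIV (\<lambda>y. fst z (exp (- snd z), exp (- y)))" if "z \<in> space ?M" for z
    using that eval_exp_continuous[of "fst z" "snd z" 0 0 1]
      eval_exp_continuous[of "fst z" "- snd z" 0 0 "-1"] by (auto simp: space_pair_measure)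
  have I: "{z \<in> space ?M. ?I m n (G k) z} \<in> sets ?M" if "G = G1 \<or> G = G2" for m n k G
  proof (cases "- real n \<le> r - 1 / real (Suc m)")
    case True
    show ?thesis
    proof (rule hit_interval_sets[OF _ _ True])
      fix z assume z: "z \<in> space ?M"
      show "continuous_on UNIV (G k z)"
        using that cf[OF z] unfolding G1_def G2_def Let_def by (auto intro!: continuous_intros)
    next
      fix y
      have [measurable]: "(\<lambda>z. fst z (exp (snd z), exp y)) \<in> borel_measurable ?M"
        "(\<lambda>z. fst z (exp (- snd z), exp (- y))) \<in> borel_measurable ?M"
        by (intro measurable_eval; simp add: borel_prod[symmetric])+
      show "(\<lambda>z. G k z y) \<in> borel_measurable ?M"
        using that unfolding G1_def G2_def Let_def by (elim disjE) (simp_all)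
    qed
  next
    case False
    then have "{- real n..r - 1 / real (Suc m)} = {}" by simp
    then show ?thesis unfolding \<open>{- real n..r - 1 / real (Suc m)} = {}\<close> by simp
  qed
  have lt: "(\<exists>k. t \<le> c - 1 / real (Suc k)) \<longleftrightarrow> t < c" for t c :: real
  proof
    assume "t < c"
    then obtain k where "inverse (real (Suc k)) < c - t" using reals_Archimedean[of "c - t"] by auto
    then show "\<exists>k. t \<le> c - 1 / real (Suc k)" by (intro exI[of _ k]) (auto simp: inverse_eq_divide)
  next
    assume "\<exists>k. t \<le> c - 1 / real (Suc k)"
    then obtain k where k: "t \<le> c - 1 / real (Suc k)" by blast
    have "1 / real (Suc k) > 0" by simp
    with k show "t < c" by linarith
  qed
  have range: "(\<exists>y<r. P y) \<longleftrightarrow> (\<exists>m n. \<exists>y\<in>{- real n..r - 1 / real (Suc m)}. P y)" for P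
  proof
    assume "\<exists>y<r. P y"
    then obtain y where y: "y < r" "P y" by auto
    obtain m where "y \<le> r - 1 / real (Suc m)" using lt y by blast
    moreover obtain n :: nat where "- y \<le> real n" using real_arch_simple by blast
    ultimately show "\<exists>m n. \<exists>y\<in>{- real n..r - 1 / real (Suc m)}. P y" using y
      by (intro exI[of _ m] exI[of _ n] bexI[of _ y]) auto
  next
    assume "\<exists>m n. \<exists>y\<in>{- real n..r - 1 / real (Suc m)}. P y"
    then obtain m n y where y: "y \<in> {- real n..r - 1 / real (Suc m)}" "P y" by blast
    then have "y < r" using lt[of y r] by (simp only: atLeastAtMost_iff) blast
    with y show "\<exists>y<r. P y" by blast
  qed
  have star1: "star f (exp (- x), exp (- y)) < 1 \<longleftrightarrow> (\<exists>k. G1 k (f, x) y \<le> 0)" if "eps f = 1" for f x y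
  proof -
    have "G1 k (f, x) y \<le> 0 \<longleftrightarrow> f (exp (- x), exp (- y)) \<le> 1 - 1 / real (Suc k)" for k
      unfolding G1_def fst_conv snd_conv by linarith
    then show ?thesis using that lt[of "f (exp (- x), exp (- y))" 1] by (simp add: star_def)
  qed
  have star2: "star f (exp (- x), exp (- y)) < 1 \<longleftrightarrow> (\<exists>k. G2 k (f, x) y \<le> 0)" if "eps f \<noteq> 1" for f x y
  proof -
    define t where "t = f (exp x, exp y)"
    have G2: "G2 k (f, x) y \<le> 0 \<longleftrightarrow> t \<le> 0 \<or> - t \<le> - 1 - 1 / real (Suc k)" for k
      unfolding G2_def Let_def fst_conv snd_conv t_def[symmetric] min_le_iff_disj by linarith
    have "star f (exp (- x), exp (- y)) < 1 \<longleftrightarrow> 1 / t < 1"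
      using that by (simp add: star_def exp_minus inverse_eq_divide t_def)
    also have "\<dots> \<longleftrightarrow> t \<le> 0 \<or> - t < - 1" by (auto simp: divide_less_eq)
    also have "\<dots> \<longleftrightarrow> (\<exists>k. G2 k (f, x) y \<le> 0)"
      unfolding G2 ex_disj_distrib lt by simp
    finally show ?thesis .
  qed
  have "{z \<in> space ?M. \<exists>y<r. y \<in> {y. star (fst z) (exp (- snd z), exp (- y)) < 1}}
     = ({z \<in> space ?M. eps (fst z) = 1} \<inter> {z \<in> space ?M. \<exists>m n k. ?I m n (G1 k) z}) \<union>
       ({z \<in> space ?M. eps (fst z) \<noteq> 1} \<inter> {z \<in> space ?M. \<exists>m n k. ?I m n (G2 k) z})"
    (is "?L = ?R")
  proof (rule set_eqI)
    fix z :: "(real \<times> real \<Rightarrow> real) \<times> real"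
    have "z \<in> ?R \<longleftrightarrow> z \<in> space ?M \<and> (\<exists>m n. \<exists>y\<in>{- real n..r - 1 / real (Suc m)}.
        \<exists>k. if eps (fst z) = 1 then G1 k z y \<le> 0 else G2 k z y \<le> 0)"
      by (cases "eps (fst z) = 1"; simp only: Un_iff Int_iff mem_Collect_eq; simp; blast)
    also have "\<dots> \<longleftrightarrow> z \<in> space ?M \<and> (\<exists>m n. \<exists>y\<in>{- real n..r - 1 / real (Suc m)}.
        star (fst z) (exp (- snd z), exp (- y)) < 1)"
      using star1[of "fst z" "snd z"] star2[of "fst z" "snd z"] by (cases "eps (fst z) = 1") simp_all
    finally show "z \<in> ?L \<longleftrightarrow> z \<in> ?R" unfolding range[symmetric] by simp
  qed
  also have "\<dots> \<in> sets ?M"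
    by (intro sets.Un sets.Int sets.sets_Collect_countable_Ex I) measurable
  finally show "{z \<in> space ?M. \<exists>y<r. y \<in> {y. star (fst z) (exp (- snd z), exp (- y)) < 1}} \<in> sets ?M" .
qed

lemma Gamma_fun_measurable [measurable]: "Gamma_fun a b \<in> borel_measurable C0_borel"
proof -
  have [measurable]: "(\<lambda>z. T_fun (fst z) (snd z)) \<in> borel_measurable (C0_borel \<Otimes>\<^sub>M lborel)"
    using T_fun_measurable by simp
  show ?thesis unfolding Gamma_fun_def[abs_def] by measurable
qed

lemma T_fun_measurable1:
  assumes "f \<in> C0"
  shows "T_fun f \<in> borel_measurable borel"
  using measurable_compose[OF measurable_Pair1'[of f C0_borel "borel :: real measure"] T_fun_measurable] assms
  by simp

section \<open>The class of step functions\<close>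

lemma class_H_D:
  assumes "f \<in> class_H"
  shows class_H_cont: "continuous_on ({0<..} \<times> {0<..}) f"
    and class_H_pos: "x > 0 \<Longrightarrow> y > 0 \<Longrightarrow> f (x, y) > 0"
    and class_H_mono1: "x > 0 \<Longrightarrow> x \<le> x' \<Longrightarrow> y > 0 \<Longrightarrow> f (x, y) \<le> f (x', y)"
    and class_H_mono2: "x > 0 \<Longrightarrow> y > 0 \<Longrightarrow> y \<le> y' \<Longrightarrow> f (x, y) \<le> f (x, y')"
    and class_H_homogeneous: "x > 0 \<Longrightarrow> y > 0 \<Longrightarrow> z > 0 \<Longrightarrow> f (z * x, z * y) = z * f (x, y)"
    and class_H_above: "eps f = 1 \<Longrightarrow> above_max f"
    and class_H_below: "eps f = -1 \<Longrightarrow> below_min f"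
    and class_H_lim_plus: "eps f = 1 \<Longrightarrow> x > 0 \<Longrightarrow> ((\<lambda>y. f (x, y)) \<longlongrightarrow> x) (at_right 0)"
    and class_H_lim_minus: "eps f = -1 \<Longrightarrow> x > 0 \<Longrightarrow> ((\<lambda>y. f (x, y)) \<longlongrightarrow> x) at_top"
  using assms unfolding class_H_def by (auto simp: eps_def split: if_splits)

lemma eps_cases: "eps f = 1 \<or> eps f = -1"
  by (simp add: eps_def)

lemma star_plus: "eps f = 1 \<Longrightarrow> star f = f"
  by (simp add: star_def)

lemma star_minus: "eps f = -1 \<Longrightarrow> star f (x, y) = 1 / f (1 / x, 1 / y)"
  by (simp add: star_def)

text \<open>Conjugation by inversion exchanges \<open>min\<close> with \<open>max\<close> and
  infinity with \<open>0\<close>, so \<open>star f\<close> behaves like a function of positive sign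
  in both cases. The facts about \<open>T_fun\<close> below rest on these properties.\<close>

lemma
  assumes f: "f \<in> class_H"
  shows star_ge: "x > 0 \<Longrightarrow> y > 0 \<Longrightarrow> max x y \<le> star f (x, y)"
    and star_mono: "x > 0 \<Longrightarrow> x \<le> x' \<Longrightarrow> y > 0 \<Longrightarrow> y \<le> y' \<Longrightarrow> star f (x, y) \<le> star f (x', y')"
    and star_homogeneous: "x > 0 \<Longrightarrow> y > 0 \<Longrightarrow> z > 0 \<Longrightarrow> star f (z * x, z * y) = z * star f (x, y)"
    and star_lim: "x > 0 \<Longrightarrow> ((\<lambda>y. star f (x, y)) \<longlongrightarrow> x) (at_right 0)"
proof -
  consider (1) "eps f = 1" | (2) "eps f = -1" using eps_cases by blast
  then show "max x y \<le> star f (x, y)" if "x > 0" "y > 0"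
  proof cases
    case 1
    then show ?thesis using class_H_above[OF f 1] that by (auto simp: star_plus above_max_def)
  next
    case 2
    have "f (1 / x, 1 / y) \<le> min (1 / x) (1 / y)"
      using class_H_below[OF f 2] that by (auto simp: below_min_def)
    moreover have "f (1 / x, 1 / y) > 0" using class_H_pos[OF f] that by simp
    ultimately show ?thesis using that 2 by (simp add: star_minus field_simps)
  qed
  have mono: "f (x, y) \<le> f (x', y')" if "x > 0" "x \<le> x'" "y > 0" "y \<le> y'" for x x' y y'
    using class_H_mono1[OF f, of x x' y] class_H_mono2[OF f, of x' y y'] that by linarith
  consider (1) "eps f = 1" | (2) "eps f = -1" using eps_cases by blast
  then show "star f (x, y) \<le> star f (x', y')" if "x > 0" "x \<le> x'" "y > 0" "y \<le> y'"
  proof cases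
    case 1
    then show ?thesis using mono that by (simp add: star_plus)
  next
    case 2
    have "f (1 / x', 1 / y') \<le> f (1 / x, 1 / y)" using that by (intro mono) (auto simp: field_simps)
    moreover have "f (1 / x', 1 / y') > 0" using class_H_pos[OF f] that by simp
    ultimately show ?thesis using 2 by (simp add: star_minus frac_le)
  qed
  consider (1) "eps f = 1" | (2) "eps f = -1" using eps_cases by blast
  then show "star f (z * x, z * y) = z * star f (x, y)" if "x > 0" "y > 0" "z > 0"
  proof cases
    case 1
    then show ?thesis using class_H_homogeneous[OF f] that by (simp add: star_plus)
  next
    case 2
    have "f ((1 / z) * (1 / x), (1 / z) * (1 / y)) = (1 / z) * f (1 / x, 1 / y)"
      using that by (intro class_H_homogeneous[OF f]) auto
    then show ?thesis using 2 that by (simp add: star_minus mult.commute)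
  qed
  consider (1) "eps f = 1" | (2) "eps f = -1" using eps_cases by blast
  then show "((\<lambda>y. star f (x, y)) \<longlongrightarrow> x) (at_right 0)" if "x > 0"
  proof cases
    case 1
    then show ?thesis using class_H_lim_plus[OF f] that by (simp add: star_plus)
  next
    case 2
    have "((\<lambda>y. f (1 / x, inverse y)) \<longlongrightarrow> 1 / x) (at_right 0)"
      using class_H_lim_minus[OF f 2, of "1 / x"] that
      by (intro filterlim_compose[OF _ filterlim_inverse_at_top_right]) auto
    then have "((\<lambda>y. 1 / f (1 / x, 1 / y)) \<longlongrightarrow> 1 / (1 / x)) (at_right 0)"
      unfolding inverse_eq_divide using that by (intro tendsto_divide tendsto_const) auto
    then show ?thesis using 2 by (simp add: star_minus)
  qed
qed

section \<open>The sublevel set of \<open>star f\<close> in logarithmic coordinates\<close>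

context
  fixes f :: "real \<times> real \<Rightarrow> real"
  assumes f: "f \<in> class_H"
begin

text \<open>Since \<open>star f\<close> dominates \<open>max\<close>, the sublevel set lies in the
  open positive quadrant; this later restricts the integrals to positive distances.\<close>

lemma star_exp_nonpos: "x \<le> 0 \<or> y \<le> 0 \<Longrightarrow> star f (exp (- x), exp (- y)) \<ge> 1"
  using star_ge[OF f, of "exp (- x)" "exp (- y)"] one_le_exp_iff[of "- x"] one_le_exp_iff[of "- y"]
  by (smt (verit) exp_gt_zero)

lemma T_fun_set_bdd: "bdd_below {y. star f (exp (- x), exp (- y)) < 1}"
proof (rule bdd_belowI[of _ 0])
  fix y assume "y \<in> {y. star f (exp (- x), exp (- y)) < 1}"
  then have "\<not> y \<le> 0" using star_exp_nonpos[of x y] by auto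
  then show "0 \<le> y" by simp
qed

text \<open>The limit condition of the class enters here: as the second argument tends to
  \<open>0\<close>, \<open>star f\<close> tends to \<open>exp (- x) < 1\<close>. It makes
  \<open>T_fun\<close> a genuine infimum.\<close>

lemma T_fun_set_nonempty:
  assumes "x > 0"
  shows "{y. star f (exp (- x), exp (- y)) < 1} \<noteq> {}"
proof -
  have "\<forall>\<^sub>F y in at_right 0. star f (exp (- x), y) < 1"
    using order_tendstoD(2)[OF star_lim[OF f, of "exp (- x)"], of 1] assms by simp
  moreover have "\<forall>\<^sub>F y :: real in at_right 0. y > 0"
    by (auto simp: eventually_at_right_field intro: exI[of _ 1])
  ultimately have "\<forall>\<^sub>F y in at_right 0. y > 0 \<and> star f (exp (- x), y) < 1"
    by eventually_elim simp
  then obtain y where "y > 0" "star f (exp (- x), y) < 1"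
    using eventually_happens trivial_limit_at_right_real by blast
  then have "star f (exp (- x), exp (- (- ln y))) < 1" by simp
  then show ?thesis by blast
qed

lemma T_fun_nonneg: "x > 0 \<Longrightarrow> T_fun f x \<ge> 0"
  unfolding T_fun_def
proof (rule cInf_greatest[OF T_fun_set_nonempty])
  fix y assume "y \<in> {y. star f (exp (- x), exp (- y)) < 1}"
  then have "\<not> y \<le> 0" using star_exp_nonpos[of x y] by auto
  then show "0 \<le> y" by simp
qed

lemma star_lt_imp_T_fun_le: "star f (exp (- x), exp (- y)) < 1 \<Longrightarrow> T_fun f x \<le> y"
  unfolding T_fun_def using T_fun_set_bdd by (intro cInf_lower) auto

text \<open>With \<open>star_lt_imp_T_fun_le\<close>, this leaves only the case
  \<open>y = T_fun f x\<close> undecided, which is Lebesgue null on each vertical line.\<close>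

lemma T_fun_lt_imp_star_lt:
  assumes "x > 0" "T_fun f x < y"
  shows "star f (exp (- x), exp (- y)) < 1"
proof -
  obtain z where "star f (exp (- x), exp (- z)) < 1" "z < y"
    using assms cInf_lessD[OF T_fun_set_nonempty] unfolding T_fun_def by blast
  then show ?thesis
    using star_mono[OF f, of "exp (- x)" "exp (- x)" "exp (- y)" "exp (- z)"] by simp
qed

text \<open>Used to upgrade vanishing almost everywhere to vanishing at every positive
  point.\<close>

lemma T_fun_antimono:
  assumes "x > 0" "x \<le> x'"
  shows "T_fun f x' \<le> T_fun f x"
proof (rule dense_ge)
  fix y assume "T_fun f x < y"
  then have "star f (exp (- x), exp (- y)) < 1" using assms T_fun_lt_imp_star_lt by simp
  then have "star f (exp (- x'), exp (- y)) < 1"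
    using star_mono[OF f, of "exp (- x')" "exp (- x)" "exp (- y)" "exp (- y)"] assms by simp
  then show "T_fun f x' \<le> y" by (rule star_lt_imp_T_fun_le)
qed

lemma class_H_exp_shift: "f (exp (a + t), exp (b + t)) = exp t * f (exp a, exp b)"
  using class_H_homogeneous[OF f, of "exp a" "exp b" "exp t"] by (simp add: exp_add mult.commute)

text \<open>By homogeneity only the distances of the logarithms to the level \<open>u\<close>
  matter, here measured downwards.\<close>

lemma star_lt_iff_plus:
  assumes "eps f = 1"
  shows "star f (exp (- (u - a)), exp (- (u - b))) < 1 \<longleftrightarrow> f (exp a, exp b) < exp u"
proof -
  have "f (exp a, exp b) = exp u * f (exp (a - u), exp (b - u))"
    using class_H_exp_shift[of "a - u" u "b - u"] by simp
  then show ?thesis using assms by (simp add: star_plus)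
qed

text \<open>Distances are now measured upwards, and the sublevel set describes an output above the
  level; the distribution function is then read off from the complement.\<close>

lemma star_lt_iff_minus:
  assumes "eps f = -1"
  shows "star f (exp (- (a - u)), exp (- (b - u))) < 1 \<longleftrightarrow> f (exp a, exp b) > exp u"
proof -
  have "star f (exp (- (a - u)), exp (- (b - u))) = 1 / f (exp (a - u), exp (b - u))"
    using assms by (simp add: star_minus exp_minus[symmetric] inverse_eq_divide[symmetric])
  moreover have "f (exp (a - u), exp (b - u)) > 0" by (simp add: class_H_pos[OF f])
  moreover have "f (exp a, exp b) = exp u * f (exp (a - u), exp (b - u))"
    using class_H_exp_shift[of "a - u" u "b - u"] by simp
  ultimately show ?thesis by (simp add: divide_less_eq)
qed

lemma class_H_exp_continuous: "continuous_on UNIV (\<lambda>p. f (exp (fst p), exp (snd p)))"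
proof -
  have "continuous_on UNIV (f \<circ> (\<lambda>p. (exp (fst p), exp (snd p))))"
    by (intro continuous_on_compose continuous_intros continuous_on_subset[OF class_H_cont[OF f]]) auto
  then show ?thesis by (simp add: o_def)
qed

lemma class_H_exp_measurable [measurable]:
  "(\<lambda>p. f (exp (fst p), exp (snd p))) \<in> borel_measurable borel"
  using class_H_exp_continuous by (rule borel_measurable_continuous_onI)

lemma measurable_step_set:
  "{p. f (exp (fst p), exp (snd p)) \<le> exp u} \<in> sets (borel \<Otimes>\<^sub>M borel)"
proof -
  have fm [measurable]: "(\<lambda>p. f (exp (fst p), exp (snd p))) \<in> borel_measurable (borel \<Otimes>\<^sub>M borel)"
    using class_H_exp_measurable by (simp add: borel_prod)
  have "{p \<in> space (borel \<Otimes>\<^sub>M borel). f (exp (fst p), exp (snd p)) \<le> exp u} \<in> sets (borel \<Otimes>\<^sub>M borel)"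
    by measurable
  then show ?thesis by (simp add: space_pair_measure)
qed

text \<open>By homogeneity, the level set meets each line of direction \<open>(1, 1)\<close> in a single point.\<close>

lemma class_H_level_null: "AE p in lborel \<Otimes>\<^sub>M lborel. f (exp (fst p), exp (snd p)) \<noteq> exp u"
proof -
  have m [measurable]: "(\<lambda>p. f (exp (fst p), exp (snd p))) \<in> borel_measurable (lborel \<Otimes>\<^sub>M lborel)"
    by (subst lborel_prod) simp
  have m': "(\<lambda>p. f (exp (fst p), exp (fst p + snd p))) \<in> borel_measurable (lborel \<Otimes>\<^sub>M lborel)"
  proof -
    have "(\<lambda>p :: real \<times> real. (fst p, fst p + snd p)) \<in> borel_measurable borel"
      by (intro borel_measurable_continuous_onI continuous_intros)
    from measurable_compose[OF this class_H_exp_measurable]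
    show ?thesis unfolding fst_conv snd_conv by (subst lborel_prod) simp
  qed
  have N: "{p \<in> space (lborel \<Otimes>\<^sub>M lborel). f (exp (fst p), exp (snd p)) = exp u} \<in> sets (lborel \<Otimes>\<^sub>M lborel)"
    by (rule borel_measurable_eq[OF m borel_measurable_const])
  let ?N = "{p \<in> space (lborel \<Otimes>\<^sub>M lborel). f (exp (fst p), exp (snd p)) = exp u}"
  have "emeasure (lborel \<Otimes>\<^sub>M lborel) ?N
     = (\<integral>\<^sup>+p. indicator {exp u} (f (exp (fst p), exp (snd p))) \<partial>(lborel \<Otimes>\<^sub>M lborel))"
    unfolding nn_integral_indicator[OF N, symmetric]
    by (rule nn_integral_cong) (simp add: indicator_def)
  also have "\<dots> = (\<integral>\<^sup>+a. \<integral>\<^sup>+b. indicator {exp u} (f (exp a, exp b)) \<partial>lborel \<partial>lborel)"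
    by (subst lborel.nn_integral_fst[symmetric]) (simp_all)
  \<comment> \<open>The shear \<open>b = a + d\<close>, followed by exchanging the integrals,
    integrates along these lines.\<close>
  also have "\<dots> = (\<integral>\<^sup>+a. \<integral>\<^sup>+d. indicator {exp u} (f (exp a, exp (a + d))) \<partial>lborel \<partial>lborel)"
  proof (rule nn_integral_cong)
    fix a :: real
    have "(\<lambda>b. f (exp a, exp b)) \<in> borel_measurable borel"
      using measurable_compose[OF measurable_Pair1'[of a lborel lborel] m] by simp
    then have "(\<lambda>b. indicator {exp u} (f (exp a, exp b)) :: ennreal) \<in> borel_measurable borel"
      by measurable
    from nn_integral_real_affine[OF this, of 1 a]
    show "(\<integral>\<^sup>+b. indicator {exp u} (f (exp a, exp b)) \<partial>lborel) =
        (\<integral>\<^sup>+d. indicator {exp u} (f (exp a, exp (a + d))) \<partial>lborel)" by simp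
  qed
  also have "\<dots> = (\<integral>\<^sup>+d. \<integral>\<^sup>+a. indicator {exp u} (f (exp a, exp (a + d))) \<partial>lborel \<partial>lborel)"
    using lborel_pair.Fubini[of "\<lambda>p. indicator {exp u} (f (exp (fst p), exp (fst p + snd p)))"] m' by simp
  also have "\<dots> = (\<integral>\<^sup>+(d :: real). 0 \<partial>lborel)"
  proof (rule nn_integral_cong)
    fix d :: real
    have "indicator {exp u} (f (exp a, exp (a + d))) = (indicator {u - ln (f (1, exp d))} a :: ennreal)" for a
    proof -
      have p: "f (1, exp d) > 0" by (simp add: class_H_pos[OF f])
      have "f (exp a, exp (a + d)) = exp a * f (1, exp d)"
        using class_H_exp_shift[of 0 a d] by (simp add: add.commute)
      also have "\<dots> = exp (a + ln (f (1, exp d)))" using p by (simp add: exp_add)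
      finally show ?thesis by (simp add: indicator_def)
    qed
    then show "(\<integral>\<^sup>+a. indicator {exp u} (f (exp a, exp (a + d))) \<partial>lborel) = 0" by simp
  qed
  finally have "emeasure (lborel \<Otimes>\<^sub>M lborel) ?N = 0" by simp
  then show ?thesis
    using N by (intro AE_I[of _ _ ?N]) auto
qed

end

section \<open>Degenerate step functions\<close>

lemma star_eq_max_if_T_fun_zero:
  assumes f: "f \<in> class_H" and T: "\<And>x. x > 0 \<Longrightarrow> T_fun f x = 0" and xy: "x > 0" "y > 0"
  shows "star f (x, y) = max x y"
proof (rule antisym)
  show "star f (x, y) \<le> max x y"
  proof (rule dense_ge)
    fix z assume z: "max x y < z"
    then have z0: "z > 0" using xy by simp
    \<comment> \<open>Dividing by \<open>z\<close> makes both logarithmic coordinates positive,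
      hence strictly above the graph of the zero function; homogeneity then gives
      \<open>star f (x, y) < z\<close>.\<close>
    have "x / z < 1" "y / z < 1" "x / z > 0" "y / z > 0" using z xy z0 by simp_all
    then have "star f (exp (- (- ln (x / z))), exp (- (- ln (y / z)))) < 1"
      using T[of "- ln (x / z)"] by (intro T_fun_lt_imp_star_lt[OF f]) simp_all
    then have "star f (x / z, y / z) < 1" using xy z0 by simp
    moreover have "star f (z * (x / z), z * (y / z)) = z * star f (x / z, y / z)"
      using xy z0 by (intro star_homogeneous[OF f]) simp_all
    ultimately show "star f (x, y) \<le> z" using z0 by simp
  qed
qed (rule star_ge[OF f xy])

lemma C0_eqI:
  assumes f: "f \<in> C0" and g: "continuous_on quadrant g"
    and eq: "\<And>x y. x > 0 \<Longrightarrow> y > 0 \<Longrightarrow> f (x, y) = g (x, y)"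
  shows "f = restrict g quadrant"
proof
  fix p
  let ?P = "{0<..} \<times> {0<..} :: (real \<times> real) set"
  have cl: "closure ?P = quadrant" by (simp add: closure_Times quadrant_def)
  show "f p = restrict g quadrant p"
  proof (cases "p \<in> quadrant")
    case True
    have "continuous_on (closure ?P) (\<lambda>p. f p - g p)"
      unfolding cl using f g by (intro continuous_on_diff) (auto simp: C0_def)
    then have "f p - g p = 0"
      by (rule continuous_constant_on_closure) (use eq True cl in auto)
    then show ?thesis using True by simp
  next
    case False
    then show ?thesis using f extensional_arb[of f quadrant p] by (simp add: C0_def del: split_paired_All)
  qed
qed

lemma T_fun_zero_imp_phi:
  assumes f: "f \<in> class_H" "f \<in> C0" and T: "\<And>x. x > 0 \<Longrightarrow> T_fun f x = 0"
  shows "f \<in> {phi_plus, phi_minus}"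
proof -
  note star = star_eq_max_if_T_fun_zero[OF f(1) T]
  consider (1) "eps f = 1" | (2) "eps f = -1" using eps_cases by blast
  then show ?thesis
  proof cases
    case 1
    have "f = restrict (\<lambda>p. max (fst p) (snd p)) quadrant"
      by (rule C0_eqI[OF f(2)]) (use star 1 in \<open>auto simp: star_plus intro!: continuous_intros\<close>)
    also have "\<dots> = phi_plus" by (simp add: phi_plus_def case_prod_unfold)
    finally show ?thesis by simp
  next
    case 2
    have "f (x, y) = min x y" if "x > 0" "y > 0" for x y
    proof -
      have "1 / f (x, y) = max (1 / x) (1 / y)"
        using star[of "1 / x" "1 / y"] that 2 by (simp add: star_minus)
      then have "f (x, y) = 1 / max (1 / x) (1 / y)" by (metis div_by_1 divide_divide_eq_right mult_1)
      also have "max (1 / x) (1 / y) = 1 / min x y"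
        using that by (cases "x \<le> y") (auto simp: max_def min_def field_simps)
      finally show ?thesis by simp
    qed
    then have "f = restrict (\<lambda>p. min (fst p) (snd p)) quadrant"
      by (intro C0_eqI[OF f(2)]) (auto intro!: continuous_intros)
    also have "\<dots> = phi_minus" by (simp add: phi_minus_def case_prod_unfold)
    finally show ?thesis by simp
  qed
qed

text \<open>The summand \<open>Gamma_fun 1 1\<close> alone forces \<open>T_fun\<close> to vanish
  almost everywhere. A positive value at \<open>x\<close> would by monotonicity persist on the whole
  interval from \<open>0\<close> to \<open>x\<close>.\<close>

lemma c_fun_zero_imp_phi:
  assumes f: "f \<in> class_H" "f \<in> C0" and T_meas [measurable]: "T_fun f \<in> borel_measurable borel"
    and c: "c_fun f = 0"
  shows "f \<in> {phi_plus, phi_minus}"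
proof (rule T_fun_zero_imp_phi[OF f])
  fix x :: real assume x: "x > 0"
  have "Gamma_fun 1 1 f = 0" using c by (simp add: c_fun_def)
  then have "AE z in lborel. ennreal (z powr 1 * T_fun f z powr 1) * indicator {0<..} z = 0"
    unfolding Gamma_fun_def by (subst (asm) nn_integral_0_iff_AE) simp_all
  then have ae: "AE z in lborel. z > 0 \<longrightarrow> T_fun f z = 0"
  proof eventually_elim
    case (elim z)
    then show ?case using T_fun_nonneg[OF f(1), of z] by (auto simp: indicator_def mult_le_0_iff)
  qed
  show "T_fun f x = 0"
  proof (rule ccontr)
    assume "T_fun f x \<noteq> 0"
    then have "T_fun f x > 0" using T_fun_nonneg[OF f(1) x] by simp
    then have pos: "T_fun f z > 0" if "z \<in> {0<..<x}" for z
      using T_fun_antimono[OF f(1), of z x] that by simp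
    have "AE z in lborel. z \<notin> {0<..<x}"
      using ae by (rule eventually_mono) (use pos in force)
    then have "emeasure lborel {0<..<x} = 0"
      using AE_iff_null_sets[of "{0<..<x}" lborel] by auto
    then show False using x by simp
  qed
qed

section \<open>The Barenblatt profile\<close>

text \<open>Clamping builds the support into the argument: density and distribution function become
  polynomials in a Lipschitz function, valid on the whole line.\<close>

definition clamp1 :: "real \<Rightarrow> real" where
  "clamp1 v = max (-1) (min 1 v)"

definition bar_density :: "real \<Rightarrow> real" where
  "bar_density v = 3 / 4 * (1 - (clamp1 v)\<^sup>2)"

definition bar_cdf :: "real \<Rightarrow> real" where
  "bar_cdf v = 1 / 2 + 3 / 4 * (clamp1 v - clamp1 v ^ 3 / 3)"

text \<open>Inside the support \<open>-(3/2) v\<close> is the derivative of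
  \<open>bar_density\<close>, so this is the product of the density and its derivative. It has a
  continuous meaning at the edges too, where the derivative jumps.\<close>

definition bar_flux :: "real \<Rightarrow> real" where
  "bar_flux v = - (3 / 2) * v * bar_density v"

lemma clamp1_bounds: "-1 \<le> clamp1 v" "clamp1 v \<le> 1" "\<bar>clamp1 v\<bar> \<le> 1"
  by (auto simp: clamp1_def)

lemma clamp1_sq_le: "(clamp1 v)\<^sup>2 \<le> 1"
  using clamp1_bounds(3)[of v] abs_square_le_1 by blast

lemma clamp1_inside: "\<bar>v\<bar> \<le> 1 \<Longrightarrow> clamp1 v = v"
  by (auto simp: clamp1_def)

lemma clamp1_lipschitz: "\<bar>clamp1 v - clamp1 w\<bar> \<le> \<bar>v - w\<bar>"
  by (auto simp: clamp1_def)

lemma bar_density_nonneg: "bar_density v \<ge> 0"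
  using clamp1_sq_le[of v] by (simp add: bar_density_def)

lemma bar_density_le: "bar_density v \<le> 3 / 4"
  by (simp add: bar_density_def)

lemma bar_density_outside: "\<bar>v\<bar> \<ge> 1 \<Longrightarrow> bar_density v = 0"
  by (auto simp: bar_density_def clamp1_def abs_if max_def min_def split: if_splits)

lemma bar_density_inside: "\<bar>v\<bar> \<le> 1 \<Longrightarrow> bar_density v = 3 / 4 * (1 - v\<^sup>2)"
  by (simp add: bar_density_def clamp1_inside)

lemma continuous_clamp1: "continuous_on A clamp1"
  unfolding clamp1_def by (intro continuous_intros)

lemma continuous_bar_density: "continuous_on A bar_density"
  unfolding bar_density_def by (intro continuous_intros continuous_clamp1)

lemma continuous_bar_cdf: "continuous_on A bar_cdf"
  unfolding bar_cdf_def by (intro continuous_intros continuous_clamp1) auto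

lemma bar_density_measurable [measurable]: "bar_density \<in> borel_measurable borel"
  by (intro borel_measurable_continuous_onI continuous_bar_density)

section \<open>Regularity of the profile across the edges of its support\<close>

lemma bar_density_lipschitz: "\<bar>bar_density v - bar_density w\<bar> \<le> 3 / 2 * \<bar>v - w\<bar>"
proof -
  have "\<bar>bar_density v - bar_density w\<bar> = 3 / 4 * (\<bar>clamp1 v - clamp1 w\<bar> * \<bar>clamp1 v + clamp1 w\<bar>)"
  proof -
    have "bar_density v - bar_density w = - (3 / 4) * ((clamp1 v - clamp1 w) * (clamp1 v + clamp1 w))"
      by (simp add: bar_density_def field_simps power2_eq_square)
    then show ?thesis by (simp add: abs_mult)
  qed
  also have "\<dots> \<le> 3 / 4 * (\<bar>v - w\<bar> * 2)"
    using clamp1_bounds(3)[of v] clamp1_bounds(3)[of w]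
    by (intro mult_left_mono mult_mono clamp1_lipschitz) auto
  finally show ?thesis by simp
qed

text \<open>This pays for the kink: an increment that leaves the support is weighted by a density of
  at most the order of the increment.\<close>

lemma bar_density_le_dist:
  assumes "\<bar>v\<bar> < 1" "\<bar>w\<bar> \<ge> 1"
  shows "bar_density v \<le> 3 / 2 * \<bar>w - v\<bar>"
  using bar_density_lipschitz[of v w] bar_density_outside[OF assms(2)] bar_density_nonneg[of v]
  by (simp add: abs_minus_commute)

lemma bar_cdf_below: "v \<le> -1 \<Longrightarrow> bar_cdf v = 0"
  by (simp add: bar_cdf_def clamp1_def max_def min_def)

lemma bar_cdf_above: "v \<ge> 1 \<Longrightarrow> bar_cdf v = 1"
  by (simp add: bar_cdf_def clamp1_def max_def min_def)

text \<open>The function is cubic in the clamped variable, so its expansion there is exact. Clamped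
  and true increments differ with nonzero weight only when \<open>w\<close> leaves the support from
  inside, where the weight is itself of first order.\<close>

lemma bar_cdf_taylor: "\<bar>bar_cdf w - bar_cdf v - bar_density v * (w - v)\<bar> \<le> 4 * (w - v)\<^sup>2"
proof -
  define c d where "c = clamp1 v" and "d = clamp1 w - clamp1 v"
  have c: "\<bar>c\<bar> \<le> 1" and d: "\<bar>d\<bar> \<le> \<bar>w - v\<bar>" "\<bar>d\<bar> \<le> 2"
    using clamp1_bounds[of v] clamp1_bounds[of w] clamp1_lipschitz[of w v] by (auto simp: c_def d_def)
  have w: "clamp1 w = c + d" by (simp add: c_def d_def)
  have "bar_cdf w - bar_cdf v - bar_density v * (w - v)
      = bar_density v * (d - (w - v)) - 3 / 4 * c * d\<^sup>2 - 1 / 4 * d ^ 3"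
    unfolding bar_cdf_def bar_density_def w c_def[symmetric]
    by (simp add: field_simps power2_eq_square power3_eq_cube)
  moreover have "\<bar>bar_density v * (d - (w - v))\<bar> \<le> 3 * (w - v)\<^sup>2 / 2"
  proof (cases "\<bar>v\<bar> < 1 \<and> \<bar>w\<bar> \<ge> 1")
    case True
    have "\<bar>d - (w - v)\<bar> \<le> \<bar>w - v\<bar>"
      using True unfolding d_def by (auto simp: clamp1_def)
    then have "\<bar>bar_density v * (d - (w - v))\<bar> \<le> (3 / 2 * \<bar>w - v\<bar>) * \<bar>w - v\<bar>"
      unfolding abs_mult using bar_density_le_dist[of v w] bar_density_nonneg[of v] True
      by (intro mult_mono) auto
    then show ?thesis by (simp add: power2_eq_square abs_mult_self_eq mult.assoc)
  next
    case False
    then have "bar_density v * (d - (w - v)) = 0"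
      using bar_density_outside[of v] clamp1_inside[of v] clamp1_inside[of w]
      by (cases "\<bar>v\<bar> \<ge> 1") (auto simp: d_def)
    then show ?thesis by (simp only: abs_zero) simp
  qed
  moreover have "\<bar>3 / 4 * c * d\<^sup>2\<bar> \<le> 3 / 4 * (w - v)\<^sup>2"
  proof -
    have "\<bar>3 / 4 * c * d\<^sup>2\<bar> = 3 / 4 * (\<bar>c\<bar> * d\<^sup>2)" by (simp add: abs_mult)
    also have "\<dots> \<le> 3 / 4 * (1 * (w - v)\<^sup>2)"
      using c d(1) by (intro mult_left_mono mult_mono) (auto simp: abs_le_square_iff)
    finally show ?thesis by simp
  qed
  moreover have "\<bar>1 / 4 * d ^ 3\<bar> \<le> 1 / 2 * (w - v)\<^sup>2"
  proof -
    have "\<bar>1 / 4 * d ^ 3\<bar> = 1 / 4 * (\<bar>d\<bar> * d\<^sup>2)"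
      by (simp add: abs_mult power3_eq_cube power2_eq_square)
    also have "\<dots> \<le> 1 / 4 * (2 * (w - v)\<^sup>2)"
      using d by (intro mult_left_mono mult_mono) (auto simp: abs_le_square_iff)
    finally show ?thesis by simp
  qed
  \<comment> \<open>The constants add up to 3/2 + 3/4 + 1/2, which is below 4.\<close>
  ultimately show ?thesis using zero_le_power2[of "w - v"] by linarith
qed

text \<open>The quadratic remainder gives differentiability at all points at once, edges
  included.\<close>

lemma bar_cdf_deriv: "(bar_cdf has_real_derivative bar_density v) (at v)"
  unfolding has_field_derivative_iff
proof (rule LIM_zero_cancel, rule Lim_null_comparison)
  show "\<forall>\<^sub>F w in at v. norm ((bar_cdf w - bar_cdf v) / (w - v) - bar_density v) \<le> 4 * \<bar>w - v\<bar>"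
    unfolding eventually_at
  proof (intro exI[of _ 1] conjI ballI impI)
    fix w assume "w \<noteq> v \<and> dist w v < 1"
    then have n: "\<bar>w - v\<bar> > 0" by simp
    then have "(bar_cdf w - bar_cdf v) / (w - v) - bar_density v
        = (bar_cdf w - bar_cdf v - bar_density v * (w - v)) / (w - v)"
      by (simp add: field_simps)
    then have "norm ((bar_cdf w - bar_cdf v) / (w - v) - bar_density v)
        = \<bar>bar_cdf w - bar_cdf v - bar_density v * (w - v)\<bar> / \<bar>w - v\<bar>"
      by simp
    also have "\<dots> \<le> 4 * (w - v)\<^sup>2 / \<bar>w - v\<bar>"
      by (intro divide_right_mono bar_cdf_taylor) simp
    also have "\<dots> = 4 * \<bar>w - v\<bar>"
    proof -
      have "(w - v)\<^sup>2 = \<bar>w - v\<bar> * \<bar>w - v\<bar>" by (simp only: power2_eq_square[symmetric] power2_abs)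
      then have "(w - v)\<^sup>2 / \<bar>w - v\<bar> = \<bar>w - v\<bar>"
        using n by (metis nonzero_mult_div_cancel_right less_irrefl)
      then show ?thesis by (simp only: times_divide_eq_right[symmetric])
    qed
    finally show "norm ((bar_cdf w - bar_cdf v) / (w - v) - bar_density v) \<le> 4 * \<bar>w - v\<bar>" .
  qed simp
  show "((\<lambda>w. 4 * \<bar>w - v\<bar>) \<longlongrightarrow> 0) (at v)"
    by (rule tendsto_eq_rhs[OF tendsto_mult[OF tendsto_const tendsto_rabs[OF tendsto_diff[OF tendsto_ident_at tendsto_const]]]]) simp
qed

text \<open>
  This is the self-similarity of the Barenblatt solution of the porous medium equation. Bounding
  \<open>1 - r\<close> through \<open>(1 - r) (1 + r + r\<^sup>2) = 1 - r\<^sup>3\<close> avoids differentiating in time.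
\<close>

lemma bar_cdf_rescale:
  assumes n: "n \<ge> 1" and r: "r > 0" "r ^ 3 = n / (n + 1)"
  shows "\<bar>bar_cdf (r * v) - bar_cdf v - 2 / (9 * n) * bar_flux v\<bar> \<le> 5 / n\<^sup>2"
proof -
  have r1: "r < 1"
  proof (rule ccontr)
    assume "\<not> r < 1"
    then have "1 \<le> r ^ 3" by simp
    then show False using r n by (simp add: field_simps)
  qed
  have r13: "1 - r ^ 3 = 1 / (n + 1)" using n r by (simp add: field_simps)
  have fact: "(1 - r) * (1 + r + r\<^sup>2) = 1 / (n + 1)"
    unfolding r13[symmetric] by (simp add: algebra_simps power2_eq_square power3_eq_cube)
  have rsq: "0 < r\<^sup>2" "r\<^sup>2 \<le> r" "r\<^sup>2 \<le> 1" "r ^ 3 \<le> r"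
    using r(1) r1 power_decreasing[of 1 2 r] power_decreasing[of 1 3 r] power_decreasing[of 0 2 r] by simp_all
  have pos: "1 + r + r\<^sup>2 > 0" using r rsq by linarith
  have lo: "1 - r \<ge> 1 / (3 * (n + 1))"
  proof -
    have "1 / (n + 1) \<le> (1 - r) * 3"
      unfolding fact[symmetric] using r1 rsq by (intro mult_left_mono) auto
    then show ?thesis using n by (simp add: field_simps)
  qed
  have up: "1 - r \<le> (n + 1) / (3 * n\<^sup>2)"
  proof -
    \<comment> \<open>Since \<open>r < 1\<close>, one has \<open>r \<ge> r^3 = n / (n + 1)\<close>,
      so each of \<open>1\<close>, \<open>r\<close> and \<open>r^2\<close> is at least
      \<open>(n / (n + 1))^2\<close>.\<close>
    have "(n / (n + 1))\<^sup>2 \<le> r\<^sup>2"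
      using rsq r n by (intro power_mono) simp_all
    then have "(1 - r) * (3 * (n / (n + 1))\<^sup>2) \<le> (1 - r) * (1 + r + r\<^sup>2)"
      using r1 rsq by (intro mult_left_mono) auto
    then have "(1 - r) * (3 * (n / (n + 1))\<^sup>2) * (n + 1)\<^sup>2 \<le> 1 / (n + 1) * (n + 1)\<^sup>2"
      using fact by (intro mult_right_mono) simp_all
    also have "\<dots> = n + 1" using n by (simp add: power2_eq_square)
    also have "(1 - r) * (3 * (n / (n + 1))\<^sup>2) * (n + 1)\<^sup>2 = (1 - r) * (3 * n\<^sup>2)"
      using n by (simp add: power_divide)
    finally show ?thesis using n by (subst pos_le_divide_eq) simp_all
  qed
  have rr: "\<bar>r - 1 + 1 / (3 * n)\<bar> \<le> 1 / (3 * n\<^sup>2)"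
  proof (rule abs_leI)
    have "r - 1 + 1 / (3 * n) \<le> 1 / (3 * n) - 1 / (3 * (n + 1))" using lo by simp
    also have "\<dots> = 1 / (3 * n * (n + 1))" using n by (simp add: field_simps)
    also have "\<dots> \<le> 1 / (3 * n\<^sup>2)"
      using n by (intro divide_left_mono) (auto simp: power2_eq_square)
    finally show "r - 1 + 1 / (3 * n) \<le> 1 / (3 * n\<^sup>2)" .
    have "- (r - 1 + 1 / (3 * n)) \<le> (n + 1) / (3 * n\<^sup>2) - 1 / (3 * n)" using up by simp
    also have "\<dots> = 1 / (3 * n\<^sup>2)" using n by (simp add: field_simps power2_eq_square)
    finally show "- (r - 1 + 1 / (3 * n)) \<le> 1 / (3 * n\<^sup>2)" .
  qed
  \<comment> \<open>The split is on \<open>r * v\<close> rather than \<open>v\<close>. If it is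
    outside the support, both distribution functions agree and the flux vanishes. Otherwise
    \<open>\<bar>v\<bar> < 1 / r\<close>, which bounds the increment even for \<open>v\<close>
    slightly outside.\<close>
  show ?thesis
  proof (cases "\<bar>r * v\<bar> \<ge> 1")
    case True
    have "\<bar>r * v\<bar> \<le> \<bar>v\<bar>" using r r1 by (simp add: abs_mult mult_left_le_one_le)
    then have v: "\<bar>v\<bar> \<ge> 1" using True by simp
    have "bar_cdf (r * v) = bar_cdf v"
    proof (cases "v \<ge> 0")
      case p: True
      then have "r * v \<ge> 1" "v \<ge> 1" using True v r by (auto simp: abs_mult)
      then show ?thesis by (simp add: bar_cdf_above)
    next
      case p: False
      then have "r * v \<le> -1" "v \<le> -1" using True v r by (auto simp: abs_mult)
      then show ?thesis by (simp add: bar_cdf_below)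
    qed
    moreover have "bar_flux v = 0" using bar_density_outside[OF v] by (simp add: bar_flux_def)
    ultimately show ?thesis by simp
  next
    case False
    have dist: "\<bar>r * v - v\<bar> \<le> 1 / n"
    proof -
      \<comment> \<open>The factor \<open>r\<close> on the right turns \<open>\<bar>v\<bar>\<close>
        into \<open>\<bar>r * v\<bar>\<close>, which is below 1.\<close>
      have 1: "1 - r \<le> r / n"
      proof -
        have "n / (n + 1) \<le> r" using rsq r by simp
        then have "n \<le> r * (n + 1)" using n by (simp add: field_simps)
        then show ?thesis using n by (simp add: field_simps)
      qed
      have "\<bar>r * v - v\<bar> = (1 - r) * \<bar>v\<bar>"
        using r1 by (subst left_diff_distrib[symmetric, of r v 1, simplified]) (simp add: abs_mult)
      also have "\<dots> \<le> r / n * \<bar>v\<bar>" using 1 by (intro mult_right_mono) auto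
      also have "\<dots> = \<bar>r * v\<bar> / n" using r by (simp add: abs_mult)
      also have "\<dots> \<le> 1 / n" using False n by (intro divide_right_mono) auto
      finally show ?thesis .
    qed
    have sq: "(r * v - v)\<^sup>2 \<le> 1 / n\<^sup>2"
      using power_mono[OF dist, of 2] by (simp add: power_divide)
    have "\<bar>bar_density v * (r * v - v) - 2 / (9 * n) * bar_flux v\<bar> \<le> 1 / n\<^sup>2"
    proof -
      have "bar_density v * (r * v - v) - 2 / (9 * n) * bar_flux v
         = bar_density v * v * (r - 1 + 1 / (3 * n))"
        using n unfolding bar_flux_def by (simp add: field_simps)
      also have "\<bar>\<dots>\<bar> \<le> 3 / 4 * 1 * (1 / (3 * n\<^sup>2))"
      proof -
        have "\<bar>bar_density v * v\<bar> \<le> 3 / 4 * 1"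
        proof (cases "\<bar>v\<bar> \<ge> 1")
          case True
          then show ?thesis by (simp add: bar_density_outside)
        next
          case False
          then show ?thesis unfolding abs_mult
            using bar_density_le[of v] bar_density_nonneg[of v] by (intro mult_mono) auto
        qed
        then show ?thesis unfolding abs_mult[of "bar_density v * v"] using rr by (intro mult_mono) auto
      qed
      also have "\<dots> \<le> 1 / n\<^sup>2" using n by (simp add: field_simps)
      finally show ?thesis .
    qed
    \<comment> \<open>The Taylor remainder contributes \<open>4 / n^2\<close>, the replacement of
      \<open>r - 1\<close> by \<open>- 1 / (3 n)\<close> another \<open>1 / n^2\<close>.\<close>
    then show ?thesis using bar_cdf_taylor[of "r * v" v] sq by (simp add: field_simps) 
  qed
qed

text \<open>Inside the support the parabola is exact and leaves only \<open>-(3/4) z^2\<close>. If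
  the shift leaves the support, the remainder of the density is merely
  \<open>O(\<bar>z\<bar>)\<close>, but the factor \<open>bar_density v\<close> is
  \<open>O(\<bar>z\<bar>)\<close> as well.\<close>

lemma bar_density_product_taylor1:
  "\<bar>bar_density v * (bar_density (v - z) - bar_density v) + bar_flux v * z\<bar> \<le> 9 / 2 * z\<^sup>2"
proof (cases "\<bar>v\<bar> < 1")
  case False
  then show ?thesis by (simp add: bar_flux_def bar_density_outside)
next
  case v: True
  define e where "e = bar_density (v - z) - bar_density v - 3 / 2 * v * z"
  have eq: "bar_density v * (bar_density (v - z) - bar_density v) + bar_flux v * z = bar_density v * e"
    by (simp add: e_def bar_flux_def algebra_simps)
  show ?thesis
  proof (cases "\<bar>v - z\<bar> < 1")
    case True
    have "e = - (3 / 4) * z\<^sup>2"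
      using v True by (simp add: e_def bar_density_inside power2_eq_square field_simps)
    then have "\<bar>bar_density v * e\<bar> = bar_density v * (3 / 4 * z\<^sup>2)"
      using bar_density_nonneg[of v] by (simp add: abs_mult)
    also have "\<dots> \<le> 3 / 4 * (3 / 4 * z\<^sup>2)"
      using bar_density_le[of v] by (intro mult_right_mono) auto
    finally show ?thesis unfolding eq using zero_le_power2[of z] by linarith
  next
    case False
    have p: "bar_density v \<le> 3 / 2 * \<bar>z\<bar>"
      using bar_density_le_dist[of v "v - z"] v False by simp
    have "\<bar>e\<bar> \<le> \<bar>bar_density v\<bar> + \<bar>3 / 2 * v * z\<bar>"
      using False by (simp add: e_def bar_density_outside)
    also have "\<bar>3 / 2 * v * z\<bar> \<le> 3 / 2 * \<bar>z\<bar>"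
      using v by (simp add: abs_mult mult_left_le_one_le)
    finally have "\<bar>e\<bar> \<le> 3 * \<bar>z\<bar>" using p bar_density_nonneg[of v] by simp
    then have "\<bar>bar_density v * e\<bar> \<le> (3 / 2 * \<bar>z\<bar>) * (3 * \<bar>z\<bar>)"
      unfolding abs_mult using p bar_density_nonneg[of v] by (intro mult_mono) auto
    then show ?thesis unfolding eq by (simp add: power2_eq_square)
  qed
qed

lemma bar_flux_le: "\<bar>bar_flux v\<bar> \<le> 9 / 8"
proof (cases "\<bar>v\<bar> < 1")
  case True
  have "\<bar>bar_flux v\<bar> = 3 / 2 * (\<bar>v\<bar> * bar_density v)"
    using bar_density_nonneg[of v] by (simp add: bar_flux_def abs_mult)
  also have "\<dots> \<le> 3 / 2 * (1 * (3 / 4))"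
    using True bar_density_le[of v] bar_density_nonneg[of v] by (intro mult_left_mono mult_mono) auto
  finally show ?thesis by simp
qed (simp add: bar_flux_def bar_density_outside)

text \<open>The remainder is quadratic for small \<open>x + y\<close> and at most linear for large
  \<open>x + y\<close>. Both are dominated by the power \<open>1 + \<eta>\<close>, the one that
  \<open>M_fun\<close> controls.\<close>

lemma bar_density_product_taylor:
  assumes xy: "x > 0" "y > 0" and \<sigma>: "\<bar>\<sigma>\<bar> = 1" and \<eta>: "0 < \<eta>" "\<eta> < 1"
  shows "\<bar>bar_density (v - \<sigma> * x) * bar_density (v - \<sigma> * y) - (bar_density v)\<^sup>2
      + \<sigma> * bar_flux v * (x + y)\<bar> \<le> 18 * (x powr (1 + \<eta>) + y powr (1 + \<eta>))"
    (is "\<bar>?E\<bar> \<le> _")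
proof -
  let ?b = bar_density
  define d where "d = x + y"
  have d: "d > 0" using xy by (simp add: d_def)
  have s2: "\<sigma>\<^sup>2 = 1" using \<sigma> by (metis power2_abs power_one)
  have "\<bar>?E\<bar> \<le> 9 / 2 * d powr (1 + \<eta>)"
  proof (cases "d \<le> 1")
    case True
    \<comment> \<open>Product rule with exact remainder: two expansions in one coordinate, plus the
      product of the increments.\<close>
    have "?E = (?b v * (?b (v - \<sigma> * x) - ?b v) + bar_flux v * (\<sigma> * x))
       + (?b v * (?b (v - \<sigma> * y) - ?b v) + bar_flux v * (\<sigma> * y))
       + (?b (v - \<sigma> * x) - ?b v) * (?b (v - \<sigma> * y) - ?b v)"
      by (simp add: algebra_simps power2_eq_square)
    moreover have "\<bar>(?b (v - \<sigma> * x) - ?b v) * (?b (v - \<sigma> * y) - ?b v)\<bar> \<le> (3 / 2 * x) * (3 / 2 * y)"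
      unfolding abs_mult using bar_density_lipschitz[of "v - \<sigma> * x" v] bar_density_lipschitz[of "v - \<sigma> * y" v] xy \<sigma>
      by (intro mult_mono) (auto simp: abs_mult)
    moreover note bar_density_product_taylor1[of v "\<sigma> * x"] bar_density_product_taylor1[of v "\<sigma> * y"]
    ultimately have "\<bar>?E\<bar> \<le> 9 / 2 * (\<sigma> * x)\<^sup>2 + 9 / 2 * (\<sigma> * y)\<^sup>2 + (3 / 2 * x) * (3 / 2 * y)"
      by linarith
    also have "\<dots> = 9 / 2 * x\<^sup>2 + 9 / 2 * y\<^sup>2 + 9 / 4 * (x * y)"
      by (simp add: power_mult_distrib s2)
    also have "\<dots> \<le> 9 / 2 * d\<^sup>2"
    proof -
      have "d\<^sup>2 = x\<^sup>2 + y\<^sup>2 + 2 * (x * y)" by (simp add: d_def power2_eq_square algebra_simps)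
      moreover have "x * y \<ge> 0" using xy by simp
      ultimately show ?thesis by linarith
    qed
    also have "d\<^sup>2 \<le> d powr (1 + \<eta>)"
    proof -
      have "d powr 2 \<le> d powr (1 + \<eta>)" using True d \<eta> by (intro powr_mono') auto
      then show ?thesis using d by simp
    qed
    finally show ?thesis by simp
  next
    case False
    have 1: "0 \<le> ?b (v - \<sigma> * x) * ?b (v - \<sigma> * y)" "?b (v - \<sigma> * x) * ?b (v - \<sigma> * y) \<le> 3 / 4 * (3 / 4)"
      by (intro mult_nonneg_nonneg bar_density_nonneg)
         (intro mult_mono bar_density_le bar_density_nonneg, simp)
    have 2: "0 \<le> (?b v)\<^sup>2" "(?b v)\<^sup>2 \<le> 3 / 4 * (3 / 4)"
      unfolding power2_eq_square
      by (intro mult_nonneg_nonneg bar_density_nonneg)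
         (intro mult_mono bar_density_le bar_density_nonneg, simp)
    have "\<bar>\<sigma> * bar_flux v * (x + y)\<bar> = \<bar>bar_flux v\<bar> * d"
      using \<sigma> xy by (simp add: abs_mult d_def)
    also have "\<dots> \<le> 9 / 8 * d" using bar_flux_le d by (intro mult_right_mono) auto
    finally have "\<bar>?E\<bar> \<le> 9 / 2 * d" using 1 2 False by linarith
    also have "d \<le> d powr (1 + \<eta>)"
      using powr_mono[of 1 "1 + \<eta>" d] False \<eta> by simp
    finally show ?thesis by simp
  qed
  \<comment> \<open>As \<open>1 + \<eta> < 2\<close>, the factor \<open>2 powr (1 + \<eta>)\<close>
    is below 4; with 9/2 this makes 18.\<close>
  also have "d powr (1 + \<eta>) \<le> 4 * (x powr (1 + \<eta>) + y powr (1 + \<eta>))"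
  proof -
    have "d powr (1 + \<eta>) \<le> (2 * max x y) powr (1 + \<eta>)"
      using d \<eta> by (intro powr_mono2) (auto simp: d_def)
    also have "\<dots> = 2 powr (1 + \<eta>) * max x y powr (1 + \<eta>)"
      by (rule powr_mult)
    also have "\<dots> \<le> 4 * (x powr (1 + \<eta>) + y powr (1 + \<eta>))"
    proof (rule mult_mono)
      show "2 powr (1 + \<eta>) \<le> 4" using powr_mono[of "1 + \<eta>" 2 2] \<eta> by simp
      show "max x y powr (1 + \<eta>) \<le> x powr (1 + \<eta>) + y powr (1 + \<eta>)"
        by (cases "x \<le> y") (auto simp: max_def)
    qed auto
    finally show ?thesis .
  qed
  finally show ?thesis by simp
qed

section \<open>One step from a Barenblatt law\<close>

text \<open>The translation \<open>m\<close> stays fixed along the iteration; it is the freedom to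
  place the profile on either side of the initial law.\<close>

definition bar_law_density :: "real \<Rightarrow> real \<Rightarrow> real \<Rightarrow> real" where
  "bar_law_density m s z = bar_density ((z - m) / s) / s"

definition bar_law :: "real \<Rightarrow> real \<Rightarrow> real measure" where
  "bar_law m s = density lborel (\<lambda>z. ennreal (bar_law_density m s z))"

text \<open>The distribution function of \<open>ln (f (exp A, exp B))\<close> for independent
  \<open>A\<close> and \<open>B\<close> of law \<mu>, stated without the logarithm.\<close>

definition step_cdf :: "(real \<times> real \<Rightarrow> real) \<Rightarrow> real measure \<Rightarrow> real \<Rightarrow> real" where
  "step_cdf f \<mu> u = measure (\<mu> \<Otimes>\<^sub>M \<mu>) {p. f (exp (fst p), exp (snd p)) \<le> exp u}"

lemma bar_law_density_measurable [measurable]: "bar_law_density m s \<in> borel_measurable borel"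
  unfolding bar_law_density_def[abs_def] by measurable

lemma bar_law_density_nonneg: "s > 0 \<Longrightarrow> bar_law_density m s z \<ge> 0"
  by (simp add: bar_law_density_def bar_density_nonneg)

lemma sets_bar_law [measurable_cong, simp]: "sets (bar_law m s) = sets borel"
  and space_bar_law [simp]: "space (bar_law m s) = UNIV"
  by (simp_all add: bar_law_def)

lemma bar_law_atMost:
  assumes s: "s > 0"
  shows "emeasure (bar_law m s) {..t} = ennreal (bar_cdf ((t - m) / s))"
proof -
  \<comment> \<open>A starting point not beyond \<open>t\<close> and not inside the support, so that
    the fundamental theorem applies on \<open>{a..t}\<close> and the boundary term at
    \<open>a\<close> is \<open>0\<close>.\<close>
  define a where "a = min t (m - s)"
  have zero: "bar_law_density m s z = 0" if "z < a" for z
  proof -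
    have "(z - m) / s \<le> -1" using that s by (simp add: a_def field_simps)
    then have "\<bar>(z - m) / s\<bar> \<ge> 1" by linarith
    from bar_density_outside[OF this] show ?thesis by (simp add: bar_law_density_def)
  qed
  have "emeasure (bar_law m s) {..t} = (\<integral>\<^sup>+z. ennreal (bar_law_density m s z) * indicator {..t} z \<partial>lborel)"
    unfolding bar_law_def by (rule emeasure_density) simp_all
  also have "\<dots> = (\<integral>\<^sup>+z. ennreal (bar_law_density m s z) * indicator {a..t} z \<partial>lborel)"
    by (rule nn_integral_cong) (use zero in \<open>force simp: indicator_def\<close>)
  also have "\<dots> = ennreal (bar_cdf ((t - m) / s) - bar_cdf ((a - m) / s))"
  proof (rule nn_integral_FTC_Icc)
    fix z
    have "((\<lambda>z. bar_cdf ((z - m) / s)) has_real_derivative bar_density ((z - m) / s) * (1 / s)) (at z)"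
      by (rule DERIV_chain2[OF bar_cdf_deriv]) (use s in \<open>auto intro!: derivative_eq_intros\<close>)
    then show "((\<lambda>z. bar_cdf ((z - m) / s)) has_real_derivative bar_law_density m s z) (at z)"
      unfolding bar_law_density_def by simp
  qed (use s in \<open>auto simp: a_def bar_law_density_nonneg\<close>)
  also have "bar_cdf ((a - m) / s) = 0"
    using s by (intro bar_cdf_below) (simp add: a_def field_simps)
  finally show ?thesis by simp
qed

lemma prob_space_bar_law:
  assumes s: "s > 0"
  shows "prob_space (bar_law m s)"
proof
  have "emeasure (bar_law m s) UNIV = emeasure (bar_law m s) {..m + s}"
  proof -
    have "emeasure (bar_law m s) A = emeasure (bar_law m s) (A \<inter> {..m + s})" if "A \<in> sets borel" for A
    proof -
      have "bar_law_density m s z = 0" if "z > m + s" for z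
        using that s by (simp add: bar_law_density_def bar_density_outside field_simps)
      then show ?thesis unfolding bar_law_def using that
        by (subst (1 2) emeasure_density) (auto intro!: nn_integral_cong simp: indicator_def not_le)
    qed
    from this[of UNIV] show ?thesis by simp
  qed
  also have "\<dots> = 1" using s by (simp add: bar_law_atMost bar_cdf_above)
  finally show "emeasure (bar_law m s) (space (bar_law m s)) = 1" by simp
qed

lemma real_distribution_bar_law: "s > 0 \<Longrightarrow> real_distribution (bar_law m s)"
  by (simp add: real_distribution_def real_distribution_axioms_def prob_space_bar_law)

lemma bar_cdf_nonneg: "bar_cdf v \<ge> 0" and bar_cdf_le_1: "bar_cdf v \<le> 1"
proof -
  interpret real_distribution "bar_law 0 1" by (rule real_distribution_bar_law) simp
  have "ennreal (bar_cdf w) \<le> 1" for w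
    using bar_law_atMost[of 1 0 w] emeasure_le_1 by (metis diff_zero div_by_1 zero_less_one)
  then show "bar_cdf v \<le> 1" by simp
  \<comment> \<open>\<open>ennreal\<close> truncates negative numbers, so the lower bound needs its
    own argument: monotonicity from a point left of the support.\<close>
  have "bar_cdf (min v (-1)) \<le> bar_cdf v"
    by (rule DERIV_nonneg_imp_nondecreasing) (use bar_cdf_deriv bar_density_nonneg in auto)
  then show "bar_cdf v \<ge> 0" using bar_cdf_below[of "min v (-1)"] by simp
qed

lemma cdf_bar_law: "s > 0 \<Longrightarrow> cdf (bar_law m s) t = bar_cdf ((t - m) / s)"
  by (simp add: cdf_def measure_def bar_law_atMost bar_cdf_nonneg)

text \<open>Reflection \<open>\<sigma> = \<plusminus>1\<close> treats the two signs of \<^const>\<open>eps\<close> simultaneously.\<close>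

lemma bar_law_half_line:
  fixes m u :: real
  assumes s: "s > 0" and \<sigma>: "\<sigma> = 1 \<or> \<sigma> = -1"
  defines "K \<equiv> bar_cdf ((u - m) / s)"
  shows "(\<integral>\<^sup>+y. ennreal (bar_law_density m s (u - \<sigma> * y)) * indicator {0<..} y \<partial>lborel)
     = ennreal (if \<sigma> = 1 then K else 1 - K)"
proof -
  interpret real_distribution "bar_law m s" by (rule real_distribution_bar_law) (rule s)
  let ?h = "bar_law_density m s"
  have K: "measure (bar_law m s) {..u} = K"
    using cdf_bar_law[OF s, of m u] by (simp add: cdf_def K_def)
  have "(\<integral>\<^sup>+y. ennreal (?h (u - \<sigma> * y)) * indicator {0<..} y \<partial>lborel)
     = (\<integral>\<^sup>+z. ennreal (?h z) * indicator {z. \<sigma> * (u - z) > 0} z \<partial>lborel)"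
  proof -
    have "(\<lambda>z. ennreal (?h z) * indicator {z. 0 < \<sigma> * (u - z)} z) \<in> borel_measurable borel"
      by measurable
    moreover have "- \<sigma> \<noteq> 0" using \<sigma> by auto
    ultimately have "(\<integral>\<^sup>+z. ennreal (?h z) * indicator {z. \<sigma> * (u - z) > 0} z \<partial>lborel)
      = ennreal \<bar>- \<sigma>\<bar> * (\<integral>\<^sup>+x. ennreal (?h (u + - \<sigma> * x)) * indicator {z. 0 < \<sigma> * (u - z)} (u + - \<sigma> * x) \<partial>lborel)"
      by (rule nn_integral_real_affine)
    also have "\<dots> = (\<integral>\<^sup>+y. ennreal (?h (u - \<sigma> * y)) * indicator {0<..} y \<partial>lborel)"
      using \<sigma> by (auto intro!: nn_integral_cong simp: indicator_def)
    finally show ?thesis by simp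
  qed
  also have "\<dots> = emeasure (bar_law m s) {z. \<sigma> * (u - z) > 0}"
    unfolding bar_law_def by (rule emeasure_density[symmetric]) measurable
  also have "\<dots> = ennreal (if \<sigma> = 1 then K else 1 - K)"
  proof (cases "\<sigma> = 1")
    case True
    have "emeasure (bar_law m s) {u} = 0"
      unfolding bar_law_def by (subst emeasure_density) (auto intro!: nn_integral_0_iff_AE[THEN iffD2] AE_lborel_singleton)
    then have "emeasure (bar_law m s) {z. z < u} = emeasure (bar_law m s) {..u}"
      by (intro emeasure_eq_AE AE_I[of _ _ "{u}"]) auto
    then show ?thesis using True K by (simp add: emeasure_eq_measure)
  next
    case False
    then have "{z. \<sigma> * (u - z) > 0} = UNIV - {..u}" using \<sigma> by auto
    then show ?thesis using False K prob_compl[of "{..u}"] by (simp add: emeasure_eq_measure)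
  qed
  finally show ?thesis .
qed

section \<open>Moments of the region under the graph of \<open>T_fun\<close>\<close>

lemma nn_integral_powr_Ioc:
  assumes "T \<ge> 0" "a \<ge> 0"
  shows "(\<integral>\<^sup>+y. ennreal (y powr a) * indicator {0<..T} y \<partial>lborel) = ennreal (T powr (a + 1) / (a + 1))"
proof -
  have "(\<integral>\<^sup>+y. ennreal (y powr a) * indicator {0<..T} y \<partial>lborel)
      = (\<integral>\<^sup>+y. ennreal (if y \<in> {0..T} then y powr a else 0) \<partial>lborel)"
  proof (rule nn_integral_cong_AE)
    show "AE y in lborel. ennreal (y powr a) * indicator {0<..T} y
        = ennreal (if y \<in> {0..T} then y powr a else 0)"
      using AE_lborel_singleton[of 0] by eventually_elim (simp add: indicator_def)
  qed
  also have "\<dots> = ennreal (T powr (a + 1) / (a + 1))"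
  proof (rule nn_integral_has_integral_lborel)
    show "((\<lambda>y. if y \<in> {0..T} then y powr a else 0) has_integral T powr (a + 1) / (a + 1)) UNIV"
      unfolding has_integral_restrict_UNIV using assms by (intro has_integral_powr_from_0) simp_all
  qed simp_all
  finally show ?thesis .
qed

text \<open>In distances to the level, the region where \<open>max\<close> (or \<open>min\<close>,
  for negative sign) is still on the near side while \<open>f\<close> is not strictly there, up to
  the graph. Its area is \<open>Gamma_fun 0 1 f\<close>.\<close>

definition under_T :: "(real \<times> real \<Rightarrow> real) \<Rightarrow> (real \<times> real) set" where
  "under_T f = {p. 0 < fst p \<and> 0 < snd p \<and> snd p \<le> T_fun f (fst p)}"

context
  fixes f :: "real \<times> real \<Rightarrow> real"
  assumes f: "f \<in> class_H" and T_meas [measurable]: "T_fun f \<in> borel_measurable borel"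
begin

lemma under_T_sets [measurable]: "under_T f \<in> sets (borel \<Otimes>\<^sub>M borel)"
proof -
  have "{p \<in> space (borel \<Otimes>\<^sub>M borel). 0 < fst p \<and> 0 < snd p \<and> snd p \<le> T_fun f (fst p)}
      \<in> sets (borel \<Otimes>\<^sub>M borel)" by measurable
  then show ?thesis by (simp add: under_T_def space_pair_measure)
qed

lemma nn_integral_under_T:
  assumes [measurable]: "g \<in> borel_measurable (borel \<Otimes>\<^sub>M borel)"
  shows "(\<integral>\<^sup>+p. g p * indicator (under_T f) p \<partial>(lborel \<Otimes>\<^sub>M lborel))
    = (\<integral>\<^sup>+x\<in>{0<..}. (\<integral>\<^sup>+y. g (x, y) * indicator {0<..T_fun f x} y \<partial>lborel) \<partial>lborel)"
proof -
  have "(\<integral>\<^sup>+p. g p * indicator (under_T f) p \<partial>(lborel \<Otimes>\<^sub>M lborel))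
     = (\<integral>\<^sup>+x. \<integral>\<^sup>+y. g (x, y) * indicator (under_T f) (x, y) \<partial>lborel \<partial>lborel)"
    by (subst lborel.nn_integral_fst[symmetric]) simp_all
  also have "\<dots> = (\<integral>\<^sup>+x\<in>{0<..}. (\<integral>\<^sup>+y. g (x, y) * indicator {0<..T_fun f x} y \<partial>lborel) \<partial>lborel)"
    by (intro nn_integral_cong) (auto intro!: nn_integral_cong simp: under_T_def indicator_def)
  finally show ?thesis .
qed

lemma nn_integral_under_T_fst:
  "(\<integral>\<^sup>+p. ennreal (fst p powr a) * indicator (under_T f) p \<partial>(lborel \<Otimes>\<^sub>M lborel)) = Gamma_fun a 1 f"
  unfolding Gamma_fun_def
proof (subst nn_integral_under_T)
  show "(\<integral>\<^sup>+x\<in>{0<..}. (\<integral>\<^sup>+y. ennreal (fst (x, y) powr a) * indicator {0<..T_fun f x} y \<partial>lborel) \<partial>lborel)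
      = (\<integral>\<^sup>+x\<in>{0<..}. ennreal (x powr a * T_fun f x powr 1) \<partial>lborel)"
  proof (intro nn_integral_cong)
    fix x :: real
    show "(\<integral>\<^sup>+y. ennreal (fst (x, y) powr a) * indicator {0<..T_fun f x} y \<partial>lborel) * indicator {0<..} x
        = ennreal (x powr a * T_fun f x powr 1) * indicator {0<..} x"
    proof (cases "x > 0")
      case True
      then show ?thesis using T_fun_nonneg[OF f True]
        by (simp add: nn_integral_cmult ennreal_mult)
    qed simp
  qed
qed measurable

text \<open>The vertical integral of \<open>y powr a\<close> is a power of \<open>T_fun\<close>
  divided by \<open>a + 1\<close>. For \<open>a = 1\<close> this is the origin of the factor 1/2 in
  \<open>c_fun\<close>.\<close>

lemma nn_integral_under_T_snd:
  assumes "a \<ge> 0"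
  shows "(\<integral>\<^sup>+p. ennreal (snd p powr a) * indicator (under_T f) p \<partial>(lborel \<Otimes>\<^sub>M lborel))
    = ennreal (1 / (a + 1)) * Gamma_fun 0 (a + 1) f"
proof (subst nn_integral_under_T)
  have "(\<integral>\<^sup>+x\<in>{0<..}. (\<integral>\<^sup>+y. ennreal (snd (x, y) powr a) * indicator {0<..T_fun f x} y \<partial>lborel) \<partial>lborel)
      = (\<integral>\<^sup>+x. ennreal (1 / (a + 1)) * (ennreal (x powr 0 * T_fun f x powr (a + 1)) * indicator {0<..} x) \<partial>lborel)"
  proof (intro nn_integral_cong)
    fix x :: real
    show "(\<integral>\<^sup>+y. ennreal (snd (x, y) powr a) * indicator {0<..T_fun f x} y \<partial>lborel) * indicator {0<..} x
        = ennreal (1 / (a + 1)) * (ennreal (x powr 0 * T_fun f x powr (a + 1)) * indicator {0<..} x)"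
    proof (cases "x > 0")
      case True
      then show ?thesis using T_fun_nonneg[OF f True] assms
        by (simp add: nn_integral_powr_Ioc ennreal_mult[symmetric])
    qed simp
  qed
  also have "\<dots> = ennreal (1 / (a + 1)) * Gamma_fun 0 (a + 1) f"
    unfolding Gamma_fun_def by (rule nn_integral_cmult) measurable
  finally show "(\<integral>\<^sup>+x\<in>{0<..}. (\<integral>\<^sup>+y. ennreal (snd (x, y) powr a) * indicator {0<..T_fun f x} y \<partial>lborel) \<partial>lborel)
      = ennreal (1 / (a + 1)) * Gamma_fun 0 (a + 1) f" .
qed measurable

text \<open>On \<open>x \<le> 1\<close> powers of \<open>T_fun\<close> are compared with
  \<open>1\<close> plus the highest power, at a cost of 1 in the integral; beyond, the weight
  \<open>x powr (1 + \<eta>)\<close> dominates both \<open>1\<close> and \<open>x\<close>.\<close>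

lemma Gamma_fun_le:
  assumes \<eta>: "\<eta> > 0" and ab: "(a, b) \<in> {(0, 1), (1, 1), (0, 2)}"
  shows "Gamma_fun a b f \<le> 1 + M_fun \<eta> f"
proof -
  let ?T = "T_fun f"
  have le: "x powr a * ?T x powr b \<le> indicator {0..1} x + (x powr (1 + \<eta>) * ?T x powr 1 + x powr 0 * ?T x powr (2 + \<eta>))"
    if x: "x > 0" for x
  proof -
    have T: "?T x \<ge> 0" by (rule T_fun_nonneg[OF f x])
    have T1: "?T x \<le> 1 + ?T x powr (2 + \<eta>)"
      using powr_mono[of 1 "2 + \<eta>" "?T x"] \<eta> by (cases "?T x \<le> 1") (auto intro: order_trans)
    have T2: "?T x powr 2 \<le> 1 + ?T x powr (2 + \<eta>)"
    proof (cases "?T x \<le> 1")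
      case True
      then have "?T x powr 2 \<le> 1" using T by (simp add: power_le_one)
      then show ?thesis by (simp add: add_increasing2)
    next
      case False
      then show ?thesis using powr_mono[of 2 "2 + \<eta>" "?T x"] \<eta> by simp
    qed
    show ?thesis
    proof (cases "x \<le> 1")
      case True
      have "x * ?T x \<le> ?T x" using True x T by (simp add: mult_left_le_one_le)
      moreover have "x powr (1 + \<eta>) * ?T x powr 1 \<ge> 0" by simp
      ultimately have "x powr a * ?T x powr b \<le> 1 + ?T x powr (2 + \<eta>)"
        using ab x T T1 T2 by auto
      moreover have "0 \<le> x powr (1 + \<eta>) * ?T x" using T by simp
      moreover have "indicator {0..1} x + (x powr (1 + \<eta>) * ?T x powr 1 + x powr 0 * ?T x powr (2 + \<eta>))
          = 1 + (x powr (1 + \<eta>) * ?T x + ?T x powr (2 + \<eta>))"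
        using True x T by simp
      ultimately show ?thesis by linarith
    next
      case False
      have x1: "1 \<le> x powr (1 + \<eta>)" "x \<le> x powr (1 + \<eta>)"
        using False \<eta> ge_one_powr_ge_zero[of x "1 + \<eta>"] powr_mono[of 1 "1 + \<eta>" x] by auto
      have 1: "?T x \<le> x powr (1 + \<eta>) * ?T x" "x * ?T x \<le> x powr (1 + \<eta>) * ?T x"
        using mult_right_mono[OF x1(1) T] mult_right_mono[OF x1(2) T] by simp_all
      \<comment> \<open>An additive constant would not be integrable on this unbounded range, so
        \<open>T_fun\<close> itself takes the place of \<open>1\<close>.\<close>
      have 2: "?T x powr 2 \<le> ?T x + ?T x powr (2 + \<eta>)"
      proof (cases "?T x \<le> 1")
        case True
        then have "?T x powr 2 \<le> ?T x" using T by (simp add: power2_eq_square mult_left_le)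
        then show ?thesis by (simp add: add_increasing2)
      next
        case False
        then show ?thesis using powr_mono[of 2 "2 + \<eta>" "?T x"] \<eta> T by simp
      qed
      have 3: "?T x powr (2 + \<eta>) \<ge> 0" by simp
      have "x powr a * ?T x powr b \<le> x powr (1 + \<eta>) * ?T x + ?T x powr (2 + \<eta>)"
        using ab
      proof (elim insertE emptyE)
        assume "(a, b) = (0, 1)"
        then have "x powr a * ?T x powr b = ?T x" using x T by simp
        then show ?thesis using 1 3 by linarith
      next
        assume "(a, b) = (1, 1)"
        then have "x powr a * ?T x powr b = x * ?T x" using x T by simp
        then show ?thesis using 1 3 by linarith
      next
        assume "(a, b) = (0, 2)"
        then have "x powr a * ?T x powr b = ?T x powr 2" using x by simp
        then show ?thesis using 1 2 by linarith
      qed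
      then show ?thesis using False x T by simp
    qed
  qed
  have "Gamma_fun a b f \<le> (\<integral>\<^sup>+x. indicator {0..1} x + (ennreal (x powr (1 + \<eta>) * ?T x powr 1) * indicator {0<..} x
      + ennreal (x powr 0 * ?T x powr (2 + \<eta>)) * indicator {0<..} x) \<partial>lborel)"
    unfolding Gamma_fun_def
  proof (rule nn_integral_mono)
    fix x :: real
    show "ennreal (x powr a * ?T x powr b) * indicator {0<..} x
        \<le> indicator {0..1} x + (ennreal (x powr (1 + \<eta>) * ?T x powr 1) * indicator {0<..} x
      + ennreal (x powr 0 * ?T x powr (2 + \<eta>)) * indicator {0<..} x)"
    proof (cases "x > 0")
      case True
      have "ennreal (x powr a * ?T x powr b) \<le> ennreal (indicator {0..1} x
          + (x powr (1 + \<eta>) * ?T x powr 1 + x powr 0 * ?T x powr (2 + \<eta>)))"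
        by (rule ennreal_leI[OF le[OF True]])
      also have "\<dots> = indicator {0..1} x + (ennreal (x powr (1 + \<eta>) * ?T x powr 1)
          + ennreal (x powr 0 * ?T x powr (2 + \<eta>)))"
        by (simp add: ennreal_plus ennreal_indicator del: powr_one powr_zero_eq_one)
      finally show ?thesis using True by simp
    qed simp
  qed
  also have "\<dots> = 1 + M_fun \<eta> f"
  proof -
    let ?B = "\<lambda>x. ennreal (x powr (1 + \<eta>) * ?T x powr 1) * indicator {0<..} x"
    let ?C = "\<lambda>x. ennreal (x powr 0 * ?T x powr (2 + \<eta>)) * indicator {0<..} x"
    have "(\<integral>\<^sup>+x. indicator {0..1} x + (?B x + ?C x) \<partial>lborel)
        = (\<integral>\<^sup>+x. indicator {0..1 :: real} x \<partial>lborel) + (\<integral>\<^sup>+x. ?B x + ?C x \<partial>lborel)"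
      by (rule nn_integral_add) measurable
    also have "(\<integral>\<^sup>+x. ?B x + ?C x \<partial>lborel) = (\<integral>\<^sup>+x. ?B x \<partial>lborel) + (\<integral>\<^sup>+x. ?C x \<partial>lborel)"
      by (rule nn_integral_add) measurable
    also have "(\<integral>\<^sup>+x. indicator {0..1 :: real} x \<partial>lborel) = 1" by simp
    finally show ?thesis by (simp only: M_fun_def Gamma_fun_def)
  qed
  finally show ?thesis .
qed

lemma c_fun_le:
  assumes "\<eta> > 0"
  shows "c_fun f \<le> 2 * (1 + M_fun \<eta> f)"
proof -
  have half: "ennreal (1 / 2) \<le> 1" by (rule ennreal_le_1[THEN iffD2]) simp
  have "c_fun f \<le> (1 + M_fun \<eta> f) + 1 * (1 + M_fun \<eta> f)"
    unfolding c_fun_def using Gamma_fun_le[OF assms, of 1 1] Gamma_fun_le[OF assms, of 0 2]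
    by (intro add_mono mult_mono half) simp_all
  then show ?thesis by (simp only: mult_2 mult_1_left)
qed

end

section \<open>Exact formula for one step from a profile law\<close>

context
  fixes f :: "real \<times> real \<Rightarrow> real"
  assumes f: "f \<in> class_H" and T_meas [measurable]: "T_fun f \<in> borel_measurable borel"
begin

text \<open>
  In the reflected coordinates \<open>u - \<sigma> x\<close>, the event \<open>A\<close> is up to a null set the part of the open quadrant
  above the graph of \<^const>\<open>T_fun\<close>, so that its complement in the quadrant is \<open>under_T f\<close>.
\<close>

lemma bar_law_square_decomposition:
  fixes m s u :: real
  assumes s: "s > 0"
  defines "\<sigma> \<equiv> eps f" and "K \<equiv> bar_cdf ((u - m) / s)" and "h \<equiv> bar_law_density m s"
  defines "K' \<equiv> if \<sigma> = 1 then K else 1 - K"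
  defines "A \<equiv> {p. if \<sigma> = 1 then f (exp (fst p), exp (snd p)) < exp u else f (exp (fst p), exp (snd p)) > exp u}"
  shows "emeasure (bar_law m s \<Otimes>\<^sub>M bar_law m s) A
    + (\<integral>\<^sup>+p. ennreal (h (u - \<sigma> * fst p) * h (u - \<sigma> * snd p)) * indicator (under_T f) p \<partial>(lborel \<Otimes>\<^sub>M lborel))
    = ennreal (K'\<^sup>2)"
proof -
  let ?\<nu> = "bar_law m s"
  interpret \<nu>: prob_space ?\<nu> by (rule prob_space_bar_law[OF s])
  have \<sigma>: "\<sigma> = 1 \<or> \<sigma> = -1" unfolding \<sigma>_def by (rule eps_cases)
  have hm [measurable]: "h \<in> borel_measurable borel" unfolding h_def by measurable
  have h0: "h z \<ge> 0" for z unfolding h_def by (rule bar_law_density_nonneg[OF s])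
  have K': "K' \<ge> 0" unfolding K'_def K_def using bar_cdf_nonneg bar_cdf_le_1 by simp
  have fm [measurable]: "(\<lambda>p. f (exp (fst p), exp (snd p))) \<in> borel_measurable (borel \<Otimes>\<^sub>M borel)"
    using class_H_exp_measurable[OF f] by (simp add: borel_prod)
  have Am [measurable]: "A \<in> sets (borel \<Otimes>\<^sub>M borel)"
  proof -
    have "{p \<in> space (borel \<Otimes>\<^sub>M borel). if \<sigma> = 1 then f (exp (fst p), exp (snd p)) < exp u
        else f (exp (fst p), exp (snd p)) > exp u} \<in> sets (borel \<Otimes>\<^sub>M borel)" by measurable
    then show ?thesis by (simp add: A_def space_pair_measure)
  qed
  \<comment> \<open>In distances to \<open>u\<close> both signs yield the same set.\<close>
  have mem: "(u - \<sigma> * x, u - \<sigma> * y) \<in> A \<longleftrightarrow> star f (exp (- x), exp (- y)) < 1" for x y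
  proof (cases "\<sigma> = 1")
    case True
    then show ?thesis using star_lt_iff_plus[OF f, of u "u - x" "u - y"] by (simp add: A_def \<sigma>_def)
  next
    case False
    then have "\<sigma> = -1" using \<sigma> by simp
    then show ?thesis using star_lt_iff_minus[OF f, of "u + x" u "u + y"] by (simp add: A_def \<sigma>_def)
  qed
  have aff: "(\<integral>\<^sup>+z. g z \<partial>lborel) = (\<integral>\<^sup>+x. g (u - \<sigma> * x) \<partial>lborel)"
    if "g \<in> borel_measurable borel" for g :: "real \<Rightarrow> ennreal"
    using nn_integral_real_affine[OF that, of "- \<sigma>" u] \<sigma> by auto
  define J where "J x = (\<integral>\<^sup>+y. ennreal (h (u - \<sigma> * y)) * indicator {T_fun f x<..} y \<partial>lborel)" for x
  define I where "I x = (\<integral>\<^sup>+y. ennreal (h (u - \<sigma> * y)) * indicator {0<..T_fun f x} y \<partial>lborel)" for x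
  have [measurable]: "J \<in> borel_measurable borel" "I \<in> borel_measurable borel"
    unfolding J_def[abs_def] I_def[abs_def] greaterThan_def greaterThanAtMost_def lessThan_def atMost_def
    by (measurable)
  have "emeasure (?\<nu> \<Otimes>\<^sub>M ?\<nu>) A = (\<integral>\<^sup>+a. \<integral>\<^sup>+b. indicator A (a, b) \<partial>?\<nu> \<partial>?\<nu>)"
    by (rule \<nu>.emeasure_pair_measure) (simp add: sets_pair_measure_cong[OF sets_bar_law sets_bar_law])
  also have "\<dots> = (\<integral>\<^sup>+a. ennreal (h a) * (\<integral>\<^sup>+b. ennreal (h b) * indicator A (a, b) \<partial>lborel) \<partial>lborel)"
    unfolding bar_law_def h_def[symmetric] by (simp add: nn_integral_density)
  also have "\<dots> = (\<integral>\<^sup>+x. ennreal (h (u - \<sigma> * x)) * (\<integral>\<^sup>+b. ennreal (h b) * indicator A (u - \<sigma> * x, b) \<partial>lborel) \<partial>lborel)"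
    by (rule aff) measurable
  also have "\<dots> = (\<integral>\<^sup>+x. ennreal (h (u - \<sigma> * x)) * (\<integral>\<^sup>+y. ennreal (h (u - \<sigma> * y)) * indicator A (u - \<sigma> * x, u - \<sigma> * y) \<partial>lborel) \<partial>lborel)"
    by (subst aff) simp_all
  also have "\<dots> = (\<integral>\<^sup>+x. ennreal (h (u - \<sigma> * x)) * J x * indicator {0<..} x \<partial>lborel)"
  proof (rule nn_integral_cong)
    fix x :: real
    show "ennreal (h (u - \<sigma> * x)) * (\<integral>\<^sup>+y. ennreal (h (u - \<sigma> * y)) * indicator A (u - \<sigma> * x, u - \<sigma> * y) \<partial>lborel)
        = ennreal (h (u - \<sigma> * x)) * J x * indicator {0<..} x"
    proof (cases "x > 0")
      case True
      have "(\<integral>\<^sup>+y. ennreal (h (u - \<sigma> * y)) * indicator A (u - \<sigma> * x, u - \<sigma> * y) \<partial>lborel) = J x"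
        unfolding J_def
      proof (rule nn_integral_cong_AE)
        show "AE y in lborel. ennreal (h (u - \<sigma> * y)) * indicator A (u - \<sigma> * x, u - \<sigma> * y)
            = ennreal (h (u - \<sigma> * y)) * indicator {T_fun f x<..} y"
          using AE_lborel_singleton[of "T_fun f x"]
        proof eventually_elim
          case (elim y)
          then have "star f (exp (- x), exp (- y)) < 1 \<longleftrightarrow> T_fun f x < y"
            using T_fun_lt_imp_star_lt[OF f True, of y] star_lt_imp_T_fun_le[OF f, of x y] by auto
          then show ?case by (simp add: indicator_def mem)
        qed
      qed
      then show ?thesis using True by simp
    next
      case False
      then have "\<not> star f (exp (- x), exp (- y)) < 1" for y
        using star_exp_nonpos[OF f, of x y] by simp
      then have "indicator A (u - \<sigma> * x, u - \<sigma> * y) = (0 :: ennreal)" for y by (simp add: indicator_def mem)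
      then show ?thesis using False by simp
    qed
  qed
  finally have A: "emeasure (?\<nu> \<Otimes>\<^sub>M ?\<nu>) A = (\<integral>\<^sup>+x. ennreal (h (u - \<sigma> * x)) * J x * indicator {0<..} x \<partial>lborel)" .
  have "(\<integral>\<^sup>+p. ennreal (h (u - \<sigma> * fst p) * h (u - \<sigma> * snd p)) * indicator (under_T f) p \<partial>(lborel \<Otimes>\<^sub>M lborel))
     = (\<integral>\<^sup>+x\<in>{0<..}. (\<integral>\<^sup>+y. ennreal (h (u - \<sigma> * fst (x, y)) * h (u - \<sigma> * snd (x, y)))
         * indicator {0<..T_fun f x} y \<partial>lborel) \<partial>lborel)"
    by (rule nn_integral_under_T[OF f T_meas]) measurable
  also have "\<dots> = (\<integral>\<^sup>+x. ennreal (h (u - \<sigma> * x)) * I x * indicator {0<..} x \<partial>lborel)"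
  proof (rule nn_integral_cong)
    fix x :: real
    have "(\<integral>\<^sup>+y. ennreal (h (u - \<sigma> * fst (x, y)) * h (u - \<sigma> * snd (x, y))) * indicator {0<..T_fun f x} y \<partial>lborel)
        = ennreal (h (u - \<sigma> * x)) * I x"
      unfolding I_def using h0
      by (subst nn_integral_cmult[symmetric]) (auto simp: ennreal_mult mult.assoc)
    then show "(\<integral>\<^sup>+y. ennreal (h (u - \<sigma> * fst (x, y)) * h (u - \<sigma> * snd (x, y))) * indicator {0<..T_fun f x} y \<partial>lborel)
        * indicator {0<..} x = ennreal (h (u - \<sigma> * x)) * I x * indicator {0<..} x" by simp
  qed
  finally have R: "(\<integral>\<^sup>+p. ennreal (h (u - \<sigma> * fst p) * h (u - \<sigma> * snd p)) * indicator (under_T f) p \<partial>(lborel \<Otimes>\<^sub>M lborel))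
     = (\<integral>\<^sup>+x. ennreal (h (u - \<sigma> * x)) * I x * indicator {0<..} x \<partial>lborel)" .
  have half: "(\<integral>\<^sup>+y. ennreal (h (u - \<sigma> * y)) * indicator {0<..} y \<partial>lborel) = ennreal K'"
    unfolding h_def K'_def K_def by (rule bar_law_half_line[OF s \<sigma>])
  have "emeasure (?\<nu> \<Otimes>\<^sub>M ?\<nu>) A
    + (\<integral>\<^sup>+p. ennreal (h (u - \<sigma> * fst p) * h (u - \<sigma> * snd p)) * indicator (under_T f) p \<partial>(lborel \<Otimes>\<^sub>M lborel))
    = (\<integral>\<^sup>+x. ennreal (h (u - \<sigma> * x)) * J x * indicator {0<..} x + ennreal (h (u - \<sigma> * x)) * I x * indicator {0<..} x \<partial>lborel)"
    unfolding A R by (rule nn_integral_add[symmetric]) measurable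
  also have "\<dots> = (\<integral>\<^sup>+x. (ennreal (h (u - \<sigma> * x)) * indicator {0<..} x) * ennreal K' \<partial>lborel)"
  proof (rule nn_integral_cong)
    fix x :: real
    show "ennreal (h (u - \<sigma> * x)) * J x * indicator {0<..} x + ennreal (h (u - \<sigma> * x)) * I x * indicator {0<..} x
        = (ennreal (h (u - \<sigma> * x)) * indicator {0<..} x) * ennreal K'"
    proof (cases "x > 0")
      case True
      \<comment> \<open>Cutting the half-line at \<open>T_fun f x\<close> and regluing gives a mass
        independent of \<open>x\<close>, so the double integral factors into a square.\<close>
      have "J x + I x = (\<integral>\<^sup>+y. ennreal (h (u - \<sigma> * y)) * indicator {0<..} y \<partial>lborel)"
        unfolding J_def I_def using T_fun_nonneg[OF f True]
        by (subst nn_integral_add[symmetric]) (auto intro!: nn_integral_cong simp: indicator_def)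
      then have "J x + I x = ennreal K'" by (simp only: half)
      then show ?thesis using True by (simp add: distrib_left[symmetric])
    qed simp
  qed
  also have "\<dots> = ennreal K' * ennreal K'"
    by (subst nn_integral_multc) (simp_all only: half, measurable)
  also have "\<dots> = ennreal (K'\<^sup>2)" using K' by (simp add: ennreal_mult power2_eq_square)
  finally show ?thesis .
qed

text \<open>For the pure maximum the result is \<open>K^2\<close>, for the pure minimum
  \<open>2 K - K^2\<close>; both equal \<open>K - \<sigma> (K - K^2)\<close>. The deviation of
  \<open>f\<close> from them is the mass \<open>R\<close>.\<close>

lemma step_cdf_bar_law:
  fixes m s u :: real
  assumes s: "s > 0"
  defines "\<sigma> \<equiv> eps f" and "K \<equiv> bar_cdf ((u - m) / s)" and "h \<equiv> bar_law_density m s"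
  defines "R \<equiv> enn2real (\<integral>\<^sup>+p. ennreal (h (u - \<sigma> * fst p) * h (u - \<sigma> * snd p)) * indicator (under_T f) p \<partial>(lborel \<Otimes>\<^sub>M lborel))"
  shows "step_cdf f (bar_law m s) u = K - \<sigma> * (K - K\<^sup>2 + R)"
    and "(\<integral>\<^sup>+p. ennreal (h (u - \<sigma> * fst p) * h (u - \<sigma> * snd p)) * indicator (under_T f) p \<partial>(lborel \<Otimes>\<^sub>M lborel)) < \<infinity>"
proof -
  let ?\<nu> = "bar_law m s"
  let ?R = "(\<integral>\<^sup>+p. ennreal (h (u - \<sigma> * fst p) * h (u - \<sigma> * snd p)) * indicator (under_T f) p \<partial>(lborel \<Otimes>\<^sub>M lborel))"
  interpret \<nu>: prob_space ?\<nu> by (rule prob_space_bar_law[OF s])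
  interpret P: pair_prob_space ?\<nu> ?\<nu> ..
  have \<sigma>: "\<sigma> = 1 \<or> \<sigma> = -1" unfolding \<sigma>_def by (rule eps_cases)
  let ?S = "{p. f (exp (fst p), exp (snd p)) \<le> exp u}"
  let ?A = "{p. if \<sigma> = 1 then f (exp (fst p), exp (snd p)) < exp u else f (exp (fst p), exp (snd p)) > exp u}"
  define K' where "K' = (if \<sigma> = 1 then K else 1 - K)"
  have dec: "emeasure (?\<nu> \<Otimes>\<^sub>M ?\<nu>) ?A + ?R = ennreal (K'\<^sup>2)"
    unfolding \<sigma>_def h_def K_def K'_def by (rule bar_law_square_decomposition[OF s])
  have "?R \<le> emeasure (?\<nu> \<Otimes>\<^sub>M ?\<nu>) ?A + ?R" by (rule add_increasing) simp_all
  also have "\<dots> < \<infinity>" unfolding dec by simp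
  finally show fin: "?R < \<infinity>" .
  have "ennreal (measure (?\<nu> \<Otimes>\<^sub>M ?\<nu>) ?A + R) = ennreal (K'\<^sup>2)"
    unfolding dec[symmetric] R_def using fin by (simp add: P.emeasure_eq_measure ennreal_plus)
  then have A: "measure (?\<nu> \<Otimes>\<^sub>M ?\<nu>) ?A = K'\<^sup>2 - R"
    by (subst (asm) ennreal_inj) (auto simp: R_def)
  have S: "?S \<in> sets (?\<nu> \<Otimes>\<^sub>M ?\<nu>)"
    unfolding sets_pair_measure_cong[OF sets_bar_law sets_bar_law] by (rule measurable_step_set[OF f])
  show "step_cdf f ?\<nu> u = K - \<sigma> * (K - K\<^sup>2 + R)"
  proof (cases "\<sigma> = 1")
    case True
    \<comment> \<open>For positive sign the decomposition treats a strict inequality, so the level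
      set must be negligible; for negative sign the two events are exact complements.\<close>
    have ae: "AE p in ?\<nu> \<Otimes>\<^sub>M ?\<nu>. f (exp (fst p), exp (snd p)) \<noteq> exp u"
    proof -
      have eq: "?\<nu> \<Otimes>\<^sub>M ?\<nu> = density (lborel \<Otimes>\<^sub>M lborel) (\<lambda>(x, y). ennreal (h x) * ennreal (h y))"
        unfolding bar_law_def h_def[symmetric]
        by (rule pair_measure_density)
           (use \<nu>.sigma_finite_measure_axioms in \<open>simp_all add: h_def lborel.sigma_finite_measure_axioms bar_law_def\<close>)
      have m: "(\<lambda>(x, y). ennreal (h x) * ennreal (h y)) \<in> borel_measurable (lborel \<Otimes>\<^sub>M lborel)"
        unfolding h_def by measurable
      show ?thesis
        unfolding eq AE_density[OF m] using class_H_level_null[OF f, of u] by (rule eventually_mono) simp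
    qed
    have "measure (?\<nu> \<Otimes>\<^sub>M ?\<nu>) ?S = measure (?\<nu> \<Otimes>\<^sub>M ?\<nu>) ?A"
    proof (intro P.finite_measure_eq_AE S)
      have [measurable]: "(\<lambda>p. f (exp (fst p), exp (snd p))) \<in> borel_measurable (borel \<Otimes>\<^sub>M borel)"
        using class_H_exp_measurable[OF f] by (simp add: borel_prod)
      have "{p \<in> space (borel \<Otimes>\<^sub>M borel). f (exp (fst p), exp (snd p)) < exp u} \<in> sets (borel \<Otimes>\<^sub>M borel)"
        by measurable
      then show "?A \<in> sets (?\<nu> \<Otimes>\<^sub>M ?\<nu>)"
        unfolding sets_pair_measure_cong[OF sets_bar_law sets_bar_law] using True
        by (simp add: space_pair_measure)
      show "AE p in ?\<nu> \<Otimes>\<^sub>M ?\<nu>. p \<in> ?S \<longleftrightarrow> p \<in> ?A"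
        using ae
        by (rule eventually_mono) (use True in auto)
    qed
    then show ?thesis using True A by (simp add: step_cdf_def K'_def)
  next
    case False
    then have "?A = space (?\<nu> \<Otimes>\<^sub>M ?\<nu>) - ?S" by (auto simp: space_pair_measure)
    then have "K'\<^sup>2 - R = 1 - measure (?\<nu> \<Otimes>\<^sub>M ?\<nu>) ?S"
      using P.prob_compl[OF S] A by simp
    moreover have "\<sigma> = -1" using False \<sigma> by simp
    ultimately show ?thesis using False
      by (simp add: step_cdf_def K'_def power2_eq_square algebra_simps)
  qed
qed

end

section \<open>Expansion of one step in powers of the scale\<close>

lemma integral_indicator_enn2real:
  fixes g :: "'b \<Rightarrow> real"
  assumes [measurable]: "g \<in> borel_measurable L" "D \<in> sets L" and nonneg: "\<And>p. p \<in> D \<Longrightarrow> g p \<ge> 0"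
    and fin: "(\<integral>\<^sup>+p. ennreal (g p) * indicator D p \<partial>L) < \<infinity>"
  shows "integrable L (\<lambda>p. g p * indicator D p)"
    and "(\<integral>p. g p * indicator D p \<partial>L) = enn2real (\<integral>\<^sup>+p. ennreal (g p) * indicator D p \<partial>L)"
proof -
  have eq: "(\<integral>\<^sup>+p. ennreal (g p * indicator D p) \<partial>L) = (\<integral>\<^sup>+p. ennreal (g p) * indicator D p \<partial>L)"
    by (rule nn_integral_cong) (simp add: indicator_def)
  have nn: "AE p in L. 0 \<le> g p * indicator D p"
    using nonneg by (simp add: indicator_def)
  show "integrable L (\<lambda>p. g p * indicator D p)"
    by (rule integrableI_nonneg) (use nn fin eq in auto)
  show "(\<integral>p. g p * indicator D p \<partial>L) = enn2real (\<integral>\<^sup>+p. ennreal (g p) * indicator D p \<partial>L)"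
    unfolding eq[symmetric] by (rule integral_eq_nn_integral) (use nn in auto)
qed

text \<open>The pointwise product expansion is integrated over \<open>under_T f\<close>: the
  constant term yields \<open>Gamma_fun 0 1\<close>, the linear term \<open>c_fun\<close>, and the
  remainder is bounded by \<open>M_fun\<close>.\<close>

lemma step_cdf_consistency:
  fixes f :: "real \<times> real \<Rightarrow> real" and m s u \<eta> :: real
  assumes f: "f \<in> class_H" and T_meas [measurable]: "T_fun f \<in> borel_measurable borel"
    and \<eta>: "0 < \<eta>" "\<eta> < 1" and fin: "M_fun \<eta> f < \<infinity>" and s: "s > 0"
  defines "\<sigma> \<equiv> eps f" and "v \<equiv> (u - m) / s"
  shows "\<bar>step_cdf f (bar_law m s) u - (bar_cdf v - \<sigma> * (bar_cdf v - (bar_cdf v)\<^sup>2)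
      - \<sigma> * (bar_density v / s)\<^sup>2 * enn2real (Gamma_fun 0 1 f) + bar_flux v / s ^ 3 * enn2real (c_fun f))\<bar>
    \<le> 18 * s powr (- (3 + \<eta>)) * enn2real (M_fun \<eta> f)"
proof -
  let ?L = "lborel \<Otimes>\<^sub>M lborel :: (real \<times> real) measure"
  define D where "D = under_T f"
  define g where "g p = bar_law_density m s (u - \<sigma> * fst p) * bar_law_density m s (u - \<sigma> * snd p)" for p
  define q where "q p = fst p powr (1 + \<eta>) + snd p powr (1 + \<eta>)" for p :: "real \<times> real"
  define E where "E = 18 * s powr (- (3 + \<eta>))"
  have \<sigma>: "\<bar>\<sigma>\<bar> = 1" "\<sigma> * \<sigma> = 1" unfolding \<sigma>_def using eps_cases[of f] by auto
  have D [measurable]: "D \<in> sets ?L"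
    unfolding D_def using under_T_sets[OF f T_meas] by simp
  have Dpos: "fst p > 0" "snd p > 0" if "p \<in> D" for p
    using that by (auto simp: D_def under_T_def)
  have [measurable]: "g \<in> borel_measurable ?L" "q \<in> borel_measurable ?L"
    unfolding g_def[abs_def] q_def[abs_def] by measurable
  have \<Gamma>fin: "1 + M_fun \<eta> f < \<infinity>" "2 * (1 + M_fun \<eta> f) < \<infinity>"
    using fin by (simp_all add: ennreal_mult_less_top less_top)
  have n0: "(\<integral>\<^sup>+p. ennreal 1 * indicator D p \<partial>?L) = Gamma_fun 0 1 f"
  proof -
    have "(\<integral>\<^sup>+p. ennreal 1 * indicator D p \<partial>?L) = (\<integral>\<^sup>+p. ennreal (fst p powr 0) * indicator D p \<partial>?L)"
      by (rule nn_integral_cong) (use Dpos in \<open>force simp: indicator_def\<close>)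
    then show ?thesis by (simp only: D_def nn_integral_under_T_fst[OF f T_meas])
  qed
  have n1: "(\<integral>\<^sup>+p. ennreal (fst p + snd p) * indicator D p \<partial>?L) = c_fun f"
  proof -
    have "(\<integral>\<^sup>+p. ennreal (fst p + snd p) * indicator D p \<partial>?L)
       = (\<integral>\<^sup>+p. ennreal (fst p powr 1) * indicator D p + ennreal (snd p powr 1) * indicator D p \<partial>?L)"
    proof (rule nn_integral_cong)
      fix p
      show "ennreal (fst p + snd p) * indicator D p
          = ennreal (fst p powr 1) * indicator D p + ennreal (snd p powr 1) * indicator D p"
      proof (cases "p \<in> D")
        case True
        then show ?thesis using Dpos[OF True] by (simp add: ennreal_plus)
      qed simp
    qed
    also have "\<dots> = (\<integral>\<^sup>+p. ennreal (fst p powr 1) * indicator D p \<partial>?L) + (\<integral>\<^sup>+p. ennreal (snd p powr 1) * indicator D p \<partial>?L)"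
      by (rule nn_integral_add) measurable
    also have "\<dots> = Gamma_fun 1 1 f + ennreal (1 / (1 + 1)) * Gamma_fun 0 (1 + 1) f"
      unfolding D_def using nn_integral_under_T_fst[OF f T_meas, of 1] nn_integral_under_T_snd[OF f T_meas, of 1]
      by simp
    finally show ?thesis by (simp only: c_fun_def one_add_one)
  qed
  have n2: "(\<integral>\<^sup>+p. ennreal (q p) * indicator D p \<partial>?L) \<le> M_fun \<eta> f"
  proof -
    have "(\<integral>\<^sup>+p. ennreal (q p) * indicator D p \<partial>?L)
       = (\<integral>\<^sup>+p. ennreal (fst p powr (1 + \<eta>)) * indicator D p + ennreal (snd p powr (1 + \<eta>)) * indicator D p \<partial>?L)"
      by (rule nn_integral_cong) (simp add: q_def ennreal_plus distrib_right)
    also have "\<dots> = (\<integral>\<^sup>+p. ennreal (fst p powr (1 + \<eta>)) * indicator D p \<partial>?L)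
        + (\<integral>\<^sup>+p. ennreal (snd p powr (1 + \<eta>)) * indicator D p \<partial>?L)"
      by (rule nn_integral_add) measurable
    also have "\<dots> = Gamma_fun (1 + \<eta>) 1 f + ennreal (1 / (1 + \<eta> + 1)) * Gamma_fun 0 (1 + \<eta> + 1) f"
      unfolding D_def using nn_integral_under_T_fst[OF f T_meas, of "1 + \<eta>"]
        nn_integral_under_T_snd[OF f T_meas, of "1 + \<eta>"] \<eta> by simp
    \<comment> \<open>The factor \<open>1 / (2 + \<eta>)\<close> from the vertical integral is
      bounded by 1 to reach \<open>M_fun\<close>.\<close>
    also have "\<dots> \<le> Gamma_fun (1 + \<eta>) 1 f + 1 * Gamma_fun 0 (1 + \<eta> + 1) f"
    proof -
      have "ennreal (1 / (1 + \<eta> + 1)) \<le> 1" by (rule ennreal_le_1[THEN iffD2]) (use \<eta> in simp)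
      then show ?thesis by (intro add_mono mult_right_mono) simp_all
    qed
    also have "\<dots> = M_fun \<eta> f" by (simp add: M_fun_def add.commute add.left_commute)
    finally show ?thesis .
  qed
  have gn: "(\<integral>\<^sup>+p. ennreal (g p) * indicator D p \<partial>?L) < \<infinity>"
    unfolding g_def D_def \<sigma>_def by (rule step_cdf_bar_law(2)[OF f T_meas s])
  have step: "step_cdf f (bar_law m s) u = bar_cdf v - \<sigma> * (bar_cdf v - (bar_cdf v)\<^sup>2
      + enn2real (\<integral>\<^sup>+p. ennreal (g p) * indicator D p \<partial>?L))"
    unfolding g_def D_def \<sigma>_def v_def by (rule step_cdf_bar_law(1)[OF f T_meas s])
  have G0: "Gamma_fun 0 1 f < \<infinity>"
    by (rule le_less_trans[OF Gamma_fun_le[OF f T_meas \<eta>(1)] \<Gamma>fin(1)]) simp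
  have C0: "c_fun f < \<infinity>"
    by (rule le_less_trans[OF c_fun_le[OF f T_meas \<eta>(1)] \<Gamma>fin(2)])
  have I0: "integrable ?L (\<lambda>p. 1 * indicator D p :: real)"
      "(\<integral>p. 1 * indicator D p \<partial>?L) = enn2real (Gamma_fun 0 1 f)"
    using integral_indicator_enn2real[of "\<lambda>_. 1" ?L D] G0 D unfolding n0 by simp_all
  have I1: "integrable ?L (\<lambda>p. (fst p + snd p) * indicator D p)"
      "(\<integral>p. (fst p + snd p) * indicator D p \<partial>?L) = enn2real (c_fun f)"
  proof -
    have m: "(\<lambda>p. fst p + snd p) \<in> borel_measurable ?L" by measurable
    have "0 \<le> fst p + snd p" if "p \<in> D" for p using Dpos[OF that] by simp
    from integral_indicator_enn2real[OF m D this, unfolded n1, OF _ C0]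
    show "integrable ?L (\<lambda>p. (fst p + snd p) * indicator D p)"
      "(\<integral>p. (fst p + snd p) * indicator D p \<partial>?L) = enn2real (c_fun f)" by blast+
  qed
  have I2: "integrable ?L (\<lambda>p. q p * indicator D p)"
      "(\<integral>p. q p * indicator D p \<partial>?L) \<le> enn2real (M_fun \<eta> f)"
  proof -
    have "(\<integral>\<^sup>+p. ennreal (q p) * indicator D p \<partial>?L) < \<infinity>" using n2 fin by (rule le_less_trans)
    from integral_indicator_enn2real[OF _ D _ this]
    show "integrable ?L (\<lambda>p. q p * indicator D p)" "(\<integral>p. q p * indicator D p \<partial>?L) \<le> enn2real (M_fun \<eta> f)"
      using n2 fin by (auto simp: q_def intro!: enn2real_mono)
  qed
  have Ig: "integrable ?L (\<lambda>p. g p * indicator D p)"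
      "(\<integral>p. g p * indicator D p \<partial>?L) = enn2real (\<integral>\<^sup>+p. ennreal (g p) * indicator D p \<partial>?L)"
    using integral_indicator_enn2real[OF _ D _ gn] bar_law_density_nonneg[OF s] by (auto simp: g_def)
  define c0 where "c0 = (bar_density v / s)\<^sup>2"
  define c1 where "c1 = bar_flux v / s ^ 3"
  have taylor: "\<bar>g p - c0 + \<sigma> * c1 * (fst p + snd p)\<bar> \<le> E * q p" if p: "p \<in> D" for p
  proof -
    let ?x = "fst p / s" and ?y = "snd p / s"
    have xy: "?x > 0" "?y > 0" using Dpos[OF p] s by auto
    have hx: "bar_law_density m s (u - \<sigma> * z) = bar_density (v - \<sigma> * (z / s)) / s" for z
    proof -
      have "(u - \<sigma> * z - m) / s = v - \<sigma> * (z / s)" by (simp add: v_def diff_divide_distrib)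
      then show ?thesis by (simp add: bar_law_density_def)
    qed
    have "g p - c0 + \<sigma> * c1 * (fst p + snd p) = (bar_density (v - \<sigma> * ?x) * bar_density (v - \<sigma> * ?y)
        - (bar_density v)\<^sup>2 + \<sigma> * bar_flux v * (?x + ?y)) / s\<^sup>2"
      unfolding g_def hx c0_def c1_def using s by (simp add: field_simps power2_eq_square power3_eq_cube)
    then have "\<bar>g p - c0 + \<sigma> * c1 * (fst p + snd p)\<bar> = \<bar>bar_density (v - \<sigma> * ?x) * bar_density (v - \<sigma> * ?y)
        - (bar_density v)\<^sup>2 + \<sigma> * bar_flux v * (?x + ?y)\<bar> / s\<^sup>2"
      using s by simp
    also have "\<dots> \<le> 18 * (?x powr (1 + \<eta>) + ?y powr (1 + \<eta>)) / s\<^sup>2"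
      by (intro divide_right_mono bar_density_product_taylor xy \<sigma> \<eta>) simp
    \<comment> \<open>The two densities contribute \<open>s^-2\<close>, the rescaled distances in
      the remainder the power \<open>- (1 + \<eta>)\<close>.\<close>
    also have "\<dots> = E * q p"
    proof -
      have "s powr (- (3 + \<eta>)) = 1 / (s powr (1 + \<eta>) * s\<^sup>2)"
      proof -
        have "s powr (- (3 + \<eta>)) = s powr (- ((1 + \<eta>) + 2))"
          by (rule arg_cong[where f="\<lambda>t. s powr t"]) simp
        also have "\<dots> = inverse (s powr ((1 + \<eta>) + 2))" by (rule powr_minus)
        also have "\<dots> = inverse (s powr (1 + \<eta>) * s\<^sup>2)" using s by (simp only: powr_add) simp
        finally show ?thesis by (simp add: inverse_eq_divide)
      qed
      moreover have "?x powr (1 + \<eta>) = fst p powr (1 + \<eta>) / s powr (1 + \<eta>)"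
          "?y powr (1 + \<eta>) = snd p powr (1 + \<eta>) / s powr (1 + \<eta>)"
        using Dpos[OF p] s by (simp_all add: powr_divide)
      ultimately show ?thesis unfolding E_def q_def using s
        by (simp add: add_divide_distrib[symmetric])
    qed
    finally show ?thesis .
  qed
  have "\<bar>(\<integral>p. (g p - c0 + \<sigma> * c1 * (fst p + snd p)) * indicator D p \<partial>?L)\<bar>
      \<le> (\<integral>p. E * (q p * indicator D p) \<partial>?L)"
  proof (rule order_trans[OF integral_abs_bound])
    have "integrable ?L (\<lambda>p. g p * indicator D p - c0 * (1 * indicator D p)
        + \<sigma> * c1 * ((fst p + snd p) * indicator D p))"
      by (intro Bochner_Integration.integrable_add Bochner_Integration.integrable_diff integrable_mult_right I0 I1 Ig)
    then have int: "integrable ?L (\<lambda>p. (g p - c0 + \<sigma> * c1 * (fst p + snd p)) * indicator D p)"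
      by (simp add: algebra_simps)
    show "(\<integral>p. \<bar>(g p - c0 + \<sigma> * c1 * (fst p + snd p)) * indicator D p\<bar> \<partial>?L) \<le> (\<integral>p. E * (q p * indicator D p) \<partial>?L)"
    proof (rule integral_mono)
      show "\<bar>(g p - c0 + \<sigma> * c1 * (fst p + snd p)) * indicator D p\<bar> \<le> E * (q p * indicator D p)" for p
        using taylor[of p] by (cases "p \<in> D") simp_all
    qed (use int I2 in auto)
  qed
  also have "\<dots> \<le> E * enn2real (M_fun \<eta> f)"
    using I2 by (simp add: E_def mult_left_mono)
  finally have main: "\<bar>(\<integral>p. (g p - c0 + \<sigma> * c1 * (fst p + snd p)) * indicator D p \<partial>?L)\<bar> \<le> E * enn2real (M_fun \<eta> f)" .
  have "(\<integral>p. (g p - c0 + \<sigma> * c1 * (fst p + snd p)) * indicator D p \<partial>?L)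
     = (\<integral>p. g p * indicator D p - c0 * (1 * indicator D p) + \<sigma> * c1 * ((fst p + snd p) * indicator D p) \<partial>?L)"
    by (rule Bochner_Integration.integral_cong) (simp_all add: algebra_simps)
  also have "\<dots> = (\<integral>p. g p * indicator D p \<partial>?L) - c0 * enn2real (Gamma_fun 0 1 f) + \<sigma> * c1 * enn2real (c_fun f)"
    unfolding I0(2)[symmetric] I1(2)[symmetric]
    by (intro has_bochner_integral_integral_eq has_bochner_integral_add has_bochner_integral_diff
        has_bochner_integral_mult_right has_bochner_integral_integrable I0 I1 Ig)
  finally have eq: "(\<integral>p. (g p - c0 + \<sigma> * c1 * (fst p + snd p)) * indicator D p \<partial>?L)
     = enn2real (\<integral>\<^sup>+p. ennreal (g p) * indicator D p \<partial>?L) - c0 * enn2real (Gamma_fun 0 1 f) + \<sigma> * c1 * enn2real (c_fun f)"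
    by (simp only: Ig(2))
  define R where "R = enn2real (\<integral>\<^sup>+p. ennreal (g p) * indicator D p \<partial>?L)"
  define G where "G = enn2real (Gamma_fun 0 1 f)"
  define c where "c = enn2real (c_fun f)"
  have "\<bar>R - c0 * G + \<sigma> * c1 * c\<bar> \<le> E * enn2real (M_fun \<eta> f)"
    using main unfolding eq R_def G_def c_def .
  moreover have "step_cdf f (bar_law m s) u - (bar_cdf v - \<sigma> * (bar_cdf v - (bar_cdf v)\<^sup>2) - \<sigma> * c0 * G + c1 * c)
      = - \<sigma> * (R - c0 * G + \<sigma> * c1 * c)"
  proof -
    have "\<sigma> * (\<sigma> * c1 * c) = c1 * c" using \<sigma>(2) by (simp add: mult.assoc[symmetric])
    then show ?thesis unfolding step R_def[symmetric] by (simp add: algebra_simps)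
  qed
  ultimately show ?thesis
    using \<sigma>(1) unfolding c0_def[symmetric] c1_def[symmetric] E_def[symmetric] G_def[symmetric] c_def[symmetric]
    by (simp add: abs_mult)
qed

section \<open>Nonexpansiveness of one step\<close>

lemma lower_set_real_cases:
  fixes S :: "real set"
  assumes lower: "\<And>x y. y \<in> S \<Longrightarrow> x \<le> y \<Longrightarrow> x \<in> S"
  obtains "S = {}" | "S = UNIV" | t where "S = {..<t}" | t where "S = {..t}"
proof (cases "S = {} \<or> \<not> bdd_above S")
  case True
  have unb: "S = UNIV" if "\<not> bdd_above S"
  proof (intro equalityI subsetI UNIV_I)
    fix x
    have "\<forall>z. \<exists>y\<in>S. z < y" using that by (auto simp: bdd_above_def not_le)
    then obtain y where "y \<in> S" "x < y" by blast
    then show "x \<in> S" using lower[of y x] by simp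
  qed
  from True show thesis
  proof
    assume "S = {}"
    then show thesis by (rule that(1))
  next
    assume "\<not> bdd_above S"
    then show thesis using unb that(2) by simp
  qed
next
  case False
  define t where "t = Sup S"
  have le: "x \<le> t" if "x \<in> S" for x unfolding t_def using False that by (intro cSup_upper) auto
  have lt: "x \<in> S" if x: "x < t" for x
  proof -
    obtain y where "y \<in> S" "x < y" using less_cSupD[of S x] False x unfolding t_def by blast
    then show ?thesis using lower[of y x] by simp
  qed
  show thesis
  proof (cases "t \<in> S")
    case True
    then have "S = {..t}" using le lt by (auto simp: le_less)
    then show thesis by (rule that(4))
  next
    case False
    then have "S = {..<t}" using le lt by (auto simp: order.strict_iff_order)
    then show thesis by (rule that(3))
  qed
qed

text \<open>A lower set of reals is empty, full or a half-line; an open half-line is reached through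
  left limits of the distribution functions.\<close>

lemma measure_lower_set_le:
  assumes \<mu>: "real_distribution \<mu>" and \<nu>: "real_distribution \<nu>"
    and le: "\<And>t. cdf \<mu> t \<le> cdf \<nu> t + a" and a: "0 \<le> a"
    and lower: "\<And>x y. y \<in> S \<Longrightarrow> x \<le> y \<Longrightarrow> x \<in> S"
  shows "measure \<mu> S \<le> measure \<nu> S + a"
proof -
  interpret \<mu>: real_distribution \<mu> by (rule \<mu>)
  interpret \<nu>: real_distribution \<nu> by (rule \<nu>)
  show ?thesis
  proof (rule lower_set_real_cases[of S])
    fix t assume "S = {..<t}"
    moreover have "measure \<mu> {..<t} \<le> measure \<nu> {..<t} + a"
      by (rule tendsto_le[OF trivial_limit_at_left_real tendsto_add[OF \<nu>.cdf_at_left tendsto_const] \<mu>.cdf_at_left])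
         (simp add: le)
    ultimately show ?thesis by simp
  next
    assume "S = UNIV"
    then show ?thesis using a \<mu>.prob_space \<nu>.prob_space by simp
  qed (use a le lower in \<open>auto simp: cdf_def\<close>)
qed

text \<open>Passing to complements exchanges the roles of \<mu> and \<nu>.\<close>

lemma measure_upper_set_le:
  assumes \<mu>: "real_distribution \<mu>" and \<nu>: "real_distribution \<nu>"
    and le: "\<And>t. cdf \<mu> t \<le> cdf \<nu> t + a" and a: "0 \<le> a"
    and upper: "\<And>x y. x \<in> S \<Longrightarrow> x \<le> y \<Longrightarrow> y \<in> S" and S: "S \<in> sets borel"
  shows "measure \<nu> S \<le> measure \<mu> S + a"
proof -
  interpret \<mu>: real_distribution \<mu> by (rule \<mu>)
  interpret \<nu>: real_distribution \<nu> by (rule \<nu>)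
  have "measure \<mu> (UNIV - S) \<le> measure \<nu> (UNIV - S) + a"
    by (rule measure_lower_set_le[OF \<mu> \<nu> le a]) (use upper in auto)
  then show ?thesis using \<mu>.prob_compl[of S] \<nu>.prob_compl[of S] S by simp
qed

text \<open>The intermediate measure is the mixed product of \<mu> and \<nu>. Sections over points
  outside \<open>C\<close> are empty, so each exchange costs \<open>a\<close> only on the mass of
  \<open>C\<close>; a plain bound would give \<open>2 a\<close>, too much for an iteration.\<close>

lemma square_measure_le:
  assumes \<mu>: "real_distribution \<mu>" and \<nu>: "real_distribution \<nu>" and a: "0 \<le> a"
    and S: "S \<in> sets (borel \<Otimes>\<^sub>M borel)" and C: "C \<in> sets borel"
    and S_C: "S \<subseteq> C \<times> C"
    and sec1: "\<And>x. measure \<mu> (Pair x -` S) \<le> measure \<nu> (Pair x -` S) + a"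
    and sec2: "\<And>y. measure \<mu> ((\<lambda>x. (x, y)) -` S) \<le> measure \<nu> ((\<lambda>x. (x, y)) -` S) + a"
  shows "measure (\<mu> \<Otimes>\<^sub>M \<mu>) S \<le> measure (\<nu> \<Otimes>\<^sub>M \<nu>) S + a * (measure \<mu> C + measure \<nu> C)"
proof -
  interpret \<mu>: real_distribution \<mu> by (rule \<mu>)
  interpret \<nu>: real_distribution \<nu> by (rule \<nu>)
  interpret A: pair_prob_space \<mu> \<mu> ..
  interpret B: pair_prob_space \<mu> \<nu> ..
  interpret D: pair_prob_space \<nu> \<nu> ..
  have sets: "sets (\<mu> \<Otimes>\<^sub>M \<mu>) = sets (borel \<Otimes>\<^sub>M borel)" "sets (\<mu> \<Otimes>\<^sub>M \<nu>) = sets (borel \<Otimes>\<^sub>M borel)"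
    "sets (\<nu> \<Otimes>\<^sub>M \<nu>) = sets (borel \<Otimes>\<^sub>M borel)"
    by (intro sets_pair_measure_cong; simp)+
  have e1: "emeasure \<mu> (Pair x -` S) \<le> emeasure \<nu> (Pair x -` S) + ennreal a * indicator C x" for x
  proof (cases "x \<in> C")
    case True
    have "ennreal (measure \<mu> (Pair x -` S)) \<le> ennreal (measure \<nu> (Pair x -` S) + a)"
      by (rule ennreal_leI[OF sec1])
    then show ?thesis using True a by (simp add: \<mu>.emeasure_eq_measure \<nu>.emeasure_eq_measure ennreal_plus)
  next
    case False
    then have "Pair x -` S = {}" using S_C by auto
    then show ?thesis by simp
  qed
  have e2: "emeasure \<mu> ((\<lambda>x. (x, y)) -` S) \<le> emeasure \<nu> ((\<lambda>x. (x, y)) -` S) + ennreal a * indicator C y" for y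
  proof (cases "y \<in> C")
    case True
    have "ennreal (measure \<mu> ((\<lambda>x. (x, y)) -` S)) \<le> ennreal (measure \<nu> ((\<lambda>x. (x, y)) -` S) + a)"
      by (rule ennreal_leI[OF sec2])
    then show ?thesis using True a by (simp add: \<mu>.emeasure_eq_measure \<nu>.emeasure_eq_measure ennreal_plus)
  next
    case False
    then have "(\<lambda>x. (x, y)) -` S = {}" using S_C by auto
    then show ?thesis by simp
  qed
  have "emeasure (\<mu> \<Otimes>\<^sub>M \<mu>) S = (\<integral>\<^sup>+x. emeasure \<mu> (Pair x -` S) \<partial>\<mu>)"
    by (rule \<mu>.emeasure_pair_measure_alt) (simp add: sets S)
  also have "\<dots> \<le> (\<integral>\<^sup>+x. emeasure \<nu> (Pair x -` S) + ennreal a * indicator C x \<partial>\<mu>)"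
    by (rule nn_integral_mono) (rule e1)
  also have "\<dots> = (\<integral>\<^sup>+x. emeasure \<nu> (Pair x -` S) \<partial>\<mu>) + (\<integral>\<^sup>+x. ennreal a * indicator C x \<partial>\<mu>)"
    by (rule nn_integral_add) (use C S sets in \<open>auto intro!: \<nu>.measurable_emeasure_Pair\<close>)
  also have "\<dots> = emeasure (\<mu> \<Otimes>\<^sub>M \<nu>) S + ennreal a * emeasure \<mu> C"
    using C S by (simp add: \<nu>.emeasure_pair_measure_alt sets nn_integral_cmult_indicator)
  finally have 1: "measure (\<mu> \<Otimes>\<^sub>M \<mu>) S \<le> measure (\<mu> \<Otimes>\<^sub>M \<nu>) S + a * measure \<mu> C"
    using a by (simp add: A.emeasure_eq_measure B.emeasure_eq_measure \<mu>.emeasure_eq_measure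
        ennreal_mult[symmetric] ennreal_plus[symmetric] del: ennreal_plus)
  have "emeasure (\<mu> \<Otimes>\<^sub>M \<nu>) S = (\<integral>\<^sup>+y. emeasure \<mu> ((\<lambda>x. (x, y)) -` S) \<partial>\<nu>)"
    by (rule B.emeasure_pair_measure_alt2) (simp add: sets S)
  also have "\<dots> \<le> (\<integral>\<^sup>+y. emeasure \<nu> ((\<lambda>x. (x, y)) -` S) + ennreal a * indicator C y \<partial>\<nu>)"
    by (rule nn_integral_mono) (rule e2)
  also have "\<dots> = (\<integral>\<^sup>+y. emeasure \<nu> ((\<lambda>x. (x, y)) -` S) \<partial>\<nu>) + (\<integral>\<^sup>+y. ennreal a * indicator C y \<partial>\<nu>)"
    by (rule nn_integral_add) (use C S sets in \<open>auto intro!: D.measurable_emeasure_Pair2\<close>)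
  also have "\<dots> = emeasure (\<nu> \<Otimes>\<^sub>M \<nu>) S + ennreal a * emeasure \<nu> C"
    using C S by (simp add: D.emeasure_pair_measure_alt2 sets nn_integral_cmult_indicator)
  finally have 2: "measure (\<mu> \<Otimes>\<^sub>M \<nu>) S \<le> measure (\<nu> \<Otimes>\<^sub>M \<nu>) S + a * measure \<nu> C"
    using a by (simp add: D.emeasure_eq_measure B.emeasure_eq_measure \<nu>.emeasure_eq_measure
        ennreal_mult[symmetric] ennreal_plus[symmetric] del: ennreal_plus)
  show ?thesis using 1 2 by (simp add: distrib_left)
qed

lemma class_H_exp_mono:
  assumes f: "f \<in> class_H" and "a \<le> a'" "b \<le> b'"
  shows "f (exp a, exp b) \<le> f (exp a', exp b')"
  using class_H_mono1[OF f, of "exp a" "exp a'" "exp b"] class_H_mono2[OF f, of "exp a'" "exp b" "exp b'"] assms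
  by simp

text \<open>
  The two coordinates are replaced one at a time. For \<^term>\<open>eps f = 1\<close> each replacement costs \<open>a\<close> only on
  the event that the other coordinate is at most \<open>u\<close>, for \<^term>\<open>eps f = -1\<close> only on the event that it
  exceeds \<open>u\<close>; a fair sign therefore gives total cost exactly \<open>a\<close>.
\<close>

lemma step_cdf_nonexpansive:
  assumes f: "f \<in> class_H" and \<mu>: "real_distribution \<mu>" and \<nu>: "real_distribution \<nu>"
    and le: "\<And>t. cdf \<mu> t \<le> cdf \<nu> t + a" and a: "0 \<le> a"
  shows "step_cdf f \<mu> u - step_cdf f \<nu> u \<le> a * (1 + eps f * (cdf \<mu> u + cdf \<nu> u - 1))"
proof -
  interpret \<mu>: real_distribution \<mu> by (rule \<mu>)
  interpret \<nu>: real_distribution \<nu> by (rule \<nu>)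
  interpret A: pair_prob_space \<mu> \<mu> ..
  interpret D: pair_prob_space \<nu> \<nu> ..
  have sets: "sets (\<mu> \<Otimes>\<^sub>M \<mu>) = sets (borel \<Otimes>\<^sub>M borel)" "sets (\<nu> \<Otimes>\<^sub>M \<nu>) = sets (borel \<Otimes>\<^sub>M borel)"
    by (intro sets_pair_measure_cong; simp)+
  define S where "S = {p. f (exp (fst p), exp (snd p)) \<le> exp u}"
  have S: "S \<in> sets (borel \<Otimes>\<^sub>M borel)" unfolding S_def by (rule measurable_step_set[OF f])
  note mono = class_H_exp_mono[OF f]
  consider (1) "eps f = 1" | (2) "eps f = -1" using eps_cases by blast
  then show ?thesis
  proof cases
    case 1
    have "max (exp x) (exp y) \<le> f (exp x, exp y)" for x y
      using class_H_above[OF f 1] by (simp add: above_max_def)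
    then have "x \<le> u \<and> y \<le> u" if "(x, y) \<in> S" for x y
    proof -
      assume "\<And>x y. max (exp x) (exp y) \<le> f (exp x, exp y)"
      from this[of x y] that have "exp x \<le> exp u \<and> exp y \<le> exp u"
        by (auto simp: S_def simp del: exp_le_cancel_iff)
      then show ?thesis by simp
    qed
    then have sub: "S \<subseteq> {..u} \<times> {..u}" by auto
    have "measure (\<mu> \<Otimes>\<^sub>M \<mu>) S \<le> measure (\<nu> \<Otimes>\<^sub>M \<nu>) S + a * (measure \<mu> {..u} + measure \<nu> {..u})"
    proof (rule square_measure_le[OF \<mu> \<nu> a S _ sub])
      show "measure \<mu> (Pair x -` S) \<le> measure \<nu> (Pair x -` S) + a" for x
        by (rule measure_lower_set_le[OF \<mu> \<nu> le a]) (use mono[of x x] in \<open>force simp: S_def intro: order_trans\<close>)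
      show "measure \<mu> ((\<lambda>x. (x, y)) -` S) \<le> measure \<nu> ((\<lambda>x. (x, y)) -` S) + a" for y
        by (rule measure_lower_set_le[OF \<mu> \<nu> le a]) (use mono[of _ _ y y] in \<open>force simp: S_def intro: order_trans\<close>)
    qed simp
    then show ?thesis using 1 by (simp add: step_cdf_def S_def cdf_def)
  next
    case 2
    \<comment> \<open>For negative sign it is the complement that fits into a square: an output
      above \<open>u\<close> forces both inputs above \<open>u\<close>. Complements reverse the
      comparison, hence \<nu> comes first.\<close>
    let ?U = "UNIV - S"
    have "f (exp x, exp y) \<le> min (exp x) (exp y)" for x y
      using class_H_below[OF f 2] by (simp add: below_min_def)
    then have "u < x \<and> u < y" if "(x, y) \<in> ?U" for x y
    proof -
      assume "\<And>x y. f (exp x, exp y) \<le> min (exp x) (exp y)"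
      from this[of x y] that have "exp u < exp x \<and> exp u < exp y"
        by (auto simp: S_def simp del: exp_less_cancel_iff)
      then show ?thesis by simp
    qed
    then have sub: "?U \<subseteq> {u<..} \<times> {u<..}" by auto
    have U: "?U \<in> sets (borel \<Otimes>\<^sub>M borel)" using sets.compl_sets[OF S] by (simp add: space_pair_measure)
    have U1: "Pair x -` ?U \<in> sets borel" and U2: "(\<lambda>z. (z, x)) -` ?U \<in> sets borel" for x
      using sets_Pair1[OF U] sets_Pair2[OF U] by auto
    have "measure (\<nu> \<Otimes>\<^sub>M \<nu>) ?U \<le> measure (\<mu> \<Otimes>\<^sub>M \<mu>) ?U + a * (measure \<nu> {u<..} + measure \<mu> {u<..})"
    proof (rule square_measure_le[OF \<nu> \<mu> a U _ sub])
      show "measure \<nu> (Pair x -` ?U) \<le> measure \<mu> (Pair x -` ?U) + a" for x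
        by (rule measure_upper_set_le[OF \<mu> \<nu> le a _ U1]) (use mono[of x x] in \<open>force simp: S_def intro: order_trans\<close>)
      show "measure \<nu> ((\<lambda>x. (x, y)) -` ?U) \<le> measure \<mu> ((\<lambda>x. (x, y)) -` ?U) + a" for y
        by (rule measure_upper_set_le[OF \<mu> \<nu> le a _ U2]) (use mono[of _ _ y y] in \<open>force simp: S_def intro: order_trans\<close>)
    qed simp
    moreover have "measure \<mu> {u<..} = 1 - cdf \<mu> u" "measure \<nu> {u<..} = 1 - cdf \<nu> u"
      using \<mu>.prob_compl[of "{..u}"] \<nu>.prob_compl[of "{..u}"]
      by (simp_all add: cdf_def Compl_eq_Diff_UNIV[symmetric])
    moreover have "measure (\<mu> \<Otimes>\<^sub>M \<mu>) ?U = 1 - measure (\<mu> \<Otimes>\<^sub>M \<mu>) S" "measure (\<nu> \<Otimes>\<^sub>M \<nu>) ?U = 1 - measure (\<nu> \<Otimes>\<^sub>M \<nu>) S"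
      using A.prob_compl[of S] D.prob_compl[of S] S by (simp_all add: sets space_pair_measure)
    ultimately show ?thesis using 2 by (simp add: step_cdf_def S_def[symmetric] algebra_simps)
  qed
qed

section \<open>The recursion for the distribution functions\<close>

lemma c_fun_measurable [measurable]: "c_fun \<in> borel_measurable C0_borel"
  unfolding c_fun_def[abs_def] by measurable

lemma M_fun_measurable [measurable]: "M_fun \<eta> \<in> borel_measurable C0_borel"
  unfolding M_fun_def[abs_def] by measurable

lemma step_event_measurable:
  "{z \<in> space (C0_borel \<Otimes>\<^sub>M (borel \<Otimes>\<^sub>M borel)). fst z (exp (fst (snd z)), exp (snd (snd z))) \<le> exp u}
    \<in> sets (C0_borel \<Otimes>\<^sub>M (borel \<Otimes>\<^sub>M borel))"
proof -
  let ?M = "C0_borel \<Otimes>\<^sub>M (borel \<Otimes>\<^sub>M borel) :: ((real \<times> real \<Rightarrow> real) \<times> real \<times> real) measure"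
  have "(\<lambda>z. (exp (fst (snd z)), exp (snd (snd z)))) \<in> ?M \<rightarrow>\<^sub>M borel \<Otimes>\<^sub>M borel"
    by measurable
  then have "(\<lambda>z. (exp (fst (snd z)), exp (snd (snd z)))) \<in> borel_measurable ?M"
    by (simp add: borel_prod)
  from measurable_eval[OF measurable_fst this] show ?thesis
    by (rule borel_measurable_le) simp
qed

lemma step_cdf_measurable:
  assumes \<mu>: "real_distribution \<mu>"
  shows "(\<lambda>g. step_cdf g \<mu> u) \<in> borel_measurable C0_borel"
proof -
  interpret \<mu>: real_distribution \<mu> by (rule \<mu>)
  interpret P: pair_prob_space \<mu> \<mu> ..
  let ?B = "{z \<in> space (C0_borel \<Otimes>\<^sub>M (borel \<Otimes>\<^sub>M borel)). fst z (exp (fst (snd z)), exp (snd (snd z))) \<le> exp u}"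
  have sets: "sets (\<mu> \<Otimes>\<^sub>M \<mu>) = sets (borel \<Otimes>\<^sub>M borel)" by (intro sets_pair_measure_cong) simp_all
  have "?B \<in> sets (C0_borel \<Otimes>\<^sub>M (\<mu> \<Otimes>\<^sub>M \<mu>))"
    unfolding sets_pair_measure_cong[OF refl sets] by (rule step_event_measurable)
  then have "(\<lambda>g. emeasure (\<mu> \<Otimes>\<^sub>M \<mu>) (Pair g -` ?B)) \<in> borel_measurable C0_borel"
    by (rule P.measurable_emeasure_Pair)
  then have m: "(\<lambda>g. measure (\<mu> \<Otimes>\<^sub>M \<mu>) (Pair g -` ?B)) \<in> borel_measurable C0_borel"
    unfolding measure_def by measurable
  have eq: "measure (\<mu> \<Otimes>\<^sub>M \<mu>) (Pair g -` ?B) = step_cdf g \<mu> u" if "g \<in> space C0_borel" for g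
  proof -
    have "Pair g -` ?B = {p. g (exp (fst p), exp (snd p)) \<le> exp u}"
      using that by (auto simp: space_pair_measure)
    then show ?thesis by (simp only: step_cdf_def)
  qed
  show ?thesis by (rule iffD1[OF measurable_cong m]) (rule eq)
qed

lemma step_cdf_bounds:
  assumes "real_distribution \<mu>"
  shows "0 \<le> step_cdf g \<mu> u" "step_cdf g \<mu> u \<le> 1"
proof -
  interpret \<mu>: real_distribution \<mu> by fact
  interpret P: pair_prob_space \<mu> \<mu> ..
  show "0 \<le> step_cdf g \<mu> u" "step_cdf g \<mu> u \<le> 1" by (simp_all add: step_cdf_def)
qed

text \<open>Turns independence of generated \<sigma>-algebras into a product law. The map
  \<open>h\<close> is built in so that the second factor can be taken directly in logarithmic
  coordinates.\<close>

lemma indep_rv_distr: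
  assumes M: "prob_space M" and ind: "indep_rv M S A T B" and h: "h \<in> T \<rightarrow>\<^sub>M T'"
  shows "distr M (S \<Otimes>\<^sub>M T') (\<lambda>\<omega>. (A \<omega>, h (B \<omega>))) = distr M S A \<Otimes>\<^sub>M distr M T' (\<lambda>\<omega>. h (B \<omega>))"
proof -
  interpret prob_space M by (rule M)
  have A: "A \<in> M \<rightarrow>\<^sub>M S" and B: "B \<in> M \<rightarrow>\<^sub>M T"
    and indep: "indep_set (sets (vimage_algebra (space M) A S)) (sets (vimage_algebra (space M) B T))"
    using ind by (auto simp: indep_rv_def)
  have hB: "(\<lambda>\<omega>. h (B \<omega>)) \<in> M \<rightarrow>\<^sub>M T'" by (rule measurable_compose[OF B h])
  interpret DA: prob_space "distr M S A" by (rule prob_space_distr[OF A])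
  interpret DB: prob_space "distr M T' (\<lambda>\<omega>. h (B \<omega>))" by (rule prob_space_distr[OF hB])
  have AB: "(\<lambda>\<omega>. (A \<omega>, h (B \<omega>))) \<in> M \<rightarrow>\<^sub>M S \<Otimes>\<^sub>M T'" by (rule measurable_Pair[OF A hB])
  show ?thesis
  proof (rule pair_measure_eqI[symmetric])
    fix a b
    assume a: "a \<in> sets (distr M S A)" and b: "b \<in> sets (distr M T' (\<lambda>\<omega>. h (B \<omega>)))"
    have a': "A -` a \<inter> space M \<in> sets (vimage_algebra (space M) A S)"
      using a by (simp add: in_vimage_algebra)
    have "B -` (h -` b \<inter> space T) \<inter> space M \<in> sets (vimage_algebra (space M) B T)"
      using b measurable_sets[OF h] by (intro in_vimage_algebra) simp
    moreover have "B -` (h -` b \<inter> space T) \<inter> space M = (\<lambda>\<omega>. h (B \<omega>)) -` b \<inter> space M"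
      using measurable_space[OF B] by auto
    ultimately have b': "(\<lambda>\<omega>. h (B \<omega>)) -` b \<inter> space M \<in> sets (vimage_algebra (space M) B T)"
      by simp
    have "prob ((A -` a \<inter> space M) \<inter> ((\<lambda>\<omega>. h (B \<omega>)) -` b \<inter> space M))
        = prob (A -` a \<inter> space M) * prob ((\<lambda>\<omega>. h (B \<omega>)) -` b \<inter> space M)"
      by (rule indep_setD[OF indep a' b'])
    moreover have "(\<lambda>\<omega>. (A \<omega>, h (B \<omega>))) -` (a \<times> b) \<inter> space M
        = (A -` a \<inter> space M) \<inter> ((\<lambda>\<omega>. h (B \<omega>)) -` b \<inter> space M)" by auto
    ultimately show "emeasure (distr M S A) a * emeasure (distr M T' (\<lambda>\<omega>. h (B \<omega>))) b
        = emeasure (distr M (S \<Otimes>\<^sub>M T') (\<lambda>\<omega>. (A \<omega>, h (B \<omega>)))) (a \<times> b)"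
      using a b A hB AB by (simp add: emeasure_distr emeasure_eq_measure ennreal_mult)
  qed (simp_all add: DA.sigma_finite_measure_axioms DB.sigma_finite_measure_axioms)
qed

text \<open>The joint law of \<open>G\<close>, \<open>ln X\<close> and \<open>ln X'\<close> is a
  product, and \<open>G\<close> enters only through its law; this allows the right-hand side to
  integrate over \<open>F\<close>.\<close>

lemma cdf_step:
  assumes M: "prob_space M" and F: "F \<in> M \<rightarrow>\<^sub>M C0_borel"
    and X: "X \<in> borel_measurable M" "\<And>\<omega>. \<omega> \<in> space M \<Longrightarrow> X \<omega> > 0"
    and Y: "Y \<in> borel_measurable M" "\<And>\<omega>. \<omega> \<in> space M \<Longrightarrow> Y \<omega> > 0"
    and ind: "prob_space.indep_var M borel X borel X'" and X': "distr M borel X' = distr M borel X"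
    and indG: "indep_rv M C0_borel G borel (\<lambda>\<omega>. (X \<omega>, X' \<omega>))"
    and GF: "distr M C0_borel G = distr M C0_borel F"
    and YG: "distr M borel Y = distr M borel (\<lambda>\<omega>. G \<omega> (X \<omega>, X' \<omega>))"
  shows "cdf (distr M borel (\<lambda>\<omega>. ln (Y \<omega>))) u
    = (\<integral>\<omega>. step_cdf (F \<omega>) (distr M borel (\<lambda>\<omega>. ln (X \<omega>))) u \<partial>M)"
proof -
  interpret prob_space M by (rule M)
  define \<mu> where "\<mu> = distr M borel (\<lambda>\<omega>. ln (X \<omega>))"
  have \<mu>: "real_distribution \<mu>" unfolding \<mu>_def using X(1) by (intro real_distribution_distr) simp
  interpret \<mu>: real_distribution \<mu> by (rule \<mu>)
  interpret P: pair_prob_space \<mu> \<mu> ..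
  have X'm [measurable]: "X' \<in> borel_measurable M" and Xm [measurable]: "X \<in> borel_measurable M"
    using indep_var_rv2[OF ind] X by auto
  have Gm: "G \<in> M \<rightarrow>\<^sub>M C0_borel" using indG by (simp add: indep_rv_def)
  have pm: "(\<lambda>\<omega>. (X \<omega>, X' \<omega>)) \<in> borel_measurable M" by (simp add: borel_prod[symmetric])
  have GX: "(\<lambda>\<omega>. G \<omega> (X \<omega>, X' \<omega>)) \<in> borel_measurable M" by (rule measurable_eval[OF Gm pm])
  have lnX': "distr M borel (\<lambda>\<omega>. ln (X' \<omega>)) = \<mu>"
  proof -
    have "distr M borel (\<lambda>\<omega>. ln (X' \<omega>)) = distr (distr M borel X') borel ln"
      by (subst distr_distr) (simp_all add: o_def)
    also have "\<dots> = \<mu>" unfolding X' \<mu>_def by (subst distr_distr) (simp_all add: o_def)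
    finally show ?thesis .
  qed
  \<comment> \<open>Only the law of \<open>X'\<close> is prescribed, so positivity, and with it
    \<open>exp (ln (X' \<omega>)) = X' \<omega>\<close>, holds merely almost surely.\<close>
  have pos': "AE \<omega> in M. X' \<omega> > 0"
  proof -
    have "AE x in distr M borel X. x > 0" using X by (subst AE_distr_iff) auto
    then have "AE x in distr M borel X'. x > 0" by (simp only: X')
    then show ?thesis by (subst (asm) AE_distr_iff) auto
  qed
  let ?h = "\<lambda>p :: real \<times> real. (ln (fst p), ln (snd p))"
  have h: "?h \<in> borel \<rightarrow>\<^sub>M borel \<Otimes>\<^sub>M borel" by (simp add: borel_prod[symmetric])
  have pair: "distr M (borel \<Otimes>\<^sub>M borel) (\<lambda>\<omega>. ?h (X \<omega>, X' \<omega>)) = \<mu> \<Otimes>\<^sub>M \<mu>"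
  proof -
    have "indep_var borel (ln \<circ> X) borel (ln \<circ> X')"
      by (rule indep_var_compose[OF ind]) simp_all
    then have "distr M borel (ln \<circ> X) \<Otimes>\<^sub>M distr M borel (ln \<circ> X') = distr M (borel \<Otimes>\<^sub>M borel) (\<lambda>\<omega>. ((ln \<circ> X) \<omega>, (ln \<circ> X') \<omega>))"
      unfolding indep_var_distribution_eq by simp
    then show ?thesis using lnX' by (simp add: o_def \<mu>_def)
  qed
  let ?N = "C0_borel \<Otimes>\<^sub>M (borel \<Otimes>\<^sub>M borel) :: ((real \<times> real \<Rightarrow> real) \<times> real \<times> real) measure"
  let ?B = "{z \<in> space ?N. fst z (exp (fst (snd z)), exp (snd (snd z))) \<le> exp u}"
  have B: "?B \<in> sets ?N" by (rule step_event_measurable)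
  have sets: "sets (\<mu> \<Otimes>\<^sub>M \<mu>) = sets (borel \<Otimes>\<^sub>M borel)" by (intro sets_pair_measure_cong) simp_all
  have B': "?B \<in> sets (distr M C0_borel F \<Otimes>\<^sub>M (\<mu> \<Otimes>\<^sub>M \<mu>))"
    using B by (simp only: sets_pair_measure_cong[OF sets_distr sets])
  have joint: "distr M ?N (\<lambda>\<omega>. (G \<omega>, ?h (X \<omega>, X' \<omega>))) = distr M C0_borel F \<Otimes>\<^sub>M (\<mu> \<Otimes>\<^sub>M \<mu>)"
    using indep_rv_distr[OF M indG h] by (simp only: pair GF)
  have hX: "(\<lambda>\<omega>. (G \<omega>, ?h (X \<omega>, X' \<omega>))) \<in> M \<rightarrow>\<^sub>M ?N"
    by (rule measurable_Pair[OF Gm measurable_compose[OF pm h]])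
  have "cdf (distr M borel (\<lambda>\<omega>. ln (Y \<omega>))) u = prob {\<omega> \<in> space M. ln (Y \<omega>) \<le> u}"
    unfolding cdf_def using Y(1) by (subst measure_distr) (auto intro!: arg_cong[where f=prob])
  also have "\<dots> = prob (Y -` {..exp u} \<inter> space M)"
  proof -
    have "ln (Y \<omega>) \<le> u \<longleftrightarrow> Y \<omega> \<le> exp u" if "\<omega> \<in> space M" for \<omega>
      using Y(2)[OF that] by (metis exp_le_cancel_iff exp_ln)
    then show ?thesis by (intro arg_cong[where f=prob]) auto
  qed
  also have "\<dots> = measure (distr M borel Y) {..exp u}" using Y(1) by (simp add: measure_distr)
  also have "\<dots> = prob {\<omega> \<in> space M. G \<omega> (X \<omega>, X' \<omega>) \<le> exp u}"
    unfolding YG using GX by (subst measure_distr) (auto intro!: arg_cong[where f=prob])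
  also have "\<dots> = prob ((\<lambda>\<omega>. (G \<omega>, ?h (X \<omega>, X' \<omega>))) -` ?B \<inter> space M)"
  proof (rule finite_measure_eq_AE)
    show "AE \<omega> in M. \<omega> \<in> {\<omega> \<in> space M. G \<omega> (X \<omega>, X' \<omega>) \<le> exp u}
        \<longleftrightarrow> \<omega> \<in> (\<lambda>\<omega>. (G \<omega>, ?h (X \<omega>, X' \<omega>))) -` ?B \<inter> space M"
      using pos' AE_space
    proof eventually_elim
      case (elim \<omega>)
      then have "exp (ln (X \<omega>)) = X \<omega>" "exp (ln (X' \<omega>)) = X' \<omega>" using X(2) by auto
      moreover have "(G \<omega>, ?h (X \<omega>, X' \<omega>)) \<in> space ?N" using measurable_space[OF hX elim(2)] .
      ultimately show ?case using elim by simp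
    qed
    show "{\<omega> \<in> space M. G \<omega> (X \<omega>, X' \<omega>) \<le> exp u} \<in> events"
      using borel_measurable_le[OF GX borel_measurable_const] .
    show "(\<lambda>\<omega>. (G \<omega>, ?h (X \<omega>, X' \<omega>))) -` ?B \<inter> space M \<in> events" by (rule measurable_sets[OF hX B])
  qed
  also have "\<dots> = measure (distr M C0_borel F \<Otimes>\<^sub>M (\<mu> \<Otimes>\<^sub>M \<mu>)) ?B"
    unfolding joint[symmetric] by (rule measure_distr[OF hX B, symmetric])
  also have "\<dots> = (\<integral>\<omega>. step_cdf (F \<omega>) \<mu> u \<partial>M)"
  proof -
    have "emeasure (distr M C0_borel F \<Otimes>\<^sub>M (\<mu> \<Otimes>\<^sub>M \<mu>)) ?B
        = (\<integral>\<^sup>+g. emeasure (\<mu> \<Otimes>\<^sub>M \<mu>) (Pair g -` ?B) \<partial>distr M C0_borel F)"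
      by (rule P.emeasure_pair_measure_alt[OF B'])
    also have "\<dots> = (\<integral>\<^sup>+g. ennreal (step_cdf g \<mu> u) \<partial>distr M C0_borel F)"
    proof (rule nn_integral_cong)
      fix g assume "g \<in> space (distr M C0_borel F)"
      then have "Pair g -` ?B = {p. g (exp (fst p), exp (snd p)) \<le> exp u}"
        by (auto simp: space_pair_measure)
      then show "emeasure (\<mu> \<Otimes>\<^sub>M \<mu>) (Pair g -` ?B) = ennreal (step_cdf g \<mu> u)"
        by (simp only: step_cdf_def P.emeasure_eq_measure)
    qed
    also have "\<dots> = (\<integral>\<^sup>+\<omega>. ennreal (step_cdf (F \<omega>) \<mu> u) \<partial>M)"
      using step_cdf_measurable[OF \<mu>] by (subst nn_integral_distr[OF F]) simp_all
    finally have "measure (distr M C0_borel F \<Otimes>\<^sub>M (\<mu> \<Otimes>\<^sub>M \<mu>)) ?B = enn2real (\<integral>\<^sup>+\<omega>. ennreal (step_cdf (F \<omega>) \<mu> u) \<partial>M)"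
      by (simp only: measure_def)
    also have "\<dots> = (\<integral>\<omega>. step_cdf (F \<omega>) \<mu> u \<partial>M)"
      by (rule integral_eq_nn_integral[symmetric])
         (use measurable_compose[OF F step_cdf_measurable[OF \<mu>]] step_cdf_bounds[OF \<mu>] in auto)
    finally show ?thesis .
  qed
  finally show ?thesis by (simp only: \<mu>_def)
qed

section \<open>The averaged step and its iteration\<close>

locale critical_step = prob_space M for M :: "'a measure" +
  fixes F :: "'a \<Rightarrow> real \<times> real \<Rightarrow> real" and \<eta> :: real
  assumes random_function: "H_random_function M F"
    and eta: "0 < \<eta>" "\<eta> < 1"
    and M_fun_finite: "(\<integral>\<^sup>+\<omega>. M_fun \<eta> (F \<omega>) \<partial>M) < \<infinity>"
    and eps_mean: "(\<integral>\<omega>. eps (F \<omega>) \<partial>M) = 0"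
    and Gamma_mean: "(\<integral>\<omega>. enn2real (Gamma_fun 0 1 (F \<omega>)) * eps (F \<omega>) \<partial>M) = 0"
begin

text \<open>The averaged operator of the overview, acting on laws instead of distribution
  functions.\<close>

definition mean_step :: "real measure \<Rightarrow> real \<Rightarrow> real" where
  "mean_step \<mu> u = (\<integral>\<omega>. step_cdf (F \<omega>) \<mu> u \<partial>M)"

definition c_mean :: real where
  "c_mean = (\<integral>\<omega>. enn2real (c_fun (F \<omega>)) \<partial>M)"

definition M_mean :: real where
  "M_mean = (\<integral>\<omega>. enn2real (M_fun \<eta> (F \<omega>)) \<partial>M)"

lemma F_measurable [measurable]: "F \<in> M \<rightarrow>\<^sub>M C0_borel"
  using random_function by (simp add: H_random_function_def)

lemma F_C0: "\<omega> \<in> space M \<Longrightarrow> F \<omega> \<in> C0"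
  using measurable_space[OF F_measurable] by simp

lemma F_T_fun_measurable: "\<omega> \<in> space M \<Longrightarrow> T_fun (F \<omega>) \<in> borel_measurable borel"
  by (rule T_fun_measurable1[OF F_C0])

lemma AE_class_H: "AE \<omega> in M. F \<omega> \<in> class_H"
  using random_function by (simp add: H_random_function_def)

lemma AE_M_fun_finite: "AE \<omega> in M. M_fun \<eta> (F \<omega>) < \<infinity>"
proof -
  have "AE \<omega> in M. M_fun \<eta> (F \<omega>) \<noteq> \<infinity>"
    by (rule nn_integral_noteq_infinite) (use M_fun_finite in auto)
  then show ?thesis by (simp add: less_top)
qed

lemma M_fun_integrable: "integrable M (\<lambda>\<omega>. enn2real (M_fun \<eta> (F \<omega>)))"
proof (rule integrableI_nonneg)
  have "(\<integral>\<^sup>+\<omega>. ennreal (enn2real (M_fun \<eta> (F \<omega>))) \<partial>M) \<le> (\<integral>\<^sup>+\<omega>. M_fun \<eta> (F \<omega>) \<partial>M)"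
  proof (rule nn_integral_mono)
    show "ennreal (enn2real (M_fun \<eta> (F \<omega>))) \<le> M_fun \<eta> (F \<omega>)" for \<omega>
      by (cases "M_fun \<eta> (F \<omega>)") simp_all
  qed
  then show "(\<integral>\<^sup>+\<omega>. ennreal (enn2real (M_fun \<eta> (F \<omega>))) \<partial>M) < \<infinity>"
    using M_fun_finite by (rule le_less_trans)
qed auto

text \<open>One domination argument for \<open>c_fun\<close> and \<open>Gamma_fun 0 1\<close>; the
  factor 2 leaves room for the two summands of \<open>c_fun\<close>.\<close>

lemma enn2real_bound:
  assumes m: "g \<in> borel_measurable C0_borel"
    and le: "\<And>f. f \<in> class_H \<Longrightarrow> T_fun f \<in> borel_measurable borel \<Longrightarrow> g f \<le> 2 * (1 + M_fun \<eta> f)"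
  shows "AE \<omega> in M. g (F \<omega>) < \<infinity>" and "integrable M (\<lambda>\<omega>. enn2real (g (F \<omega>)))"
proof -
  have ae: "AE \<omega> in M. g (F \<omega>) < \<infinity> \<and> enn2real (g (F \<omega>)) \<le> 2 * (1 + enn2real (M_fun \<eta> (F \<omega>)))"
    using AE_class_H AE_M_fun_finite AE_space
  proof eventually_elim
    case (elim \<omega>)
    obtain r where r: "r \<ge> 0" "M_fun \<eta> (F \<omega>) = ennreal r"
      using elim(2) by (cases "M_fun \<eta> (F \<omega>)") auto
    have "g (F \<omega>) \<le> 2 * (1 + M_fun \<eta> (F \<omega>))" by (rule le[OF elim(1) F_T_fun_measurable[OF elim(3)]])
    also have "\<dots> = ennreal (2 * (1 + r))"
      using r by (simp add: ennreal_mult ennreal_plus)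
    finally have le: "g (F \<omega>) \<le> ennreal (2 * (1 + r))" .
    have "enn2real (g (F \<omega>)) \<le> 2 * (1 + r)" using r by (intro enn2real_leI le) simp
    moreover have "g (F \<omega>) < \<infinity>" using le by (rule le_less_trans) simp
    ultimately show ?case using r by simp
  qed
  then show "AE \<omega> in M. g (F \<omega>) < \<infinity>" by (rule eventually_mono) simp
  show "integrable M (\<lambda>\<omega>. enn2real (g (F \<omega>)))"
  proof (rule Bochner_Integration.integrable_bound)
    show "integrable M (\<lambda>\<omega>. 2 * (1 + enn2real (M_fun \<eta> (F \<omega>))))"
      using M_fun_integrable by simp
    show "(\<lambda>\<omega>. enn2real (g (F \<omega>))) \<in> borel_measurable M"
      using measurable_compose[OF F_measurable m] by simp
    show "AE \<omega> in M. norm (enn2real (g (F \<omega>))) \<le> norm (2 * (1 + enn2real (M_fun \<eta> (F \<omega>))))"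
      using ae by (rule eventually_mono) simp
  qed
qed

lemma c_fun_integrable: "integrable M (\<lambda>\<omega>. enn2real (c_fun (F \<omega>)))"
  and AE_c_fun_finite: "AE \<omega> in M. c_fun (F \<omega>) < \<infinity>"
  using enn2real_bound[OF c_fun_measurable] c_fun_le eta by auto

lemma Gamma_fun_integrable: "integrable M (\<lambda>\<omega>. enn2real (Gamma_fun 0 1 (F \<omega>)))"
proof (rule enn2real_bound(2))
  fix f assume "f \<in> class_H" "T_fun f \<in> borel_measurable borel"
  then have "Gamma_fun 0 1 f \<le> 1 + M_fun \<eta> f" by (intro Gamma_fun_le eta) auto
  also have "\<dots> \<le> 2 * (1 + M_fun \<eta> f)"
    using mult_right_mono[of 1 "2 :: ennreal" "1 + M_fun \<eta> f"] by (simp only: mult_1_left one_le_numeral zero_le)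
  finally show "Gamma_fun 0 1 f \<le> 2 * (1 + M_fun \<eta> f)" .
qed measurable

lemma eps_F_measurable [measurable]: "(\<lambda>\<omega>. eps (F \<omega>)) \<in> borel_measurable M"
  by measurable

lemma abs_eps: "\<bar>eps f\<bar> = 1"
  by (simp add: eps_def)

lemma eps_integrable: "integrable M (\<lambda>\<omega>. eps (F \<omega>))"
  by (rule integrable_const_bound[of _ 1]) (simp_all add: abs_eps)

lemma Gamma_eps_integrable: "integrable M (\<lambda>\<omega>. enn2real (Gamma_fun 0 1 (F \<omega>)) * eps (F \<omega>))"
proof (rule Bochner_Integration.integrable_bound[OF Gamma_fun_integrable])
  show "AE \<omega> in M. norm (enn2real (Gamma_fun 0 1 (F \<omega>)) * eps (F \<omega>)) \<le> norm (enn2real (Gamma_fun 0 1 (F \<omega>)))"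
    by (simp add: abs_mult abs_eps)
qed measurable

lemma step_cdf_integrable:
  assumes "real_distribution \<mu>"
  shows "integrable M (\<lambda>\<omega>. step_cdf (F \<omega>) \<mu> u)"
  by (rule integrable_const_bound[of _ 1])
     (use measurable_compose[OF F_measurable step_cdf_measurable[OF assms]] step_cdf_bounds[OF assms] in auto)

lemma c_star_eq: "c_star M F = ennreal (9 / 2 * c_mean)"
proof -
  have "(\<integral>\<^sup>+\<omega>. c_fun (F \<omega>) \<partial>M) = (\<integral>\<^sup>+\<omega>. ennreal (enn2real (c_fun (F \<omega>))) \<partial>M)"
    by (rule nn_integral_cong_AE) (use AE_c_fun_finite in \<open>eventually_elim, simp\<close>)
  also have "\<dots> = ennreal c_mean"
    unfolding c_mean_def by (rule nn_integral_eq_integral[OF c_fun_integrable]) simp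
  finally show ?thesis
    unfolding c_star_def by (simp add: ennreal_mult[symmetric] c_mean_def integral_nonneg_AE)
qed

text \<open>This is where nondegeneracy enters: a vanishing mean of the nonnegative
  \<open>c_fun\<close> would force \<open>F\<close> to be \<open>phi_plus\<close> or
  \<open>phi_minus\<close> almost surely.\<close>

lemma c_mean_pos:
  assumes pos: "measure M {\<omega> \<in> space M. F \<omega> \<notin> {phi_plus, phi_minus}} > 0"
  shows "c_mean > 0"
proof (rule ccontr)
  assume "\<not> c_mean > 0"
  then have "c_mean = 0" unfolding c_mean_def
    by (metis Bochner_Integration.integral_nonneg enn2real_nonneg less_eq_real_def)
  then have "AE \<omega> in M. enn2real (c_fun (F \<omega>)) = 0"
    unfolding c_mean_def by (subst (asm) integral_nonneg_eq_0_iff_AE[OF c_fun_integrable]) auto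
  then have "AE \<omega> in M. F \<omega> \<in> {phi_plus, phi_minus}"
    using AE_c_fun_finite AE_class_H AE_space
  proof eventually_elim
    case (elim \<omega>)
    then have "c_fun (F \<omega>) = 0" by (auto simp: enn2real_eq_0_iff)
    then show ?case using elim(3,4) F_C0 F_T_fun_measurable by (intro c_fun_zero_imp_phi) auto
  qed
  then have "AE \<omega> in M. \<omega> \<notin> {\<omega> \<in> space M. F \<omega> \<notin> {phi_plus, phi_minus}}"
    by (rule eventually_mono) auto
  \<comment> \<open>\<open>measure\<close> is \<open>0\<close> outside the \<sigma>-algebra, so
    positivity of the measure already yields measurability of the event.\<close>
  moreover have "{\<omega> \<in> space M. F \<omega> \<notin> {phi_plus, phi_minus}} \<in> events"
    using pos measure_notin_sets by fastforce
  ultimately have "emeasure M {\<omega> \<in> space M. F \<omega> \<notin> {phi_plus, phi_minus}} = 0"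
    using AE_iff_null_sets by blast
  then show False using pos by (simp add: measure_def)
qed

text \<open>The cost of a single step is affine in \<open>eps\<close>, with a coefficient that does
  not depend on \<omega>; the zero mean of the sign leaves \<open>a\<close>.\<close>

lemma mean_step_nonexpansive:
  assumes \<mu>: "real_distribution \<mu>" and \<nu>: "real_distribution \<nu>"
    and le: "\<And>t. cdf \<mu> t \<le> cdf \<nu> t + a" and a: "0 \<le> a"
  shows "mean_step \<mu> u \<le> mean_step \<nu> u + a"
proof -
  have "mean_step \<mu> u - mean_step \<nu> u = (\<integral>\<omega>. step_cdf (F \<omega>) \<mu> u - step_cdf (F \<omega>) \<nu> u \<partial>M)"
    unfolding mean_step_def
    by (rule Bochner_Integration.integral_diff[symmetric]) (intro step_cdf_integrable \<mu> \<nu>)+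
  also have "\<dots> \<le> (\<integral>\<omega>. a * (1 + eps (F \<omega>) * (cdf \<mu> u + cdf \<nu> u - 1)) \<partial>M)"
  proof (rule integral_mono_AE)
    show "AE \<omega> in M. step_cdf (F \<omega>) \<mu> u - step_cdf (F \<omega>) \<nu> u \<le> a * (1 + eps (F \<omega>) * (cdf \<mu> u + cdf \<nu> u - 1))"
      using AE_class_H by (rule eventually_mono) (intro step_cdf_nonexpansive \<mu> \<nu> le a)
  qed (use eps_integrable step_cdf_integrable \<mu> \<nu> in auto)
  also have "\<dots> = a" using eps_integrable by (simp add: eps_mean prob_space)
  finally show ?thesis by simp
qed

text \<open>The two mean-zero conditions cancel exactly the contributions of order \<open>1\<close>
  and \<open>s^-2\<close>, so that the flux of order \<open>s^-3\<close> becomes the leading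
  change.\<close>

lemma mean_step_bar_law:
  fixes m s u :: real
  assumes s: "s > 0"
  defines "v \<equiv> (u - m) / s"
  shows "\<bar>mean_step (bar_law m s) u - (bar_cdf v + bar_flux v / s ^ 3 * c_mean)\<bar> \<le> 18 * s powr (- (3 + \<eta>)) * M_mean"
proof -
  let ?\<nu> = "bar_law m s"
  define A where "A \<omega> = bar_cdf v - eps (F \<omega>) * (bar_cdf v - (bar_cdf v)\<^sup>2)
      - (bar_density v / s)\<^sup>2 * (enn2real (Gamma_fun 0 1 (F \<omega>)) * eps (F \<omega>))
      + bar_flux v / s ^ 3 * enn2real (c_fun (F \<omega>))" for \<omega>
  have A: "has_bochner_integral M A (bar_cdf v - 0 * (bar_cdf v - (bar_cdf v)\<^sup>2)
      - (bar_density v / s)\<^sup>2 * 0 + bar_flux v / s ^ 3 * c_mean)"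
  proof -
    have "has_bochner_integral M (\<lambda>\<omega>. bar_cdf v) (bar_cdf v)"
      using has_bochner_integral_integrable[of M "\<lambda>_. bar_cdf v"] by (simp add: prob_space)
    moreover have "has_bochner_integral M (\<lambda>\<omega>. eps (F \<omega>)) 0"
      using has_bochner_integral_integrable[OF eps_integrable] by (simp only: eps_mean)
    moreover have "has_bochner_integral M (\<lambda>\<omega>. enn2real (Gamma_fun 0 1 (F \<omega>)) * eps (F \<omega>)) 0"
      using has_bochner_integral_integrable[OF Gamma_eps_integrable] by (simp only: Gamma_mean)
    moreover have "has_bochner_integral M (\<lambda>\<omega>. enn2real (c_fun (F \<omega>))) c_mean"
      unfolding c_mean_def by (rule has_bochner_integral_integrable[OF c_fun_integrable])
    ultimately show ?thesis unfolding A_def[abs_def]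
      by (intro has_bochner_integral_add has_bochner_integral_diff has_bochner_integral_mult_left has_bochner_integral_mult_right)
  qed
  have Aint: "integrable M A" and Aeq: "(\<integral>\<omega>. A \<omega> \<partial>M) = bar_cdf v + bar_flux v / s ^ 3 * c_mean"
    using A by (simp_all add: has_bochner_integral_iff)
  note Sint = step_cdf_integrable[OF real_distribution_bar_law[OF s]]
  have "mean_step ?\<nu> u - (bar_cdf v + bar_flux v / s ^ 3 * c_mean) = (\<integral>\<omega>. step_cdf (F \<omega>) ?\<nu> u - A \<omega> \<partial>M)"
    unfolding mean_step_def Aeq[symmetric] by (rule Bochner_Integration.integral_diff[symmetric, OF Sint Aint])
  also have "\<bar>\<dots>\<bar> \<le> (\<integral>\<omega>. \<bar>step_cdf (F \<omega>) ?\<nu> u - A \<omega>\<bar> \<partial>M)" by (rule integral_abs_bound)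
  also have "\<dots> \<le> (\<integral>\<omega>. 18 * s powr (- (3 + \<eta>)) * enn2real (M_fun \<eta> (F \<omega>)) \<partial>M)"
  proof (rule integral_mono_AE)
    show "AE \<omega> in M. \<bar>step_cdf (F \<omega>) ?\<nu> u - A \<omega>\<bar> \<le> 18 * s powr (- (3 + \<eta>)) * enn2real (M_fun \<eta> (F \<omega>))"
      using AE_class_H AE_M_fun_finite AE_space
    proof eventually_elim
      case (elim \<omega>)
      have "A \<omega> = bar_cdf v - eps (F \<omega>) * (bar_cdf v - (bar_cdf v)\<^sup>2)
        - eps (F \<omega>) * (bar_density v / s)\<^sup>2 * enn2real (Gamma_fun 0 1 (F \<omega>))
        + bar_flux v / s ^ 3 * enn2real (c_fun (F \<omega>))" by (simp add: A_def algebra_simps)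
      then show ?case
        using step_cdf_consistency[OF elim(1) F_T_fun_measurable[OF elim(3)] eta elim(2) s, of m u]
        unfolding v_def by simp
    qed
  qed (use Sint Aint M_fun_integrable in auto)
  also have "\<dots> = 18 * s powr (- (3 + \<eta>)) * M_mean" by (simp add: M_mean_def)
  finally show ?thesis .
qed

end

section \<open>Comparison along the self-similar scale\<close>

context critical_step
begin

definition scale :: "nat \<Rightarrow> real" where
  "scale k = (9 / 2 * c_mean * real k) powr (1 / 3)"

text \<open>The first summand is the consistency error at \<open>scale k\<close>; the 5 is the
  defect \<open>5 / k^2\<close> of self-similarity, weakened to the same power of
  \<open>k\<close>.\<close>

definition step_err :: "nat \<Rightarrow> real" where
  "step_err k = (18 * (9 / 2 * c_mean) powr (- (1 + \<eta> / 3)) * M_mean + 5) * real k powr (- (1 + \<eta> / 3))"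

lemma M_mean_nonneg: "M_mean \<ge> 0"
  unfolding M_mean_def by (intro Bochner_Integration.integral_nonneg) simp

lemma step_err_nonneg: "step_err k \<ge> 0"
  using M_mean_nonneg by (simp add: step_err_def)

lemma step_err_summable: "summable step_err"
  unfolding step_err_def[abs_def] using eta by (intro summable_mult) (simp add: summable_real_powr_iff)

lemma scale_cube: "c_mean > 0 \<Longrightarrow> scale k ^ 3 = 9 / 2 * c_mean * real k"
proof -
  assume "c_mean > 0"
  then have "0 \<le> 9 / 2 * c_mean * real k" by simp
  moreover have "(x powr (1 / 3)) ^ 3 = x" if "x \<ge> 0" for x :: real
    using that by (simp add: power3_eq_cube powr_add[symmetric])
  ultimately show ?thesis unfolding scale_def by blast
qed

lemma scale_pos: "c_mean > 0 \<Longrightarrow> k \<ge> 1 \<Longrightarrow> scale k > 0"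
  by (simp add: scale_def)

text \<open>The choice of \<open>scale\<close> makes the flux of one averaged step equal to
  \<open>2 / (9 k)\<close> times \<open>bar_flux\<close>, the increment produced by rescaling from
  \<open>k\<close> to \<open>k + 1\<close>.\<close>

lemma bar_law_step:
  assumes c: "c_mean > 0" and k: "k \<ge> 1"
  shows "\<bar>mean_step (bar_law m (scale k)) u - cdf (bar_law m (scale (Suc k))) u\<bar> \<le> step_err k"
proof -
  let ?s = "scale k" and ?s' = "scale (Suc k)"
  define r where "r = ?s / ?s'"
  define v where "v = (u - m) / ?s"
  have s: "?s > 0" "?s' > 0" using scale_pos[OF c] k by auto
  have k1: "real k \<ge> 1" using k by simp
  have r3: "r ^ 3 = real k / (real k + 1)"
    using c by (simp add: r_def power_divide scale_cube add.commute)
  have "(u - m) / ?s' = r * v" using s by (simp add: r_def v_def)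
  then have cdf': "cdf (bar_law m ?s') u = bar_cdf (r * v)" using s by (simp add: cdf_bar_law)
  have flux: "bar_flux v / ?s ^ 3 * c_mean = 2 / (9 * real k) * bar_flux v"
    unfolding scale_cube[OF c] using c k1 by (simp add: field_simps)
  have 1: "\<bar>mean_step (bar_law m ?s) u - (bar_cdf v + 2 / (9 * real k) * bar_flux v)\<bar>
      \<le> 18 * ?s powr (- (3 + \<eta>)) * M_mean"
    using mean_step_bar_law[OF s(1), of m u] unfolding v_def[symmetric] flux .
  have 2: "\<bar>bar_cdf (r * v) - bar_cdf v - 2 / (9 * real k) * bar_flux v\<bar> \<le> 5 / (real k)\<^sup>2"
    by (rule bar_cdf_rescale) (use k1 s r3 in \<open>simp_all add: r_def\<close>)
  have 3: "?s powr (- (3 + \<eta>)) = (9 / 2 * c_mean) powr (- (1 + \<eta> / 3)) * real k powr (- (1 + \<eta> / 3))"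
  proof -
    have "?s powr (- (3 + \<eta>)) = (9 / 2 * c_mean * real k) powr (1 / 3 * (- (3 + \<eta>)))"
      unfolding scale_def by (rule powr_powr)
    also have "1 / 3 * (- (3 + \<eta>)) = - (1 + \<eta> / 3)" by simp
    also have "(9 / 2 * c_mean * real k) powr (- (1 + \<eta> / 3))
        = (9 / 2 * c_mean) powr (- (1 + \<eta> / 3)) * real k powr (- (1 + \<eta> / 3))"
      by (rule powr_mult)
    finally show ?thesis .
  qed
  have 4: "5 / (real k)\<^sup>2 \<le> 5 * real k powr (- (1 + \<eta> / 3))"
  proof -
    have "real k powr (- 2) \<le> real k powr (- (1 + \<eta> / 3))" using k1 eta by (intro powr_mono) auto
    moreover have "real k powr (- 2) = 1 / (real k)\<^sup>2" using k1 by (simp add: powr_minus_divide)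
    ultimately show ?thesis by simp
  qed
  have "step_err k = 18 * ?s powr (- (3 + \<eta>)) * M_mean + 5 * real k powr (- (1 + \<eta> / 3))"
    unfolding step_err_def 3 by (simp add: algebra_simps)
  then show ?thesis unfolding cdf' using 1 2 4 by linarith
qed

text \<open>Nonexpansiveness carries the accumulated error through a step unchanged, and replacing
  the image of the profile by the next profile adds one \<open>step_err\<close>.\<close>

lemma iterate_upper:
  assumes c: "c_mean > 0" and \<mu>: "\<And>n. real_distribution (\<mu> n)"
    and rec: "\<And>n u. cdf (\<mu> (Suc n)) u = mean_step (\<mu> n) u"
    and n0: "n0 \<ge> 1" and d: "d \<ge> 0"
    and init: "\<And>t. cdf (\<mu> 0) t \<le> cdf (bar_law m (scale n0)) t + d"
  shows "cdf (\<mu> n) t \<le> cdf (bar_law m (scale (n0 + n))) t + (d + (\<Sum>j<n. step_err (j + n0)))"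
proof (induction n arbitrary: t)
  case 0
  then show ?case using init by simp
next
  case (Suc n)
  have k: "n0 + n \<ge> 1" using n0 by simp
  have "cdf (\<mu> (Suc n)) t = mean_step (\<mu> n) t" by (rule rec)
  also have "\<dots> \<le> mean_step (bar_law m (scale (n0 + n))) t + (d + (\<Sum>j<n. step_err (j + n0)))"
    by (intro mean_step_nonexpansive \<mu> real_distribution_bar_law scale_pos c k Suc.IH add_nonneg_nonneg d
        sum_nonneg step_err_nonneg)
  also have "\<dots> \<le> cdf (bar_law m (scale (Suc (n0 + n)))) t + step_err (n0 + n) + (d + (\<Sum>j<n. step_err (j + n0)))"
    using bar_law_step[OF c k, of m t] by linarith
  finally show ?case by (simp add: add.commute add.left_commute)
qed

lemma iterate_lower:
  assumes c: "c_mean > 0" and \<mu>: "\<And>n. real_distribution (\<mu> n)"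
    and rec: "\<And>n u. cdf (\<mu> (Suc n)) u = mean_step (\<mu> n) u"
    and n0: "n0 \<ge> 1" and d: "d \<ge> 0"
    and init: "\<And>t. cdf (bar_law m (scale n0)) t \<le> cdf (\<mu> 0) t + d"
  shows "cdf (bar_law m (scale (n0 + n))) t \<le> cdf (\<mu> n) t + (d + (\<Sum>j<n. step_err (j + n0)))"
proof (induction n arbitrary: t)
  case 0
  then show ?case using init by simp
next
  case (Suc n)
  have k: "n0 + n \<ge> 1" using n0 by simp
  have "cdf (bar_law m (scale (Suc (n0 + n)))) t \<le> mean_step (bar_law m (scale (n0 + n))) t + step_err (n0 + n)"
    using bar_law_step[OF c k, of m t] by linarith
  also have "mean_step (bar_law m (scale (n0 + n))) t \<le> mean_step (\<mu> n) t + (d + (\<Sum>j<n. step_err (j + n0)))"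
    by (intro mean_step_nonexpansive \<mu> real_distribution_bar_law scale_pos c k Suc.IH add_nonneg_nonneg d
        sum_nonneg step_err_nonneg)
  also have "mean_step (\<mu> n) t = cdf (\<mu> (Suc n)) t" by (rule rec[symmetric])
  finally show ?case by (simp add: add.commute add.left_commute)
qed

text \<open>The translation \<open>m\<close> and the time shift \<open>n0\<close> of the comparison
  profile are invisible after normalization, as the scale diverges with ratio of shifted terms
  tending to 1.\<close>

lemma scale_ratio_tendsto:
  assumes c: "c_mean > 0"
  shows "(\<lambda>n. (y * scale n - m) / scale (n0 + n)) \<longlonglongrightarrow> y"
proof -
  let ?c = "9 / 2 * c_mean"
  have top: "filterlim (\<lambda>n. real (n0 + n)) at_top sequentially"
    using filterlim_compose[OF filterlim_real_sequentially filterlim_add_const_nat_at_top[of n0]]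
    by (simp only: add.commute)
  have lin: "filterlim (\<lambda>n. ?c * real (n0 + n)) at_top sequentially"
    using c by (intro filterlim_tendsto_pos_mult_at_top[OF tendsto_const] top) simp
  have inf: "filterlim (\<lambda>n. scale (n0 + n)) at_top sequentially"
  proof -
    have "filterlim (\<lambda>x :: real. exp (1 / 3 * ln x)) at_top at_top"
      by (intro filterlim_compose[OF exp_at_top] filterlim_tendsto_pos_mult_at_top[OF tendsto_const] ln_at_top) simp
    moreover have "\<forall>\<^sub>F x :: real in at_top. exp (1 / 3 * ln x) = x powr (1 / 3)"
      using eventually_gt_at_top[of 0] by eventually_elim (simp add: powr_def)
    ultimately have "filterlim (\<lambda>x :: real. x powr (1 / 3)) at_top at_top"
      by (rule filterlim_mono_eventually[OF _ order_refl order_refl])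
    from filterlim_compose[OF this lin] show ?thesis by (simp only: scale_def)
  qed
  have "(\<lambda>n. real n / real (n0 + n)) \<longlonglongrightarrow> 1"
  proof (rule Lim_transform_eventually)
    show "(\<lambda>n. 1 - real n0 * inverse (real (n0 + n))) \<longlonglongrightarrow> 1"
      using tendsto_diff[OF tendsto_const tendsto_mult[OF tendsto_const tendsto_inverse_0_at_top[OF top]], of 1 "real n0"]
      by simp
    show "\<forall>\<^sub>F n in sequentially. 1 - real n0 * inverse (real (n0 + n)) = real n / real (n0 + n)"
      using eventually_ge_at_top[of 1] by eventually_elim (simp add: field_simps)
  qed
  then have r: "(\<lambda>n. (real n / real (n0 + n)) powr (1 / 3)) \<longlonglongrightarrow> 1 powr (1 / 3)"
    by (intro tendsto_powr tendsto_const) simp_all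
  have "\<forall>\<^sub>F n in sequentially. (real n / real (n0 + n)) powr (1 / 3) = scale n / scale (n0 + n)"
    using eventually_ge_at_top[of 1]
  proof eventually_elim
    case (elim n)
    then show ?case using c unfolding scale_def by (subst powr_divide[symmetric]) auto
  qed
  with r have "(\<lambda>n. scale n / scale (n0 + n)) \<longlonglongrightarrow> 1"
    by (subst (asm) tendsto_cong) auto
  then have "(\<lambda>n. y * (scale n / scale (n0 + n)) - m / scale (n0 + n)) \<longlonglongrightarrow> y * 1 - 0"
    by (intro tendsto_diff tendsto_mult tendsto_const tendsto_divide_0[OF tendsto_const] filterlim_at_top_imp_at_infinity inf)
  then show ?thesis by (simp add: diff_divide_distrib)
qed

theorem cdf_tendsto_bar_cdf:
  assumes c: "c_mean > 0" and \<mu>: "\<And>n. real_distribution (\<mu> n)"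
    and rec: "\<And>n u. cdf (\<mu> (Suc n)) u = mean_step (\<mu> n) u"
  shows "(\<lambda>n. cdf (\<mu> n) (y * scale n)) \<longlonglongrightarrow> bar_cdf y"
proof (rule LIMSEQ_I)
  fix e :: real assume e: "e > 0"
  \<comment> \<open>One \<open>d\<close> each for the initial comparison, for the tail of the step
    errors and for convergence of the profile; the total \<open>3 d\<close> stays below
    \<open>e\<close>.\<close>
  define d where "d = e / 4"
  have d: "d > 0" using e by (simp add: d_def)
  interpret \<mu>0: real_distribution "\<mu> 0" by (rule \<mu>)
  obtain n1 where n1: "\<And>n. n \<ge> n1 \<Longrightarrow> norm (\<Sum>j. step_err (j + n)) < d"
    using suminf_exist_split[OF d step_err_summable] by blast
  \<comment> \<open>The scale is fixed by the tail of the errors, independently of the initial law,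
    which only affects the translations chosen below. The maximum with 1 keeps
    \<open>scale n0\<close> positive.\<close>
  define n0 where "n0 = max 1 n1"
  have n0: "n0 \<ge> 1" by (simp add: n0_def)
  have tail: "(\<Sum>j<n. step_err (j + n0)) \<le> d" for n
  proof -
    have "(\<Sum>j<n. step_err (j + n0)) \<le> (\<Sum>j. step_err (j + n0))"
      using step_err_summable step_err_nonneg by (intro sum_le_suminf) (auto simp: summable_iff_shift)
    also have "\<dots> \<le> d" using n1[of n0] by (simp add: n0_def)
    finally show ?thesis .
  qed
  let ?s = "scale n0"
  have s: "?s > 0" by (rule scale_pos[OF c n0])
  obtain a where a: "cdf (\<mu> 0) a \<le> d"
  proof -
    have "\<forall>\<^sub>F t in at_bot. cdf (\<mu> 0) t < d"
      using order_tendstoD(2)[OF \<mu>0.cdf_lim_at_bot d] .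
    then obtain t where "cdf (\<mu> 0) t < d"
      using eventually_happens'[OF trivial_limit_at_bot_linorder] by blast
    then show thesis by (intro that[of t]) simp
  qed
  obtain b where b: "cdf (\<mu> 0) b \<ge> 1 - d"
  proof -
    have "\<forall>\<^sub>F t in at_top. cdf (\<mu> 0) t > 1 - d"
      using order_tendstoD(1)[OF \<mu>0.cdf_lim_at_top_prob, of "1 - d"] d by simp
    then obtain t where "cdf (\<mu> 0) t > 1 - d"
      using eventually_happens'[OF trivial_limit_at_top_linorder] by blast
    then show thesis by (intro that[of t]) simp
  qed
  \<comment> \<open>This profile lives on \<open>{a - 2 * ?s..a}\<close>: its distribution function
    is already 1 beyond \<open>a\<close>, and up to \<open>a\<close> that of \<open>\<mu> 0\<close>
    is at most \<open>d\<close>.\<close>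
  have up0: "cdf (\<mu> 0) t \<le> cdf (bar_law (a - ?s) ?s) t + d" for t
  proof (cases "t \<le> a")
    case True
    then have "cdf (\<mu> 0) t \<le> d" using \<mu>0.cdf_nondecreasing[OF True] a by simp
    then show ?thesis using bar_cdf_nonneg by (simp add: cdf_bar_law[OF s] add_increasing)
  next
    case False
    then have "(t - (a - ?s)) / ?s \<ge> 1" using s by (simp add: field_simps)
    then show ?thesis using \<mu>0.cdf_bounded_prob[of t] d by (simp add: cdf_bar_law[OF s] bar_cdf_above)
  qed
  \<comment> \<open>Symmetrically, this profile has no mass before \<open>b\<close>, where
    \<open>\<mu> 0\<close> has already accumulated \<open>1 - d\<close>.\<close>
  have lo0: "cdf (bar_law (b + ?s) ?s) t \<le> cdf (\<mu> 0) t + d" for t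
  proof (cases "b \<le> t")
    case True
    then have "1 - d \<le> cdf (\<mu> 0) t" using \<mu>0.cdf_nondecreasing[OF True] b by simp
    moreover have "cdf (bar_law (b + ?s) ?s) t \<le> 1" using bar_cdf_le_1 by (simp add: cdf_bar_law[OF s])
    ultimately show ?thesis by simp
  next
    case False
    then have "(t - (b + ?s)) / ?s \<le> -1" using s by (simp add: field_simps)
    then show ?thesis using \<mu>0.cdf_nonneg[of t] d by (simp add: cdf_bar_law[OF s] bar_cdf_below)
  qed
  have up: "cdf (\<mu> n) t \<le> bar_cdf ((t - (a - ?s)) / scale (n0 + n)) + 2 * d" for n t
    using iterate_upper[OF c \<mu> rec n0 _ up0, of n t] d tail[of n] scale_pos[OF c, of "n0 + n"] n0
    by (simp add: cdf_bar_law)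
  have lo: "bar_cdf ((t - (b + ?s)) / scale (n0 + n)) \<le> cdf (\<mu> n) t + 2 * d" for n t
    using iterate_lower[OF c \<mu> rec n0 _ lo0, of n t] d tail[of n] scale_pos[OF c, of "n0 + n"] n0
    by (simp add: cdf_bar_law)
  have lim: "(\<lambda>n. bar_cdf ((y * scale n - m) / scale (n0 + n))) \<longlonglongrightarrow> bar_cdf y" for m
    using continuous_bar_cdf[of UNIV] scale_ratio_tendsto[OF c, of y m n0]
    by (rule continuous_on_tendsto_compose) auto
  have "\<forall>\<^sub>F n in sequentially. bar_cdf ((y * scale n - (a - ?s)) / scale (n0 + n)) < bar_cdf y + d"
    using order_tendstoD(2)[OF lim] d by simp
  moreover have "\<forall>\<^sub>F n in sequentially. bar_cdf ((y * scale n - (b + ?s)) / scale (n0 + n)) > bar_cdf y - d"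
    using order_tendstoD(1)[OF lim] d by simp
  ultimately have "\<forall>\<^sub>F n in sequentially. norm (cdf (\<mu> n) (y * scale n) - bar_cdf y) < e"
  proof eventually_elim
    case (elim n)
    have "cdf (\<mu> n) (y * scale n) - bar_cdf y < 4 * d" "- (4 * d) < cdf (\<mu> n) (y * scale n) - bar_cdf y"
      using elim up[of n "y * scale n"] lo[of "y * scale n" n] d by linarith+
    then show ?case by (simp add: d_def abs_less_iff)
  qed
  then show "\<exists>no. \<forall>n\<ge>no. norm (cdf (\<mu> n) (y * scale n) - bar_cdf y) < e"
    by (simp add: eventually_sequentially)
qed

end

section \<open>Identification of the limit law\<close>

lemma bar_cdf_eq_integral:
  "(LBINT x:{..y}. 3 / 4 * (1 - x\<^sup>2) * indicator {x. \<bar>x\<bar> < 1} x) = bar_cdf y"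
proof -
  have d: "bar_density x = 3 / 4 * (1 - x\<^sup>2) * indicator {x. \<bar>x\<bar> < 1} x" for x
    by (cases "\<bar>x\<bar> < 1") (simp_all add: bar_density_inside bar_density_outside)
  have "(LBINT x:{..y}. 3 / 4 * (1 - x\<^sup>2) * indicator {x. \<bar>x\<bar> < 1} x)
      = (\<integral>x. bar_density x * indicator {..y} x \<partial>lborel)"
    unfolding set_lebesgue_integral_def d[symmetric] by (simp add: mult.commute)
  also have "\<dots> = enn2real (\<integral>\<^sup>+x. ennreal (bar_density x) * indicator {..y} x \<partial>lborel)"
  proof (rule integral_indicator_enn2real(2))
    show "(\<integral>\<^sup>+x. ennreal (bar_density x) * indicator {..y} x \<partial>lborel) < \<infinity>"
      using bar_law_atMost[of 1 0 y] by (simp add: bar_law_def emeasure_density bar_law_density_def)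
  qed (simp_all add: bar_density_nonneg)
  also have "(\<integral>\<^sup>+x. ennreal (bar_density x) * indicator {..y} x \<partial>lborel) = ennreal (bar_cdf y)"
    using bar_law_atMost[of 1 0 y] by (simp add: bar_law_def emeasure_density bar_law_density_def)
  finally show ?thesis using bar_cdf_nonneg by simp
qed

theorem theorem1p13:
  fixes M :: "'a measure"
    and F :: "'a \<Rightarrow> real \<times> real \<Rightarrow> real"
    and Fn :: "nat \<Rightarrow> 'a \<Rightarrow> real \<times> real \<Rightarrow> real"
    and X X' :: "nat \<Rightarrow> 'a \<Rightarrow> real"
    and \<eta> :: real
  assumes "prob_space M"
    and "H_random_function M F"
    and "\<And>n. X n \<in> borel_measurable M"
    and "\<And>n \<omega>. \<omega> \<in> space M \<Longrightarrow> X n \<omega> > 0"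
    and "\<And>n. prob_space.indep_var M borel (X n) borel (X' n)"
    and "\<And>n. distr M borel (X' n) = distr M borel (X n)"
    and "\<And>n. indep_rv M C0_borel (Fn n) borel (\<lambda>\<omega>. (X n \<omega>, X' n \<omega>))"
    and "\<And>n. distr M C0_borel (Fn n) = distr M C0_borel F"
    and "\<And>n. distr M borel (X (Suc n)) = distr M borel (\<lambda>\<omega>. Fn n \<omega> (X n \<omega>, X' n \<omega>))"
    and "0 < \<eta>" and "\<eta> < 1"
    and "measure M {\<omega> \<in> space M. F \<omega> \<notin> {phi_plus, phi_minus}} > 0"
    and "(\<integral>\<^sup>+\<omega>. M_fun \<eta> (F \<omega>) \<partial>M) < \<infinity>"
    and "(\<integral>\<omega>. eps (F \<omega>) \<partial>M) = 0"
    and "(\<integral>\<omega>. enn2real (Gamma_fun 0 1 (F \<omega>)) * eps (F \<omega>) \<partial>M) = 0"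
  shows "0 < c_star M F \<and> c_star M F < \<infinity> \<and>
    (\<forall>y. (\<lambda>n. measure M {\<omega> \<in> space M.
              ln (X n \<omega>) / (enn2real (c_star M F) * real n) powr (1 / 3) \<le> y})
          \<longlonglongrightarrow> (LBINT x:{..y}. 3 / 4 * (1 - x\<^sup>2) * indicator {x. \<bar>x\<bar> < 1} x))"
proof -
  interpret critical_step M F \<eta>
    by (intro critical_step.intro critical_step_axioms.intro assms)
  define \<mu> where "\<mu> n = distr M borel (\<lambda>\<omega>. ln (X n \<omega>))" for n
  have [measurable]: "X n \<in> borel_measurable M" for n by (rule assms(3))
  have \<mu>: "real_distribution (\<mu> n)" for n unfolding \<mu>_def by (intro real_distribution_distr) simp
  have c: "c_mean > 0" by (rule c_mean_pos[OF assms(12)])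
  have rec: "cdf (\<mu> (Suc n)) u = mean_step (\<mu> n) u" for n u
    unfolding \<mu>_def mean_step_def
    by (rule cdf_step[OF assms(1) F_measurable assms(3,4,3,4,5,6,7,8,9)])
  have "(\<lambda>n. measure M {\<omega> \<in> space M. ln (X n \<omega>) / (enn2real (c_star M F) * real n) powr (1 / 3) \<le> y})
      \<longlonglongrightarrow> bar_cdf y" for y
  proof (rule Lim_transform_eventually[OF cdf_tendsto_bar_cdf[where \<mu>=\<mu>, OF c \<mu> rec]])
    show "\<forall>\<^sub>F n in sequentially. cdf (\<mu> n) (y * scale n)
        = measure M {\<omega> \<in> space M. ln (X n \<omega>) / (enn2real (c_star M F) * real n) powr (1 / 3) \<le> y}"
      \<comment> \<open>At \<open>n = 0\<close> the normalization is \<open>0\<close>; from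
        \<open>n = 1\<close> on it is positive and the quotient can be cleared.\<close>
      using eventually_ge_at_top[of 1]
    proof eventually_elim
      case (elim n)
      have s: "(enn2real (c_star M F) * real n) powr (1 / 3) = scale n"
        using c by (simp add: c_star_eq scale_def)
      have "(\<lambda>\<omega>. ln (X n \<omega>)) -` {..y * scale n} \<inter> space M = {\<omega> \<in> space M. ln (X n \<omega>) / scale n \<le> y}"
        using scale_pos[OF c elim] by (auto simp: divide_le_eq)
      then show ?case unfolding s cdf_def \<mu>_def by (subst measure_distr) simp_all
    qed
  qed
  then show ?thesis
    unfolding bar_cdf_eq_integral using c by (intro conjI allI) (simp_all only: c_star_eq, simp_all)
qed

end
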